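(* Let $\underline Q$ be an arbitrary lower transition rate operator, let $\mathcal Q_{\underline Q}=\{Q\in\mathcal R: Qf\ge\underline Qf\text{ for all }f\in\mathcal L(\mathcal X)\}$ be its set of dominating rate matrices, and let $L_t^s$ ($0\le t\le s$) be the lower transition operators corresponding to $\underline Q$. Then the largest (with respect to inclusion) non-empty set of stochastic processes $\mathcal P$ whose conditional lower expectation operator $\underline{\mathbb E}[\cdot|\cdot]=\inf\{\mathbb E_P[\cdot|\cdot]:P\in\mathcal P\}$ satisfies $$\underline{\mathbb E}[f(X_s)\mid X_t=x_t,X_u=x_u]=[L_t^sf](x_t)$$ for all $t,s\in\mathbb R_{\ge0}$ with $t\le s$, all $u\in\mathcal U_{<t}$, all $x_t\in\mathcal X$ and $x_u\in\mathcal X_u$, and every $f\in\mathcal L(\mathcal X)$, is the set $\mathbb P^{\mathrm W}_{\mathcal Q_{\underline Q}}$ of all well-behaved stochastic processes that are consistent with $\mathcal Q_{\underline Q}$. (That is, $\mathbb P^{\mathrm W}_{\mathcal Q_{\underline Q}}$ has this property, and every set of stochastic processes with this property is a subset of it.)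
   Context: State space and operators. $\mathcal X$ is a fixed finite non-empty state space; $\mathcal L(\mathcal X)$ is the set of all $f:\mathcal X\to\mathbb R$, with $\|f\|=\max_x|f(x)|$; inequalities between functions are pointwise. A non-negatively homogeneous operator $A:\mathcal L(\mathcal X)\to\mathcal L(\mathcal X)$ has norm $\|A\|=\sup\{\|Af\|:\|f\|=1\}$. Matrices are real, indexed by $\mathcal X\times\mathcal X$, and act by $[Af](x)=\sum_yA(x,y)f(y)$. $I$ is the identity. A rate matrix is a matrix $Q$ with $\sum_yQ(x,y)=0$ for all $x$ and $Q(x,y)\ge0$ for $x\ne y$; $\mathcal R$ is the set of all of them. A lower transition rate operator is a map $\underline Q:\mathcal L(\mathcal X)\to\mathcal L(\mathcal X)$ such that $\underline Q\mu=0$ for constant $\mu$; $[\underline Q\mathbb I_y](x)\ge0$ for $x\ne y$; $\underline Q(f+g)\ge\underline Qf+\underline Qg$; $\underline Q(\lambda f)=\lambda\underline Qf$ for $\lambda\ge0$. A lower transition operator is a map $\underline T:\mathcal L(\mathcal X)\to\mathcal L(\mathcal X)$ with $[\underline Tf](x)\ge\min f$, $\underline T(f+g)\ge\underline Tf+\underline Tg$ and $\underline T(\lambda f)=\lambda\underline Tf$ for $\lambda\ge0$. For $t\le s$, $\mathcal U_{[t,s]}$ is the set of finite sequences $v:\ t=t_0<t_1<\dots<t_n=s$; $\Delta_i=t_i-t_{i-1}$, $\sigma(v)=\max_i\Delta_i$ ($0$ if $n=0$), $\Phi_v=(I+\Delta_1\underline Q)\cdots(I+\Delta_n\underline Q)$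 ($I$ if $n=0$). The lower transition operator $L_t^s$ corresponding to $\underline Q$ is the (existing, unique) lower transition operator such that for every $\epsilon>0$ there is $\delta>0$ with $\|L_t^s-\Phi_v\|\le\epsilon$ for all $v\in\mathcal U_{[t,s]}$ with $\sigma(v)\le\delta$. Stochastic processes. $\mathcal U$ is the set of all finite (possibly empty) strictly increasing sequences in $\mathbb R_{\ge0}$, identified with finite subsets; $\mathcal U_{<t}$ consists of those with all elements $<t$. "$t>u$" means $t$ exceeds every element of $u$ (true if $u=\emptyset$). $\mathcal X_u=\prod_{t\in u}\mathcal X$, elements $x_u=(x_t)_{t\in u}$. $\Omega$ is a fixed set of paths $\omega:\mathbb R_{\ge0}\to\mathcal X$ such that for every non-empty $u\in\mathcal U$ and $x_u\in\mathcal X_u$ some $\omega\in\Omega$ satisfies $\omega|_u=x_u$. $(X_t=x)=\{\omega\in\Omega:\omega(t)=x\}$, $(X_u=x_u)=\{\omega\in\Omega:\omega|_u=x_u\}$ ($=\Omega$ if $u=\emptyset$). $\mathcal A_u$ is the algebra of subsets of $\Omega$ generated by the events $(X_t=x)$ with $x\in\mathcal X$ and $t\in u$ or $t>u$. $\mathcal C^{\mathrm{SP}}=\{(A,X_u=x_u):u\in\mathcal U,x_u\in\mathcal X_u,A\in\mathcal A_u\}$. A stochastic process is a map $P:\mathcal C^{\mathrm{SP}}\to\mathbb R$, written $P(A|C)$, that is coherent: for all $n\in\mathbb N$, $(A_i,C_i)\in\mathcal C^{\mathrm{SP}}$, $\lambda_i\in\mathbb R$ ($1\le i\le n$), $\max\{\sum_{i=1}^n\lambda_i\mathbb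 I_{C_i}(\omega)(P(A_i|C_i)-\mathbb I_{A_i}(\omega)):\omega\in\bigcup_iC_i\}\ge0$. For $t\le s$, $u\in\mathcal U_{<t}$, $x_u\in\mathcal X_u$: $T_{t,x_u}^s(x,y)=P(X_s=y|X_t=x,X_u=x_u)$. $P$ is well-behaved if for all $t\ge0$, $u\in\mathcal U_{<t}$, $x_u\in\mathcal X_u$: $\limsup_{\Delta\to0^+}\frac1\Delta\|T_{t,x_u}^{t+\Delta}-I\|<\infty$ and, if $t>0$, $\limsup_{\Delta\to0^+}\frac1\Delta\|T_{t-\Delta,x_u}^{t}-I\|<\infty$. The outer partial derivative $\overline\partial T_{t,x_u}^t$ is the set of all $Q\in\mathcal R$ that are limits of $\frac1{\Delta_i}(T_{t,x_u}^{t+\Delta_i}-I)$ or, if $t>0$, of $\frac1{\Delta_i}(T_{t-\Delta_i,x_u}^t-I)$, for some sequence $\Delta_i\to0^+$. $P$ is consistent with a set $\mathcal Q\subseteq\mathcal R$ if $\overline\partial T_{t,x_u}^t\subseteq\mathcal Q$ for all $t\ge0$, $u\in\mathcal U_{<t}$, $x_u\in\mathcal X_u$. $\mathbb E_P[f(X_s)|X_t=x_t,X_u=x_u]=\sum_{y}f(y)P(X_s=y|X_t=x_t,X_u=x_u)$. *)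

theory Defs
  imports "HOL-Analysis.Analysis"
begin

text \<open>
  The finite state space is a type \<open>'x :: finite\<close>. A function on the state space is a vector
  \<open>f :: real ^ 'x\<close>, so that \<open>\<le>\<close> is pointwise, \<open>infnorm\<close> is the maximum norm, \<open>vec c\<close> is a
  constant function, \<open>axis y 1\<close> is the indicator of \<open>y\<close>, and a matrix \<open>M\<close> acts by \<open>M *v f\<close>.
\<close>

type_synonym 'x operator = "real ^ 'x \<Rightarrow> real ^ 'x"

definition op_norm :: "'x::finite operator \<Rightarrow> real" where
  "op_norm A = (SUP f\<in>{f. infnorm f = 1}. infnorm (A f))"

definition rate_matrices :: "(real ^ 'x ^ 'x::finite) set" where
  "rate_matrices = {Q. (\<forall>x. (\<Sum>y\<in>UNIV. Q $ x $ y) = 0) \<and> (\<forall>x y. x \<noteq> y \<longrightarrow> 0 \<le> Q $ x $ y)}"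

definition lower_rate_operator :: "'x::finite operator \<Rightarrow> bool" where
  "lower_rate_operator Q \<longleftrightarrow>
     (\<forall>c. Q (vec c) = 0) \<and>
     (\<forall>x y. x \<noteq> y \<longrightarrow> 0 \<le> Q (axis y 1) $ x) \<and>
     (\<forall>f g. Q f + Q g \<le> Q (f + g)) \<and>
     (\<forall>c f. 0 \<le> c \<longrightarrow> Q (c *\<^sub>R f) = c *\<^sub>R Q f)"

definition lower_transition_operator :: "'x::finite operator \<Rightarrow> bool" where
  "lower_transition_operator T \<longleftrightarrow>
     (\<forall>f x. Min (range (\<lambda>y. f $ y)) \<le> T f $ x) \<and>
     (\<forall>f g. T f + T g \<le> T (f + g)) \<and>
     (\<forall>c f. 0 \<le> c \<longrightarrow> T (c *\<^sub>R f) = c *\<^sub>R T f)"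

definition dominating_rate_matrices :: "'x::finite operator \<Rightarrow> (real ^ 'x ^ 'x) set" where
  "dominating_rate_matrices Q = {M \<in> rate_matrices. \<forall>f. Q f \<le> M *v f}"


section \<open>The lower transition operators corresponding to a lower transition rate operator\<close>

definition partitions :: "real \<Rightarrow> real \<Rightarrow> real list set" where
  "partitions t s = {v. v \<noteq> [] \<and> hd v = t \<and> last v = s \<and> sorted_wrt (<) v}"

definition mesh :: "real list \<Rightarrow> real" where
  "mesh v = (if length v \<le> 1 then 0 else Max ((\<lambda>i. v ! Suc i - v ! i) ` {i. Suc i < length v}))"

text \<open>The product \<open>(I + (t\<^sub>1 - t\<^sub>0) Q) \<cdots> (I + (t\<^sub>n - t\<^bsub>n-1\<^esub>) Q)\<close> for \<open>v = [t\<^sub>0, \<dots>, t\<^sub>n]\<close>.\<close>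

fun euler_product :: "'x::finite operator \<Rightarrow> real list \<Rightarrow> 'x operator" where
  "euler_product Q [] = id"
| "euler_product Q [r] = id"
| "euler_product Q (r0 # r1 # rs) = (\<lambda>f. f + (r1 - r0) *\<^sub>R Q f) \<circ> euler_product Q (r1 # rs)"

definition corresponding_operator ::
  "'x::finite operator \<Rightarrow> real \<Rightarrow> real \<Rightarrow> 'x operator" where
  "corresponding_operator Q t s =
     (THE L. lower_transition_operator L \<and>
        (\<forall>\<epsilon>>0. \<exists>\<delta>>0. \<forall>v\<in>partitions t s. mesh v \<le> \<delta> \<longrightarrow>
           op_norm (\<lambda>f. L f - euler_product Q v f) \<le> \<epsilon>))"


section \<open>Stochastic processes\<close>

text \<open>
  A path on the non-negative reals is a function on \<open>real\<close> that is \<open>undefined\<close> at negative times.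
  A finite increasing sequence \<open>u\<close> of time points is its set of elements, and a state
  assignment \<open>x\<^sub>u\<close> is an element of \<open>u \<rightarrow>\<^sub>E UNIV\<close>.
\<close>

type_synonym 'x path = "real \<Rightarrow> 'x"

type_synonym 'x conditional = "'x path set \<times> 'x path set \<Rightarrow> real"

definition time_seqs :: "real set set" where
  "time_seqs = {u. finite u \<and> u \<subseteq> {0..}}"

definition time_seqs_before :: "real \<Rightarrow> real set set" where
  "time_seqs_before t = {u \<in> time_seqs. \<forall>r\<in>u. r < t}"

definition path_space :: "'x path set \<Rightarrow> bool" where
  "path_space \<Omega> \<longleftrightarrow> \<Omega> \<subseteq> ({0..} \<rightarrow>\<^sub>E UNIV) \<and>
     (\<forall>u\<in>time_seqs. u \<noteq> {} \<longrightarrow> (\<forall>xu \<in> u \<rightarrow>\<^sub>E UNIV. \<exists>\<omega>\<in>\<Omega>. restrict \<omega> u = xu))"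

definition state_event :: "'x path set \<Rightarrow> real \<Rightarrow> 'x \<Rightarrow> 'x path set" where
  "state_event \<Omega> t x = {\<omega>\<in>\<Omega>. \<omega> t = x}"

definition history_event :: "'x path set \<Rightarrow> real set \<Rightarrow> (real \<Rightarrow> 'x) \<Rightarrow> 'x path set" where
  "history_event \<Omega> u xu = {\<omega>\<in>\<Omega>. restrict \<omega> u = xu}"

definition event_algebra :: "'x path set \<Rightarrow> real set \<Rightarrow> 'x path set set" where
  "event_algebra \<Omega> u =
     \<Inter>{M. algebra \<Omega> M \<and>
         {state_event \<Omega> t x | t x. 0 \<le> t \<and> (t \<in> u \<or> (\<forall>r\<in>u. r < t))} \<subseteq> M}"

definition process_domain :: "'x path set \<Rightarrow> ('x path set \<times> 'x path set) set" where
  "process_domain \<Omega> =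
     {(A, history_event \<Omega> u xu) | A u xu.
        u \<in> time_seqs \<and> xu \<in> u \<rightarrow>\<^sub>E UNIV \<and> A \<in> event_algebra \<Omega> u}"

text \<open>
  The gain below takes finitely many values, and on a path space the conditioning events
  are non-empty, so that \<open>Max\<close> is a genuine maximum.
\<close>

definition coherent :: "'x path set \<Rightarrow> 'x conditional \<Rightarrow> bool" where
  "coherent \<Omega> P \<longleftrightarrow>
     (\<forall>n\<ge>1. \<forall>(A :: nat \<Rightarrow> 'x path set) C (l :: nat \<Rightarrow> real).
        (\<forall>i\<in>{1..n}. (A i, C i) \<in> process_domain \<Omega>) \<longrightarrow>
        0 \<le> Max ((\<lambda>\<omega>. \<Sum>i=1..n. l i * indicator (C i) \<omega> * (P (A i, C i) - indicator (A i) \<omega>))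
                  ` (\<Union>i\<in>{1..n}. C i)))"

text \<open>Extensionality makes equality of processes equality on \<open>process_domain\<close>.\<close>

definition stochastic_processes :: "'x path set \<Rightarrow> 'x conditional set" where
  "stochastic_processes \<Omega> = {P \<in> extensional (process_domain \<Omega>). coherent \<Omega> P}"

definition transition_matrix ::
  "'x::finite path set \<Rightarrow> 'x conditional \<Rightarrow> real set \<Rightarrow> (real \<Rightarrow> 'x) \<Rightarrow> real \<Rightarrow> real
     \<Rightarrow> real ^ 'x ^ 'x" where
  "transition_matrix \<Omega> P u xu t s =
     (\<chi> x y. P (state_event \<Omega> s y, state_event \<Omega> t x \<inter> history_event \<Omega> u xu))"

definition well_behaved :: "'x::finite path set \<Rightarrow> 'x conditional \<Rightarrow> bool" where
  "well_behaved \<Omega> P \<longleftrightarrow>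
     (\<forall>t\<ge>0. \<forall>u\<in>time_seqs_before t. \<forall>xu \<in> u \<rightarrow>\<^sub>E UNIV.
        Limsup (at_right 0) (\<lambda>\<Delta>. ereal
          (1 / \<Delta> * op_norm ((*v) (transition_matrix \<Omega> P u xu t (t + \<Delta>) - mat 1)))) < \<infinity> \<and>
        (t > 0 \<longrightarrow> Limsup (at_right 0) (\<lambda>\<Delta>. ereal
          (1 / \<Delta> * op_norm ((*v) (transition_matrix \<Omega> P u xu (t - \<Delta>) t - mat 1)))) < \<infinity>))"

text \<open>
  In the second alternative only finitely many \<open>i\<close> can violate \<open>u < t - \<Delta> i\<close> or
  \<open>0 \<le> t - \<Delta> i\<close>; these do not affect the limit.
\<close>

definition outer_derivative ::
  "'x::finite path set \<Rightarrow> 'x conditional \<Rightarrow> real set \<Rightarrow> (real \<Rightarrow> 'x) \<Rightarrow> real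
     \<Rightarrow> (real ^ 'x ^ 'x) set" where
  "outer_derivative \<Omega> P u xu t =
     {Q \<in> rate_matrices. \<exists>\<Delta>. (\<forall>i. \<Delta> i > 0) \<and> \<Delta> \<longlonglongrightarrow> 0 \<and>
        ((\<lambda>i. (1 / \<Delta> i) *\<^sub>R (transition_matrix \<Omega> P u xu t (t + \<Delta> i) - mat 1)) \<longlonglongrightarrow> Q \<or>
         (t > 0 \<and>
          (\<lambda>i. (1 / \<Delta> i) *\<^sub>R (transition_matrix \<Omega> P u xu (t - \<Delta> i) t - mat 1)) \<longlonglongrightarrow> Q))}"

definition consistent ::
  "'x::finite path set \<Rightarrow> (real ^ 'x ^ 'x) set \<Rightarrow> 'x conditional \<Rightarrow> bool" where
  "consistent \<Omega> \<Q> P \<longleftrightarrow>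
     (\<forall>t\<ge>0. \<forall>u\<in>time_seqs_before t. \<forall>xu \<in> u \<rightarrow>\<^sub>E UNIV. outer_derivative \<Omega> P u xu t \<subseteq> \<Q>)"

definition well_behaved_consistent_processes ::
  "'x::finite path set \<Rightarrow> (real ^ 'x ^ 'x) set \<Rightarrow> 'x conditional set" where
  "well_behaved_consistent_processes \<Omega> \<Q> =
     {P \<in> stochastic_processes \<Omega>. well_behaved \<Omega> P \<and> consistent \<Omega> \<Q> P}"

text \<open>The expectation of \<open>f(X\<^sub>s)\<close> conditional on \<open>X\<^sub>t = x\<close> and \<open>X\<^sub>u = x\<^sub>u\<close>.\<close>

definition cond_expectation ::
  "'x::finite path set \<Rightarrow> 'x conditional \<Rightarrow> real ^ 'x \<Rightarrow> real \<Rightarrow> real \<Rightarrow> 'x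
     \<Rightarrow> real set \<Rightarrow> (real \<Rightarrow> 'x) \<Rightarrow> real" where
  "cond_expectation \<Omega> P f s t x u xu =
     (\<Sum>y\<in>UNIV. f $ y * P (state_event \<Omega> s y, state_event \<Omega> t x \<inter> history_event \<Omega> u xu))"

definition lower_cond_expectation ::
  "'x::finite path set \<Rightarrow> 'x conditional set \<Rightarrow> real ^ 'x \<Rightarrow> real \<Rightarrow> real \<Rightarrow> 'x
     \<Rightarrow> real set \<Rightarrow> (real \<Rightarrow> 'x) \<Rightarrow> real" where
  "lower_cond_expectation \<Omega> \<P> f s t x u xu = (INF P\<in>\<P>. cond_expectation \<Omega> P f s t x u xu)"

text \<open>
  The non-empty sets of stochastic processes whose conditional lower expectations are given by
  the operators corresponding to \<open>Q\<close>.
\<close>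

definition represents ::
  "'x::finite path set \<Rightarrow> 'x operator \<Rightarrow> 'x conditional set \<Rightarrow> bool" where
  "represents \<Omega> Q \<P> \<longleftrightarrow>
     \<P> \<noteq> {} \<and> \<P> \<subseteq> stochastic_processes \<Omega> \<and>
     (\<forall>t s f. \<forall>u\<in>time_seqs_before t. \<forall>x. \<forall>xu \<in> u \<rightarrow>\<^sub>E UNIV. 0 \<le> t \<and> t \<le> s \<longrightarrow>
        lower_cond_expectation \<Omega> \<P> f s t x u xu = corresponding_operator Q t s f $ x)"

end

theory Submission imports Defs begin

text \<open>
  Writing \<open>L\<close> for the corresponding operators, the refinement estimate for Euler products gives
  \<open>L t s f = f + (s - t) Q f + O((s - t)\<^sup>2)\<close> and \<open>L t s = L t r \<circ> L r s\<close>.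

  Lower bound: for a well-behaved process consistent with the dominating rate matrices, every
  small increment of the transition matrix is, up to \<open>\<epsilon> h\<close>, that of a dominating rate matrix.
  Hence the conditional expectation \<open>\<phi> r\<close> of \<open>(L r s f)(X\<^sub>r)\<close> satisfies \<open>\<phi> b - \<phi> a \<ge> - \<epsilon> (b - a)\<close>
  locally, therefore globally on \<open>[t, s]\<close>, and \<open>\<phi> t \<le> \<phi> s\<close> is the claim.

  Attainment: on a fine partition, \<open>Q\<close> may be replaced in each factor of the Euler product by a
  dominating rate matrix that agrees with it on the function it is applied to. The resulting
  piecewise constant rates define a Markov process whose expectation is close to \<open>L t s f\<close>.
  No countably additive measure is needed for it: coherence only involves finitely many time
  points, where it follows from strictly positive perturbed chains, and compactness does the rest.

  Maximality: a process dominating \<open>L\<close> has increments dominating \<open>h Q f - O(h\<^sup>2)\<close>, which yields both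
  well-behavedness and the domination of all cluster points.
\<close>

section \<open>Lower transition operators\<close>

text \<open>All error terms are controlled by one fact: for steps \<open>h\<close> with
  \<open>h * C \<le> 1\<close>, where \<open>C\<close> is a Lipschitz constant of \<open>Q\<close>,
  each Euler factor is a lower transition operator and hence nonexpansive in the maximum norm.
  Errors of successive factors therefore add up and are never amplified. Dominating rate matrices
  inherit the same \<open>C\<close>, which makes the estimates uniform in the choice of rates.

  The obstacle in the lower bound is that a process need not be Markov and that its derivatives need
  not exist: the interval on which increments are controlled depends on the time and the history.
  Bisection of \<open>[t, s]\<close> takes the place of uniformity. It needs control on both sides
  of each point, which is why left and right increments both enter.

  The obstacle in the construction is conditioning on events that may have probability zero.
  Strictly positive kernels remove it but violate the Chapman-Kolmogorov equation; the bound for the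
  resulting error grows with the number of time points, so the perturbation is chosen depending on
  the time set.\<close>

lemma infnorm_le_cart: "infnorm (f :: real ^ 'x::finite) \<le> c \<longleftrightarrow> (\<forall>x. \<bar>f $ x\<bar> \<le> c)"
proof
  assume "infnorm f \<le> c"
  then show "\<forall>x. \<bar>f $ x\<bar> \<le> c"
    using component_le_infnorm_cart order_trans by blast
next
  assume "\<forall>x. \<bar>f $ x\<bar> \<le> c"
  then show "infnorm f \<le> c"
    unfolding infnorm_cart by (intro cSup_least) auto
qed

lemma infnorm_diff_triangle:
  "infnorm (f - h) \<le> infnorm (f - g) + infnorm (g - h)"
  using infnorm_triangle[of "f - g" "g - h"] by simp

lemma infnorm_vec_1: "infnorm (vec 1 :: real ^ 'x::finite) = 1"
proof -
  have "infnorm (vec 1 :: real ^ 'x) \<le> 1" by (simp add: infnorm_le_cart)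
  moreover have "\<bar>(vec 1 :: real ^ 'x) $ undefined\<bar> \<le> infnorm (vec 1 :: real ^ 'x)"
    by (rule component_le_infnorm_cart)
  ultimately show ?thesis by simp
qed

lemma lower_transition_operatorI:
  assumes "\<And>f x c. (\<And>y. c \<le> f $ y) \<Longrightarrow> c \<le> T f $ x"
    and "\<And>f g. T f + T g \<le> T (f + g)"
    and "\<And>c f. 0 \<le> c \<Longrightarrow> T (c *\<^sub>R f) = c *\<^sub>R T f"
  shows "lower_transition_operator T"
  unfolding lower_transition_operator_def
  using assms by (auto intro!: assms(1) Min_le)

context
  fixes T :: "'x::finite operator"
  assumes T: "lower_transition_operator T"
begin

lemma lto_ge:
  assumes "\<And>y. c \<le> f $ y" shows "c \<le> T f $ x"
proof -
  have "c \<le> Min (range (\<lambda>y. f $ y))" using assms by simp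
  also have "\<dots> \<le> T f $ x" using T by (simp add: lower_transition_operator_def)
  finally show ?thesis .
qed

lemma lto_add: "T f $ x + T g $ x \<le> T (f + g) $ x"
  using T by (auto simp: lower_transition_operator_def less_eq_vec_def)

lemma lto_scale: "0 \<le> c \<Longrightarrow> T (c *\<^sub>R f) = c *\<^sub>R T f"
  using T by (auto simp: lower_transition_operator_def)

lemma lto_zero: "T 0 = 0"
  using lto_scale[of 0 0] by simp

lemma lto_mono:
  assumes "f \<le> g"
  shows "T f \<le> T g"
proof -
  have "T f $ x \<le> T g $ x" for x
    using lto_add[of f x "g - f"] lto_ge[of 0 "g - f" x] assms by (simp add: less_eq_vec_def)
  then show ?thesis by (simp add: less_eq_vec_def)
qed

text \<open>Superadditivity at \<open>f = g + (f - g)\<close> turns the lower bound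
  \<open>- infnorm (g - f)\<close> of \<open>f - g\<close> into a bound for \<open>T f\<close>. Used
  in both directions it yields nonexpansiveness, although \<open>T\<close> need not be
  linear.\<close>

lemma lto_diff: "T g $ x - T f $ x \<le> infnorm (g - f)"
proof -
  have "- infnorm (g - f) \<le> (f - g) $ y" for y
    using component_le_infnorm_cart[of "g - f" y] by simp
  then have "- infnorm (g - f) \<le> T (f - g) $ x" by (rule lto_ge)
  with lto_add[of g x "f - g"] show ?thesis by simp
qed

lemma lto_nonexpansive: "infnorm (T f - T g) \<le> infnorm (f - g)"
  unfolding infnorm_le_cart
  using lto_diff[of f _ g] lto_diff[of g _ f] by (auto simp: abs_le_iff infnorm_sub)

lemma lto_infnorm_le: "infnorm (T f) \<le> infnorm f"
  using lto_nonexpansive[of f 0] by (simp add: lto_zero)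

end

lemma lower_transition_operator_id: "lower_transition_operator id"
  by (rule lower_transition_operatorI) auto

lemma lower_transition_operator_comp:
  assumes S: "lower_transition_operator S" and T: "lower_transition_operator T"
  shows "lower_transition_operator (S \<circ> T)"
proof (rule lower_transition_operatorI)
  show "c \<le> (S \<circ> T) f $ x" if "\<And>y. c \<le> f $ y" for f x c
    using that by (auto intro: lto_ge[OF S] lto_ge[OF T])
  show "(S \<circ> T) f + (S \<circ> T) g \<le> (S \<circ> T) (f + g)" for f g
  proof -
    have "S (T f) + S (T g) \<le> S (T f + T g)"
      using lto_add[OF S] by (auto simp: less_eq_vec_def)
    also have "\<dots> \<le> S (T (f + g))"
      by (rule lto_mono[OF S]) (use lto_add[OF T] in \<open>auto simp: less_eq_vec_def\<close>)
    finally show ?thesis by simp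
  qed
qed (simp add: lto_scale[OF S] lto_scale[OF T])

section \<open>Partitions and Euler products\<close>

lemma partitions_single [simp]: "[r] \<in> partitions t s \<longleftrightarrow> r = t \<and> r = s"
  by (auto simp: partitions_def)

lemma partitions_Cons_Cons [simp]:
  "a # b # v \<in> partitions t s \<longleftrightarrow> a = t \<and> a < b \<and> b # v \<in> partitions b s"
  by (auto simp: partitions_def)

text \<open>Peels off the first point and keeps the right end \<open>s\<close>, in step with
  \<open>euler_product\<close>, whose outermost factor belongs to the first interval.\<close>

lemma partitions_induct [consumes 1, case_names single Cons]:
  assumes "v \<in> partitions t s"
    and "P s [s]"
    and "\<And>t r v. t < r \<Longrightarrow> r # v \<in> partitions r s \<Longrightarrow> P r (r # v) \<Longrightarrow> P t (t # r # v)"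
  shows "P t v"
  using assms(1)
proof (induction v arbitrary: t)
  case Nil
  then show ?case by (simp add: partitions_def)
next
  case (Cons a v)
  then show ?case using assms(2,3) by (cases v) auto
qed

lemma partitions_le: "v \<in> partitions t s \<Longrightarrow> t \<le> s"
  by (induction rule: partitions_induct) auto

lemma partitions_mem: "v \<in> partitions t s \<Longrightarrow> r \<in> set v \<Longrightarrow> t \<le> r \<and> r \<le> s"
  by (induction arbitrary: r rule: partitions_induct)
     (force dest: partitions_le intro: order_trans)+

text \<open>A bound on the mesh that, unlike the maximum in \<open>mesh\<close>, decomposes along
  the list and so suits induction.\<close>

abbreviation gaps_le :: "real \<Rightarrow> real list \<Rightarrow> bool" where
  "gaps_le \<delta> v \<equiv> successively (\<lambda>a b. b - a \<le> \<delta>) v"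

lemma gaps_le_mono: "gaps_le \<delta> v \<Longrightarrow> \<delta> \<le> \<delta>' \<Longrightarrow> gaps_le \<delta>' v"
  by (auto intro: successively_mono)

lemma gaps_le_conv_nth: "gaps_le \<delta> v \<longleftrightarrow> (\<forall>i. Suc i < length v \<longrightarrow> v ! Suc i - v ! i \<le> \<delta>)"
  by (induction v rule: induct_list012) (auto simp: less_Suc_eq_0_disj)

text \<open>\<open>0 \<le> \<delta>\<close> accounts for lists with at most one point: their mesh is
  \<open>0\<close> by default, while \<open>gaps_le\<close> holds vacuously.\<close>

lemma mesh_le_iff:
  assumes "0 \<le> \<delta>"
  shows "mesh v \<le> \<delta> \<longleftrightarrow> gaps_le \<delta> v"
proof (cases "length v \<le> 1")
  case False
  then have "0 \<in> {i. Suc i < length v}" "finite {i. Suc i < length v}"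
    by (auto intro: finite_subset[of _ "{..length v}"])
  then show ?thesis
    using False unfolding gaps_le_conv_nth mesh_def
    by (subst if_not_P, simp, subst Max_le_iff) blast+
qed (auto simp: gaps_le_conv_nth mesh_def assms)

lemma gaps_le_total: "v \<in> partitions t s \<Longrightarrow> gaps_le (s - t) v"
  by (induction rule: partitions_induct)
     (auto dest: partitions_le elim!: gaps_le_mono)

lemma ex_partition:
  assumes "t \<le> s" "0 < \<delta>"
  shows "\<exists>v\<in>partitions t s. gaps_le \<delta> v"
proof -
  \<comment> \<open>\<open>n\<close> steps of length \<open>\<delta>\<close> suffice to reach
    \<open>s\<close>; each induction step advances the left end by exactly \<open>\<delta>\<close>
    until at most \<open>\<delta>\<close> is left.\<close>
  have "\<exists>v\<in>partitions t s. gaps_le \<delta> v" if "s - t \<le> real n * \<delta>" "t \<le> s" for n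
    using that
  proof (induction n arbitrary: t)
    case 0
    then show ?case by (intro bexI[of _ "[s]"]) auto
  next
    case (Suc n)
    show ?case
    proof (cases "s - t \<le> \<delta>")
      case True
      then show ?thesis
        using Suc.prems by (cases "t = s") (auto intro: bexI[of _ "[s]"] bexI[of _ "[t, s]"])
    next
      case False
      then obtain v where v: "v \<in> partitions (t + \<delta>) s" "gaps_le \<delta> v"
        using Suc.IH[of "t + \<delta>"] Suc.prems by (auto simp: algebra_simps)
      then obtain v' where "v = (t + \<delta>) # v'"
        by (cases v) (auto simp: partitions_def)
      with v have "t # v \<in> partitions t s" "gaps_le \<delta> (t # v)"
        using \<open>0 < \<delta>\<close> by auto
      then show ?thesis by blast
    qed
  qed
  moreover have "\<exists>n. s - t \<le> real n * \<delta>"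
    using assms(2) reals_Archimedean3 less_imp_le by (metis)
  ultimately show ?thesis using assms(1) by blast
qed

lemma partitions_split:
  assumes "xs @ r # ys \<in> partitions t s"
  shows "xs @ [r] \<in> partitions t r" "r # ys \<in> partitions r s"
  using assms by (auto simp: partitions_def sorted_wrt_append hd_append split: if_splits)

lemma partitions_join:
  assumes "xs @ [r] \<in> partitions t r" "r # ys \<in> partitions r s"
  shows "xs @ r # ys \<in> partitions t s"
  using assms by (fastforce simp: partitions_def sorted_wrt_append hd_append split: if_splits)

text \<open>\<open>r\<close> ends one list and begins the other, since factors belong to intervals
  rather than to points.\<close>

lemma euler_product_append:
  "euler_product Q (xs @ r # ys) = euler_product Q (xs @ [r]) \<circ> euler_product Q (r # ys)"
  by (induction xs rule: induct_list012) (auto simp: fun_eq_iff)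

section \<open>Estimates for the operator norm\<close>

lemma op_norm_le:
  assumes "\<And>f. infnorm f = 1 \<Longrightarrow> infnorm (A f) \<le> B"
  shows "op_norm A \<le> B"
proof -
  have "{f :: real ^ 'a. infnorm f = 1} \<noteq> {}" using infnorm_vec_1 by blast
  then show ?thesis unfolding op_norm_def using assms by (intro cSUP_least) auto
qed

text \<open>\<open>B\<close> makes the supremum in \<open>op_norm\<close> a genuine one, over a set
  that is bounded above; homogeneity carries the estimate from the unit sphere to all
  \<open>f\<close>.\<close>

lemma infnorm_le_op_norm:
  assumes bound: "\<And>f. infnorm f = 1 \<Longrightarrow> infnorm (A f) \<le> B"
    and scale: "\<And>c f. 0 \<le> c \<Longrightarrow> A (c *\<^sub>R f) = c *\<^sub>R A f"
  shows "infnorm (A f) \<le> op_norm A * infnorm f"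
proof (cases "f = 0")
  case True
  then show ?thesis using scale[of 0 0] by (simp add: infnorm_0)
next
  case False
  then have pos: "0 < infnorm f" by (simp add: infnorm_pos_lt)
  define g where "g = (1 / infnorm f) *\<^sub>R f"
  have g: "infnorm g = 1" "f = infnorm f *\<^sub>R g"
    using pos False by (simp_all add: g_def infnorm_mul infnorm_eq_0)
  have "infnorm (A g) \<le> op_norm A"
    unfolding op_norm_def using g bound by (intro cSUP_upper bdd_aboveI[of _ B]) auto
  moreover have "A f = infnorm f *\<^sub>R A g" using scale[of "infnorm f" g] pos g(2) by simp
  ultimately show ?thesis using pos by (simp add: infnorm_mul mult.commute)
qed

lemma infnorm_eq_0I:
  assumes "\<And>\<epsilon>. 0 < \<epsilon> \<Longrightarrow> infnorm x \<le> \<epsilon> * K"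
  shows "x = 0"
proof -
  have "((\<lambda>\<epsilon>. \<epsilon> * K) \<longlongrightarrow> 0 * K) (at_right 0)" by (intro tendsto_intros)
  moreover have "eventually (\<lambda>\<epsilon>. infnorm x \<le> \<epsilon> * K) (at_right 0)"
    using assms by (auto intro: eventually_mono[OF eventually_at_right_less])
  ultimately have "infnorm x \<le> 0" by (intro tendsto_lowerbound) auto
  then show ?thesis using infnorm_pos_le[of x] infnorm_eq_0[of x] by simp
qed

text \<open>Every lower rate operator has such a constant. It is a parameter because the development
  is instantiated, with the same \<open>C\<close>, for \<open>Q\<close> and for its dominating rate
  matrices.\<close>

locale lipschitz_rate_operator =
  fixes Q :: "'x::finite operator" and C :: real
  assumes rate: "lower_rate_operator Q"
    and lipschitz: "infnorm (Q f - Q g) \<le> C * infnorm (f - g)"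
    and C_pos: "0 < C"
begin

lemma rate_add: "Q f $ x + Q g $ x \<le> Q (f + g) $ x"
  using rate by (auto simp: lower_rate_operator_def less_eq_vec_def)

lemma rate_scale: "0 \<le> c \<Longrightarrow> Q (c *\<^sub>R f) = c *\<^sub>R Q f"
  using rate by (auto simp: lower_rate_operator_def)

lemma rate_vec: "Q (vec c) = 0"
  using rate by (auto simp: lower_rate_operator_def)

lemma rate_zero: "Q 0 = 0"
  using rate_scale[of 0 0] by simp

lemma rate_bound: "infnorm (Q f) \<le> C * infnorm f"
  using lipschitz[of f 0] by (simp add: rate_zero)

lemma rate_sum: "finite A \<Longrightarrow> (\<Sum>y\<in>A. Q (g y) $ x) \<le> Q (\<Sum>y\<in>A. g y) $ x"
proof (induction A rule: finite_induct)
  case (insert y A)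
  then show ?case using rate_add[of "g y" x "\<Sum>y\<in>A. g y"] by simp
qed (simp add: rate_zero)

text \<open>With \<open>g = f - vec c \<ge> 0\<close>, superadditivity and the non-negative
  off-diagonal entries give \<open>Q f $ x \<ge> Q g $ x \<ge> - (C * g $ x)\<close>. So one step
  lowers \<open>f $ x = c + g $ x\<close> by at most \<open>h * C * g $ x \<le> g $ x\<close>, and
  the result stays above \<open>c\<close>.\<close>

lemma euler_step_lto:
  assumes "0 \<le> h" "h * C \<le> 1"
  shows "lower_transition_operator (\<lambda>f. f + h *\<^sub>R Q f)"
proof (rule lower_transition_operatorI)
  fix f :: "real ^ 'x" and x c assume c: "\<And>y. c \<le> f $ y"
  define g where "g = f - vec c"
  have g: "0 \<le> g $ y" for y using c by (simp add: g_def)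
  have g_sum: "g = (\<Sum>y\<in>UNIV. g $ y *\<^sub>R axis y 1)"
    by (simp add: vec_eq_iff axis_def if_distrib if_distribR cong: if_cong)
  have "Q g $ x + Q (vec c) $ x \<le> Q f $ x"
    using rate_add[of g x "vec c"] by (simp add: g_def)
  then have 1: "Q g $ x \<le> Q f $ x" by (simp add: rate_vec)
  have "\<bar>Q (axis x 1) $ x\<bar> \<le> C * infnorm (axis x 1 :: real ^ 'x)"
    using rate_bound[of "axis x 1"] by (simp add: infnorm_le_cart)
  also have "\<dots> \<le> C * 1"
    using C_pos by (intro mult_left_mono) (auto simp: infnorm_le_cart axis_def)
  finally have ax: "- C \<le> Q (axis x 1) $ x" by simp
  have "- (C * g $ x) \<le> (\<Sum>y\<in>UNIV. if y = x then g $ x * Q (axis x 1) $ x else 0)"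
    using mult_left_mono[OF ax g[of x]] by (simp add: algebra_simps)
  also have "\<dots> \<le> (\<Sum>y\<in>UNIV. Q (g $ y *\<^sub>R axis y 1) $ x)"
    using rate g by (intro sum_mono) (auto simp: rate_scale lower_rate_operator_def)
  also have "\<dots> \<le> Q g $ x"
    by (subst (2) g_sum, rule rate_sum) simp
  finally have 2: "- (C * g $ x) \<le> Q g $ x" .
  have "h * - (C * g $ x) \<le> h * Q f $ x"
    using assms 1 2 by (intro mult_left_mono) auto
  moreover have "h * C * g $ x \<le> 1 * g $ x"
    using assms g by (intro mult_right_mono) auto
  moreover have "f $ x = c + g $ x" by (simp add: g_def)
  ultimately show "c \<le> (f + h *\<^sub>R Q f) $ x" by (simp add: algebra_simps)
next
  fix f g :: "real ^ 'x"
  have "h * (Q f $ x + Q g $ x) \<le> h * Q (f + g) $ x" for x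
    using assms rate_add by (intro mult_left_mono) auto
  then show "f + h *\<^sub>R Q f + (g + h *\<^sub>R Q g) \<le> f + g + h *\<^sub>R Q (f + g)"
    by (auto simp: less_eq_vec_def algebra_simps)
qed (simp add: rate_scale algebra_simps)

lemma euler_lto:
  assumes "v \<in> partitions t s" "gaps_le \<delta> v" "\<delta> * C \<le> 1"
  shows "lower_transition_operator (euler_product Q v)"
  using assms
proof (induction rule: partitions_induct)
  case (Cons t r v)
  have "(r - t) * C \<le> \<delta> * C" using Cons.prems C_pos by (intro mult_right_mono) auto
  then have "lower_transition_operator (\<lambda>f. f + (r - t) *\<^sub>R Q f)"
    using Cons by (intro euler_step_lto) auto
  from lower_transition_operator_comp[OF this Cons.IH] show ?case
    using Cons.prems by (simp add: comp_def)
qed (simp add: lower_transition_operator_id)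

text \<open>The errors depend on the length \<open>s - t\<close> and not on the number of factors.
  The second estimate is what compares one Euler step with any refinement of it; its induction step
  needs the first, through the Lipschitz bound on \<open>Q g - Q f\<close>.\<close>

lemma euler_product_bound:
  assumes "v \<in> partitions t s" "gaps_le \<delta> v" "\<delta> * C \<le> 1"
  shows "infnorm (euler_product Q v f - f) \<le> C * (s - t) * infnorm f"
    and "infnorm (euler_product Q v f - f - (s - t) *\<^sub>R Q f) \<le> C\<^sup>2 * (s - t)\<^sup>2 * infnorm f"
proof -
  have "infnorm (euler_product Q v f - f) \<le> C * (s - t) * infnorm f \<and>
    infnorm (euler_product Q v f - f - (s - t) *\<^sub>R Q f) \<le> C\<^sup>2 * (s - t)\<^sup>2 * infnorm f"
    using assms
  proof (induction rule: partitions_induct)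
    case single
    then show ?case by (simp add: infnorm_0)
  next
    case (Cons t r v)
    define g where "g = euler_product Q (r # v) f"
    define N where "N = infnorm f"
    have N: "0 \<le> N" by (simp add: N_def infnorm_pos_le)
    have le: "r \<le> s" "t < r" using Cons partitions_le by auto
    have IH1: "infnorm (g - f) \<le> C * (s - r) * N"
      and IH2: "infnorm (g - f - (s - r) *\<^sub>R Q f) \<le> C\<^sup>2 * (s - r)\<^sup>2 * N"
      using Cons by (auto simp: g_def N_def)
    have gN: "infnorm g \<le> N"
      unfolding g_def N_def by (rule lto_infnorm_le, rule euler_lto) (use Cons in auto)
    have "infnorm (Q g) \<le> C * N"
      using rate_bound[of g] gN C_pos mult_left_mono[of "infnorm g" N C] by linarith
    then have 1: "infnorm ((r - t) *\<^sub>R Q g) \<le> (r - t) * (C * N)"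
      using le by (auto simp: infnorm_mul)
    have "infnorm (Q g - Q f) \<le> C * (C * (s - r) * N)"
      using lipschitz[of g f] IH1 C_pos mult_left_mono[OF IH1, of C] by linarith
    then have 2: "infnorm ((r - t) *\<^sub>R (Q g - Q f)) \<le> (r - t) * (C * (C * (s - r) * N))"
      using le by (auto simp: infnorm_mul)
    have "infnorm (g + (r - t) *\<^sub>R Q g - f) \<le> infnorm (g - f) + infnorm ((r - t) *\<^sub>R Q g)"
      using infnorm_triangle[of "g - f" "(r - t) *\<^sub>R Q g"] by (simp add: algebra_simps)
    also have "\<dots> \<le> C * (s - r) * N + (r - t) * (C * N)" using IH1 1 by simp
    also have "\<dots> = C * (s - t) * N" by (simp add: algebra_simps)
    finally have A: "infnorm (g + (r - t) *\<^sub>R Q g - f) \<le> C * (s - t) * N" .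
    have "g + (r - t) *\<^sub>R Q g - f - (s - t) *\<^sub>R Q f
        = (g - f - (s - r) *\<^sub>R Q f) + (r - t) *\<^sub>R (Q g - Q f)"
      by (simp add: algebra_simps)
    then have "infnorm (g + (r - t) *\<^sub>R Q g - f - (s - t) *\<^sub>R Q f)
        \<le> infnorm (g - f - (s - r) *\<^sub>R Q f) + infnorm ((r - t) *\<^sub>R (Q g - Q f))"
      using infnorm_triangle by metis
    also have "\<dots> \<le> C\<^sup>2 * (s - r)\<^sup>2 * N + (r - t) * (C * (C * (s - r) * N))"
      using IH2 2 by simp
    also have "\<dots> = C\<^sup>2 * N * ((s - r)\<^sup>2 + (r - t) * (s - r))"
      by (simp add: algebra_simps power2_eq_square)
    also have "\<dots> \<le> C\<^sup>2 * N * (s - t)\<^sup>2"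
    proof (intro mult_left_mono)
      have "(s - t)\<^sup>2 - ((s - r)\<^sup>2 + (r - t) * (s - r)) = (r - t) * (s - t)"
        by (simp add: algebra_simps power2_eq_square)
      moreover have "0 \<le> (r - t) * (s - t)" using le by simp
      ultimately show "(s - r)\<^sup>2 + (r - t) * (s - r) \<le> (s - t)\<^sup>2" by linarith
    qed (use N in auto)
    finally show ?case using A by (simp add: g_def N_def algebra_simps)
  qed
  then show "infnorm (euler_product Q v f - f) \<le> C * (s - t) * infnorm f"
    and "infnorm (euler_product Q v f - f - (s - t) *\<^sub>R Q f) \<le> C\<^sup>2 * (s - t)\<^sup>2 * infnorm f"
    by auto
qed

text \<open>Up to the norm of the function, refining one interval of length
  \<open>r - t \<le> \<delta>\<close> costs at most \<open>C\<^sup>2 * (r - t)\<^sup>2 \<le>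
  C\<^sup>2 * \<delta> * (r - t)\<close>. Nonexpansive factors let these costs add up to a multiple
  of \<open>s - t\<close>.\<close>

lemma euler_product_refine:
  assumes "v \<in> partitions t s" "gaps_le \<delta> v" "\<delta> * C \<le> 1"
    and "w \<in> partitions t s" "set v \<subseteq> set w"
  shows "infnorm (euler_product Q w f - euler_product Q v f) \<le> C\<^sup>2 * \<delta> * (s - t) * infnorm f"
  using assms
proof (induction arbitrary: w rule: partitions_induct)
  case single
  then have "w = [s]"
  proof (cases w)
    case (Cons a w')
    with single show ?thesis
      by (cases w') (use single(3) partitions_le in fastforce)+
  qed (auto simp: partitions_def)
  then show ?case by (simp add: infnorm_0)
next
  case (Cons t r v)
  have le: "r \<le> s" "t < r" using Cons partitions_le by auto
  have N: "0 \<le> infnorm f" by (simp add: infnorm_pos_le)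
  have "r \<in> set w" using Cons.prems by auto
  then obtain xs ys where w: "w = xs @ r # ys" by (meson split_list)
  have xs: "xs @ [r] \<in> partitions t r" and ys: "r # ys \<in> partitions r s"
    using partitions_split Cons.prems(3) w by blast+
  have rest: "set (r # v) \<subseteq> set (r # ys)"
  proof
    fix a assume "a \<in> set (r # v)"
    then have "r \<le> a" "a \<in> set w"
      using partitions_mem[OF Cons.hyps(2)] Cons.prems by auto
    moreover have "b < r" if "b \<in> set xs" for b
      using that Cons.prems(3) by (auto simp: w partitions_def sorted_wrt_append)
    ultimately show "a \<in> set (r # ys)" by (fastforce simp: w)
  qed
  define g g' where "g = euler_product Q (r # v) f" and "g' = euler_product Q (r # ys) f"
  have IH: "infnorm (g' - g) \<le> C\<^sup>2 * \<delta> * (s - r) * infnorm f"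
    unfolding g_def g'_def using Cons rest ys by auto
  have rt: "r - t \<le> \<delta>" using Cons.prems by simp
  \<comment> \<open>\<open>xs @ [r]\<close> subdivides an interval of length at most
    \<open>\<delta>\<close>, so the mesh bound passes from \<open>v\<close> to it.\<close>
  have gap: "gaps_le \<delta> (xs @ [r])" using gaps_le_total[OF xs] rt gaps_le_mono by blast
  have gN: "infnorm g \<le> infnorm f"
    unfolding g_def by (rule lto_infnorm_le, rule euler_lto) (use Cons in auto)
  have "infnorm (euler_product Q (xs @ [r]) g' - (g + (r - t) *\<^sub>R Q g))
     \<le> infnorm (euler_product Q (xs @ [r]) g' - euler_product Q (xs @ [r]) g)
      + infnorm (euler_product Q (xs @ [r]) g - (g + (r - t) *\<^sub>R Q g))"
    by (rule infnorm_diff_triangle)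
  also have "\<dots> \<le> infnorm (g' - g) + C\<^sup>2 * (r - t)\<^sup>2 * infnorm g"
    using lto_nonexpansive[OF euler_lto[OF xs gap Cons.prems(2)]]
      euler_product_bound(2)[OF xs gap Cons.prems(2), of g]
    by (intro add_mono) (auto simp: algebra_simps)
  also have "\<dots> \<le> C\<^sup>2 * \<delta> * (s - r) * infnorm f + C\<^sup>2 * ((r - t) * \<delta>) * infnorm f"
  proof -
    have "(r - t)\<^sup>2 * infnorm g \<le> (r - t) * \<delta> * infnorm f"
      unfolding power2_eq_square using rt le gN
      by (intro mult_mono) (auto intro: infnorm_pos_le)
    from mult_left_mono[OF this, of "C\<^sup>2"] IH show ?thesis by (simp add: algebra_simps)
  qed
  also have "\<dots> = C\<^sup>2 * \<delta> * (s - t) * infnorm f" by (simp add: algebra_simps)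
  finally show ?case
    by (simp add: w euler_product_append[of Q xs r ys] g_def g'_def)
qed

text \<open>Both products are compared with that of the common refinement \<open>z\<close>, whose
  points are the union of the two point sets.\<close>

lemma euler_product_cauchy:
  assumes v: "v \<in> partitions t s" "gaps_le \<delta> v" "\<delta> * C \<le> 1"
    and w: "w \<in> partitions t s" "gaps_le \<epsilon> w" "\<epsilon> * C \<le> 1"
  shows "infnorm (euler_product Q v f - euler_product Q w f)
          \<le> C\<^sup>2 * \<delta> * (s - t) * infnorm f + C\<^sup>2 * \<epsilon> * (s - t) * infnorm f"
proof -
  define z where "z = sorted_list_of_set (set v \<union> set w)"
  have ne: "v \<noteq> []" "hd v = t" "last v = s" using v by (auto simp: partitions_def)
  have z: "set z = set v \<union> set w" "sorted_wrt (<) z" by (auto simp: z_def)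
  have mem: "t \<in> set z" "s \<in> set z"
    using hd_in_set[OF ne(1)] last_in_set[OF ne(1)] by (simp_all add: ne z(1))
  have bd: "t \<le> a \<and> a \<le> s" if "a \<in> set z" for a
    using that z partitions_mem v(1) w(1) by blast
  have "z \<noteq> []" using mem by auto
  moreover have "hd z = t"
  proof -
    obtain a z' where "z = a # z'" using \<open>z \<noteq> []\<close> by (cases z) auto
    then show ?thesis using mem(1) bd[of a] z(2) by fastforce
  qed
  moreover have "last z = s"
  proof -
    obtain a z' where "z = z' @ [a]" using \<open>z \<noteq> []\<close> by (cases z rule: rev_cases) auto
    then show ?thesis using mem(2) bd[of a] z(2) by (fastforce simp: sorted_wrt_append)
  qed
  ultimately have "z \<in> partitions t s" using z by (simp add: partitions_def)
  then have "infnorm (euler_product Q z f - euler_product Q v f) \<le> C\<^sup>2 * \<delta> * (s - t) * infnorm f"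
    "infnorm (euler_product Q z f - euler_product Q w f) \<le> C\<^sup>2 * \<epsilon> * (s - t) * infnorm f"
    using z v w by (auto intro!: euler_product_refine)
  then show ?thesis
    using infnorm_diff_triangle[of "euler_product Q v f" "euler_product Q w f" "euler_product Q z f"]
    by (simp add: infnorm_sub)
qed

text \<open>The limit is taken along one sequence of partitions with meshes \<open>d n\<close>. As
  the Cauchy estimate compares these with every partition \<open>w\<close>, the limit inherits an
  explicit error bound for all of them; the defining inequalities of a lower transition operator are
  preserved under limits.\<close>

lemma ex_euler_limit:
  assumes ts: "t \<le> s"
  shows "\<exists>L. lower_transition_operator L \<and>
    (\<forall>v \<delta> f. v \<in> partitions t s \<longrightarrow> gaps_le \<delta> v \<longrightarrow> \<delta> * C \<le> 1 \<longrightarrow>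
      infnorm (L f - euler_product Q v f) \<le> C\<^sup>2 * \<delta> * (s - t) * infnorm f)"
proof -
  \<comment> \<open>\<open>d n * C = 1 / (n + 1)\<close>: the meshes tend to zero and meet the
    step-size condition from the start.\<close>
  define d where "d n = 1 / (C * real (Suc n))" for n
  have d: "0 < d n" "d n * C \<le> 1" for n
    using C_pos by (simp_all add: d_def divide_simps del: of_nat_Suc)
  have "(\<lambda>n. 1 / C * inverse (real (Suc n))) \<longlonglongrightarrow> 1 / C * 0"
    by (intro tendsto_intros LIMSEQ_inverse_real_of_nat)
  then have d_lim: "d \<longlonglongrightarrow> 0" by (simp add: d_def[abs_def] divide_inverse mult_ac)
  obtain v where v: "\<And>n. v n \<in> partitions t s" "\<And>n. gaps_le (d n) (v n)"
    using ex_partition[OF ts d(1)] by metis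
  define X where "X f n = euler_product Q (v n) f" for f n
  have X: "infnorm (X f n - euler_product Q w f)
      \<le> C\<^sup>2 * d n * (s - t) * infnorm f + C\<^sup>2 * \<epsilon> * (s - t) * infnorm f"
    if "w \<in> partitions t s" "gaps_le \<epsilon> w" "\<epsilon> * C \<le> 1" for f n w \<epsilon>
    unfolding X_def using v d that by (intro euler_product_cauchy)
  have lto: "lower_transition_operator (\<lambda>f. X f n)" for n
    unfolding X_def using euler_lto[OF v(1) v(2) d(2)] by simp
  have "convergent (X f)" for f
  proof -
    \<comment> \<open>The square root converts the maximum norm into the Euclidean norm behind
      \<open>dist\<close>.\<close>
    define K where "K = sqrt (real DIM(real ^ 'x)) * (C\<^sup>2 * (s - t) * infnorm f)"
    have K: "0 \<le> K" using ts by (auto simp: K_def infnorm_pos_le)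
    have dist: "dist (X f m) (X f n) \<le> K * d m + K * d n" for m n
    proof -
      have "dist (X f m) (X f n) \<le> sqrt (real DIM(real ^ 'x)) * infnorm (X f m - X f n)"
        unfolding dist_norm by (rule norm_le_infnorm)
      also have "\<dots> \<le> sqrt (real DIM(real ^ 'x)) *
          (C\<^sup>2 * d m * (s - t) * infnorm f + C\<^sup>2 * d n * (s - t) * infnorm f)"
        using X[of "v n" "d n" f m] v d by (intro mult_left_mono) (auto simp: X_def)
      finally show ?thesis by (simp add: K_def algebra_simps)
    qed
    have "Cauchy (X f)"
    proof (rule metric_CauchyI)
      fix e :: real assume "0 < e"
      have "(\<lambda>n. K * d n) \<longlonglongrightarrow> K * 0" by (intro tendsto_intros d_lim)
      then have "eventually (\<lambda>n. K * d n < e / 2) sequentially"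
        by (rule order_tendstoD) (use \<open>0 < e\<close> in simp)
      then obtain N where N: "\<And>n. n \<ge> N \<Longrightarrow> K * d n < e / 2"
        by (auto simp: eventually_sequentially)
      have "dist (X f m) (X f n) < e" if "m \<ge> N" "n \<ge> N" for m n
        using dist[of m n] N[of m] N[of n] that by simp
      then show "\<exists>M. \<forall>m\<ge>M. \<forall>n\<ge>M. dist (X f m) (X f n) < e" by blast
    qed
    then show ?thesis by (rule Cauchy_convergent)
  qed
  then have lim: "X f \<longlonglongrightarrow> lim (X f)" for f by (simp add: convergent_LIMSEQ_iff)
  have bound: "infnorm (lim (X f) - euler_product Q w f) \<le> C\<^sup>2 * \<epsilon> * (s - t) * infnorm f"
    if w: "w \<in> partitions t s" "gaps_le \<epsilon> w" "\<epsilon> * C \<le> 1" for f w \<epsilon>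
  proof (rule LIMSEQ_le)
    show "(\<lambda>n. infnorm (X f n - euler_product Q w f)) \<longlonglongrightarrow> infnorm (lim (X f) - euler_product Q w f)"
      by (intro tendsto_intros lim)
    have "(\<lambda>n. C\<^sup>2 * d n * (s - t) * infnorm f + C\<^sup>2 * \<epsilon> * (s - t) * infnorm f)
        \<longlonglongrightarrow> C\<^sup>2 * 0 * (s - t) * infnorm f + C\<^sup>2 * \<epsilon> * (s - t) * infnorm f"
      by (intro tendsto_intros d_lim)
    then show "(\<lambda>n. C\<^sup>2 * d n * (s - t) * infnorm f + C\<^sup>2 * \<epsilon> * (s - t) * infnorm f)
        \<longlonglongrightarrow> C\<^sup>2 * \<epsilon> * (s - t) * infnorm f" by simp
  qed (use X[OF w] in blast)
  have "lower_transition_operator (\<lambda>f. lim (X f))"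
  proof (rule lower_transition_operatorI)
    show "c \<le> lim (X f) $ x" if "\<And>y. c \<le> f $ y" for f x c
      using lto_ge[OF lto that]
      by (intro LIMSEQ_le_const[OF tendsto_vec_nth[OF lim]]) blast
    have "lim (X f) $ x + lim (X g) $ x \<le> lim (X (f + g)) $ x" for f g x
      using lto_add[OF lto]
      by (intro LIMSEQ_le[OF tendsto_add[OF tendsto_vec_nth[OF lim] tendsto_vec_nth[OF lim]]
        tendsto_vec_nth[OF lim]]) blast
    then show "lim (X f) + lim (X g) \<le> lim (X (f + g))" for f g
      by (simp add: less_eq_vec_def)
    show "lim (X (c *\<^sub>R f)) = c *\<^sub>R lim (X f)" if "0 \<le> c" for c f
    proof (rule LIMSEQ_unique[OF lim])
      have "X (c *\<^sub>R f) = (\<lambda>n. c *\<^sub>R X f n)" using lto_scale[OF lto that] by auto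
      then show "X (c *\<^sub>R f) \<longlonglongrightarrow> c *\<^sub>R lim (X f)" by (auto intro: tendsto_intros lim)
    qed
  qed
  with bound show ?thesis by blast
qed

abbreviation L where "L \<equiv> corresponding_operator Q"

text \<open>The definite description denotes the Euler limit once that limit is unique: two
  candidates are both \<open>\<epsilon>\<close>-close in operator norm to the Euler product of one
  sufficiently fine partition.\<close>

lemma corresponding_operator:
  assumes ts: "t \<le> s"
  shows corresponding_lto: "lower_transition_operator (L t s)"
    and corresponding_approx: "v \<in> partitions t s \<Longrightarrow> gaps_le \<delta> v \<Longrightarrow> \<delta> * C \<le> 1 \<Longrightarrow>
      infnorm (L t s f - euler_product Q v f) \<le> C\<^sup>2 * \<delta> * (s - t) * infnorm f"
proof -
  obtain T where T: "lower_transition_operator T" and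
    T_bound: "\<And>v \<delta> f. v \<in> partitions t s \<Longrightarrow> gaps_le \<delta> v \<Longrightarrow> \<delta> * C \<le> 1 \<Longrightarrow>
      infnorm (T f - euler_product Q v f) \<le> C\<^sup>2 * \<delta> * (s - t) * infnorm f"
    using ex_euler_limit[OF ts] by blast
  let ?lim = "\<lambda>T. \<forall>\<epsilon>>0. \<exists>\<delta>>0. \<forall>v\<in>partitions t s. mesh v \<le> \<delta> \<longrightarrow>
           op_norm (\<lambda>f. T f - euler_product Q v f) \<le> \<epsilon>"
  have T_lim: "?lim T"
  proof (intro allI impI)
    fix \<epsilon> :: real assume "0 < \<epsilon>"
    \<comment> \<open>\<open>1 / C\<close> is the step-size condition; the summand \<open>1\<close>
      keeps the denominator positive when \<open>t = s\<close>.\<close>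
    define \<delta> where "\<delta> = min (1 / C) (\<epsilon> / (C\<^sup>2 * (s - t) + 1))"
    have pos: "0 < C\<^sup>2 * (s - t) + 1" using ts by (simp add: add_nonneg_pos)
    then have \<delta>: "0 < \<delta>" using \<open>0 < \<epsilon>\<close> C_pos by (simp add: \<delta>_def)
    have "\<delta> * C \<le> 1" using C_pos by (simp add: \<delta>_def min_def field_simps)
    have "\<delta> \<le> \<epsilon> / (C\<^sup>2 * (s - t) + 1)" by (simp add: \<delta>_def)
    then have "\<delta> * (C\<^sup>2 * (s - t) + 1) \<le> \<epsilon>" using pos pos_le_divide_eq by blast
    then have \<epsilon>: "C\<^sup>2 * \<delta> * (s - t) \<le> \<epsilon>" using \<delta> by (simp add: algebra_simps)
    have "op_norm (\<lambda>f. T f - euler_product Q v f) \<le> \<epsilon>" if "v \<in> partitions t s" "mesh v \<le> \<delta>" for v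
    proof (rule op_norm_le)
      fix f :: "real ^ 'x" assume "infnorm f = 1"
      then show "infnorm (T f - euler_product Q v f) \<le> \<epsilon>"
        using T_bound[OF that(1), of \<delta> f] that(2) mesh_le_iff[of \<delta> v] \<delta> \<epsilon> \<open>\<delta> * C \<le> 1\<close> by simp
    qed
    with \<delta> show "\<exists>\<delta>>0. \<forall>v\<in>partitions t s. mesh v \<le> \<delta> \<longrightarrow>
           op_norm (\<lambda>f. T f - euler_product Q v f) \<le> \<epsilon>" by blast
  qed
  have unique: "T' = T" if T': "lower_transition_operator T'" and "?lim T'" for T'
  proof
    fix f
    have "T' f - T f = 0"
    proof (rule infnorm_eq_0I[where K = "2 * infnorm f"])
      fix \<epsilon> :: real assume "0 < \<epsilon>"
      obtain \<delta>1 where \<delta>1: "0 < \<delta>1" "\<And>v. v \<in> partitions t s \<Longrightarrow> mesh v \<le> \<delta>1 \<Longrightarrow>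
           op_norm (\<lambda>f. T' f - euler_product Q v f) \<le> \<epsilon>" using \<open>?lim T'\<close> \<open>0 < \<epsilon>\<close> by blast
      obtain \<delta>2 where \<delta>2: "0 < \<delta>2" "\<And>v. v \<in> partitions t s \<Longrightarrow> mesh v \<le> \<delta>2 \<Longrightarrow>
           op_norm (\<lambda>f. T f - euler_product Q v f) \<le> \<epsilon>" using T_lim \<open>0 < \<epsilon>\<close> by blast
      define \<delta> where "\<delta> = min (1 / C) (min \<delta>1 \<delta>2)"
      have "\<delta> \<le> 1 / C" by (simp add: \<delta>_def)
      then have \<delta>: "0 < \<delta>" "\<delta> * C \<le> 1" "\<delta> \<le> \<delta>1" "\<delta> \<le> \<delta>2"
        using \<delta>1(1) \<delta>2(1) C_pos by (simp_all add: pos_le_divide_eq) (simp_all add: \<delta>_def)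
      obtain v where v: "v \<in> partitions t s" "gaps_le \<delta> v" using ex_partition[OF ts \<delta>(1)] by blast
      then have "mesh v \<le> \<delta>" using mesh_le_iff[of \<delta> v] \<delta> by simp
      have v_lto: "lower_transition_operator (euler_product Q v)" using euler_lto v \<delta> by blast
      have close: "infnorm (S f - euler_product Q v f) \<le> \<epsilon> * infnorm f"
        if S: "lower_transition_operator S" "op_norm (\<lambda>f. S f - euler_product Q v f) \<le> \<epsilon>" for S
      proof -
        have "infnorm (S f - euler_product Q v f)
            \<le> op_norm (\<lambda>f. S f - euler_product Q v f) * infnorm f"
        \<comment> \<open>Two nonexpansive maps that fix \<open>0\<close> differ by at most
          \<open>2\<close> on the unit sphere.\<close>
        proof (rule infnorm_le_op_norm[where B = 2])
          fix g :: "real ^ 'x" assume "infnorm g = 1"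
          then show "infnorm (S g - euler_product Q v g) \<le> 2"
            using infnorm_diff_triangle[of "S g" "euler_product Q v g" 0]
              lto_infnorm_le[OF S(1), of g] lto_infnorm_le[OF v_lto, of g]
            by (simp add: infnorm_neg)
        qed (simp add: lto_scale[OF S(1)] lto_scale[OF v_lto] algebra_simps)
        also have "\<dots> \<le> \<epsilon> * infnorm f"
          using S by (intro mult_right_mono) (auto simp: infnorm_pos_le)
        finally show ?thesis .
      qed
      have "infnorm (T' f - euler_product Q v f) \<le> \<epsilon> * infnorm f"
        "infnorm (T f - euler_product Q v f) \<le> \<epsilon> * infnorm f"
        using close[OF T'] close[OF T] \<delta>1(2) \<delta>2(2) v(1) \<open>mesh v \<le> \<delta>\<close> \<delta> by auto
      then show "infnorm (T' f - T f) \<le> \<epsilon> * (2 * infnorm f)"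
        using infnorm_diff_triangle[of "T' f" "T f" "euler_product Q v f"] by (simp add: infnorm_sub)
    qed
    then show "T' f = T f" by simp
  qed
  have "L t s = T"
    unfolding corresponding_operator_def
    by (rule the_equality) (use T T_lim unique in blast)+
  with T T_bound show "lower_transition_operator (L t s)"
    and "v \<in> partitions t s \<Longrightarrow> gaps_le \<delta> v \<Longrightarrow> \<delta> * C \<le> 1 \<Longrightarrow>
      infnorm (L t s f - euler_product Q v f) \<le> C\<^sup>2 * \<delta> * (s - t) * infnorm f"
    by auto
qed

section \<open>Local expansion and semigroup property of the limit operators\<close>

lemma corresponding_refl: "L t t f = f"
  using corresponding_approx[of t t "[t]" 0 f] infnorm_pos_le[of "L t t f - f"]
    infnorm_eq_0[of "L t t f - f"] by simp

text \<open>For the two-point partition, whose mesh is \<open>s - t\<close>, the general error bound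
  becomes quadratic in the length. \<open>t = s\<close> is separate because partitions are strictly
  increasing.\<close>

lemma corresponding_step:
  assumes "t \<le> s" "(s - t) * C \<le> 1"
  shows "infnorm (L t s f - f - (s - t) *\<^sub>R Q f) \<le> C\<^sup>2 * (s - t)\<^sup>2 * infnorm f"
proof (cases "t = s")
  case True
  then show ?thesis by (simp add: corresponding_refl infnorm_0)
next
  case False
  then show ?thesis
    using corresponding_approx[of t s "[t, s]" "s - t" f] assms
    by (simp add: diff_diff_eq power2_eq_square mult.assoc)
qed

lemma corresponding_near_id:
  assumes "t \<le> s" "(s - t) * C \<le> 1"
  shows "infnorm (L t s f - f) \<le> 2 * C * (s - t) * infnorm f"
proof -
  have "infnorm (L t s f - f) \<le> infnorm (L t s f - f - (s - t) *\<^sub>R Q f) + infnorm ((s - t) *\<^sub>R Q f)"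
    using infnorm_triangle[of "L t s f - f - (s - t) *\<^sub>R Q f" "(s - t) *\<^sub>R Q f"] by simp
  also have "\<dots> \<le> C\<^sup>2 * (s - t)\<^sup>2 * infnorm f + (s - t) * (C * infnorm f)"
    using corresponding_step[OF assms] mult_left_mono[OF rate_bound, of "s - t"] assms
    by (intro add_mono) (auto simp: infnorm_mul)
  also have "\<dots> = ((s - t) * C) * (C * (s - t) * infnorm f) + C * (s - t) * infnorm f"
    by (simp add: power2_eq_square)
  also have "\<dots> \<le> 1 * (C * (s - t) * infnorm f) + C * (s - t) * infnorm f"
    using assms C_pos by (intro add_mono mult_right_mono) (auto simp: infnorm_pos_le)
  finally show ?thesis by (simp add: mult_ac)
qed

text \<open>Concatenating partitions composes Euler products exactly; nonexpansiveness of the left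
  product carries the error on \<open>[r, s]\<close> through it.\<close>

lemma corresponding_semigroup:
  assumes "t \<le> r" "r \<le> s"
  shows "L t s f = L t r (L r s f)"
proof -
  have "L t s f - L t r (L r s f) = 0"
  proof (rule infnorm_eq_0I)
    fix \<epsilon> :: real assume "0 < \<epsilon>"
    define \<delta> where "\<delta> = min \<epsilon> (1 / C)"
    have \<delta>: "0 < \<delta>" "\<delta> * C \<le> 1" "\<delta> \<le> \<epsilon>"
      using \<open>0 < \<epsilon>\<close> C_pos by (auto simp: \<delta>_def min_def field_simps)
    obtain v w where v: "v \<in> partitions t r" "gaps_le \<delta> v" and w: "w \<in> partitions r s" "gaps_le \<delta> w"
      using ex_partition[OF _ \<delta>(1)] assms by meson
    obtain xs where xs: "v = xs @ [r]" using v
      by (cases v rule: rev_cases) (auto simp: partitions_def)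
    obtain ys where ys: "w = r # ys" using w by (cases w) (auto simp: partitions_def)
    define z where "z = xs @ r # ys"
    have z: "z \<in> partitions t s" "gaps_le \<delta> z"
      using v w partitions_join by (auto simp: z_def xs ys successively_append_iff successively_Cons)
    have z_eq: "euler_product Q z f = euler_product Q v (euler_product Q w f)"
      by (simp add: z_def xs ys euler_product_append[of Q xs r ys])
    have v_lto: "lower_transition_operator (euler_product Q v)" using euler_lto v \<delta> by blast
    have g: "infnorm (L r s f) \<le> infnorm f"
      using lto_infnorm_le corresponding_lto assms by blast
    have "infnorm (L t s f - L t r (L r s f)) \<le> infnorm (L t s f - euler_product Q z f) +
        (infnorm (euler_product Q v (euler_product Q w f) - euler_product Q v (L r s f)) +
          infnorm (euler_product Q v (L r s f) - L t r (L r s f)))"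
      using infnorm_diff_triangle[of "L t s f" "L t r (L r s f)" "euler_product Q z f"]
        infnorm_diff_triangle[of "euler_product Q v (euler_product Q w f)" "L t r (L r s f)" "euler_product Q v (L r s f)"]
      by (simp add: z_eq)
    also have "\<dots> \<le> C\<^sup>2 * \<delta> * (s - t) * infnorm f + (infnorm (euler_product Q w f - L r s f) +
        C\<^sup>2 * \<delta> * (r - t) * infnorm (L r s f))"
      using corresponding_approx[OF _ z \<delta>(2)] corresponding_approx[OF _ v \<delta>(2)] assms
        lto_nonexpansive[OF v_lto]
      by (intro add_mono) (auto simp: infnorm_sub)
    also have "\<dots> \<le> C\<^sup>2 * \<delta> * (s - t) * infnorm f + (C\<^sup>2 * \<delta> * (s - r) * infnorm f +
        C\<^sup>2 * \<delta> * (r - t) * infnorm f)"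
      using corresponding_approx[OF _ w \<delta>(2)] assms g \<delta>
      by (intro add_mono mult_left_mono) (auto simp: infnorm_sub)
    also have "\<dots> = \<delta> * (2 * C\<^sup>2 * (s - t) * infnorm f)" by (simp add: algebra_simps)
    also have "\<dots> \<le> \<epsilon> * (2 * C\<^sup>2 * (s - t) * infnorm f)"
      using \<delta> assms by (intro mult_right_mono) (auto simp: infnorm_pos_le)
    finally show "infnorm (L t s f - L t r (L r s f)) \<le> \<epsilon> * (2 * C\<^sup>2 * (s - t) * infnorm f)" .
  qed
  then show ?thesis by simp
qed

end

text \<open>Superadditivity bounds \<open>Q f\<close> below by a sum over the coordinates of
  \<open>f\<close>, each a non-negative multiple of \<open>axis y 1\<close> or
  \<open>- axis y 1\<close>; the values at these finitely many vectors give \<open>B\<close>.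
  Applied to \<open>f - g\<close> and \<open>g - f\<close>, the lower bound becomes a Lipschitz
  estimate.\<close>

lemma lower_rate_operator_lipschitz:
  assumes Q: "lower_rate_operator (Q :: 'x::finite operator)"
  shows "\<exists>C. lipschitz_rate_operator Q C"
proof -
  have add: "Q f $ x + Q g $ x \<le> Q (f + g) $ x" for f g x
    using Q by (auto simp: lower_rate_operator_def less_eq_vec_def)
  have scale: "Q (c *\<^sub>R f) = c *\<^sub>R Q f" if "0 \<le> c" for c f
    using Q that by (auto simp: lower_rate_operator_def)
  have zero: "Q 0 = 0" using scale[of 0 0] by simp
  have sum: "(\<Sum>y\<in>A. Q (g y) $ x) \<le> Q (\<Sum>y\<in>A. g y) $ x" if "finite A" for A :: "'x set" and g x
    using that
  proof (induction A rule: finite_induct)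
    case (insert y A)
    then show ?case using add[of "g y" x "\<Sum>y\<in>A. g y"] by simp
  qed (simp add: zero)
  define B where "B = (\<Sum>y\<in>UNIV. infnorm (Q (axis y 1)) + infnorm (Q (- axis y 1)))"
  have lower: "- (B * infnorm f) \<le> Q f $ x" for f x
  proof -
    have f: "f = (\<Sum>y\<in>UNIV. f $ y *\<^sub>R axis y 1)"
      by (simp add: vec_eq_iff axis_def if_distrib if_distribR cong: if_cong)
    have "- ((infnorm (Q (axis y 1)) + infnorm (Q (- axis y 1))) * infnorm f)
        \<le> Q (f $ y *\<^sub>R axis y 1) $ x" for y
    proof -
      \<comment> \<open>Homogeneity is available for non-negative factors only, so the sign of
        \<open>f $ y\<close> is moved into the vector.\<close>
      define e :: "real ^ 'x" where "e = (if 0 \<le> f $ y then axis y 1 else - axis y 1)"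
      have e: "f $ y *\<^sub>R axis y 1 = \<bar>f $ y\<bar> *\<^sub>R e" by (simp add: e_def)
      have "\<bar>Q e $ x\<bar> \<le> infnorm (Q e)" by (rule component_le_infnorm_cart)
      also have "\<dots> \<le> infnorm (Q (axis y 1)) + infnorm (Q (- axis y 1))"
        by (simp add: e_def infnorm_pos_le)
      finally have "\<bar>f $ y\<bar> * \<bar>Q e $ x\<bar> \<le> infnorm f * (infnorm (Q (axis y 1)) + infnorm (Q (- axis y 1)))"
        by (intro mult_mono component_le_infnorm_cart) (auto simp: infnorm_pos_le)
      moreover have "\<bar>f $ y\<bar> * - \<bar>Q e $ x\<bar> \<le> \<bar>f $ y\<bar> * Q e $ x"
        by (intro mult_left_mono) auto
      ultimately show ?thesis by (simp add: e scale algebra_simps)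
    qed
    then have "- (B * infnorm f) \<le> (\<Sum>y\<in>UNIV. Q (f $ y *\<^sub>R axis y 1) $ x)"
      unfolding B_def sum_distrib_right sum_negf[symmetric] by (intro sum_mono) auto
    also have "\<dots> \<le> Q f $ x" using sum[of UNIV "\<lambda>y. f $ y *\<^sub>R axis y 1" x] f by simp
    finally show ?thesis .
  qed
  have "0 \<le> B" by (auto simp: B_def intro!: sum_nonneg add_nonneg_nonneg infnorm_pos_le)
  \<comment> \<open>The locale asks for a positive constant, hence \<open>B + 1\<close>.\<close>
  have diff: "Q g $ x - Q f $ x \<le> (B + 1) * infnorm (f - g)" for f g x
    using add[of g x "f - g"] lower[of "f - g" x] infnorm_pos_le[of "f - g"]
    by (simp add: algebra_simps)
  have "infnorm (Q f - Q g) \<le> (B + 1) * infnorm (f - g)" for f g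
    unfolding infnorm_le_cart
    using diff[of f _ g] diff[of g _ f] by (auto simp: abs_le_iff infnorm_sub)
  with Q \<open>0 \<le> B\<close> show ?thesis by (auto simp: lipschitz_rate_operator_def intro!: exI[of _ "B + 1"])
qed

section \<open>Dominating rate matrices\<close>

text \<open>
  The hypograph of a superlinear functional is a convex cone; a hyperplane separating it from the
  ray through \<open>(f, q f)\<close> is the graph of the required linear functional. The hypograph is lowered
  by one to make the two sets disjoint.
\<close>

lemma superlinear_supporting_functional:
  fixes q :: "'a::euclidean_space \<Rightarrow> real"
  assumes add: "\<And>f g. q f + q g \<le> q (f + g)"
    and scale: "\<And>c f. 0 \<le> c \<Longrightarrow> q (c *\<^sub>R f) = c * q f"
  shows "\<exists>l. l \<bullet> f = q f \<and> (\<forall>g. q g \<le> l \<bullet> g)"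
proof -
  define S where "S = {(g, r). r + 1 \<le> q g}"
  define T where "T = (\<lambda>c. (c *\<^sub>R f, c * q f)) ` {0..}"
  have q0: "q 0 = 0" using scale[of 0 0] by simp
  have "convex S"
  proof (rule convexI)
    fix p p' :: "'a \<times> real" and u v :: real
    assume p: "p \<in> S" "p' \<in> S" and uv: "0 \<le> u" "0 \<le> v" "u + v = 1"
    obtain g r g' r' where pp: "p = (g, r)" "p' = (g', r')" by (cases p, cases p')
    have "u * (r + 1) + v * (r' + 1) \<le> u * q g + v * q g'"
      using p uv by (intro add_mono mult_left_mono) (auto simp: S_def pp)
    also have "\<dots> \<le> q (u *\<^sub>R g + v *\<^sub>R g')"
      using add[of "u *\<^sub>R g" "v *\<^sub>R g'"] scale uv by simp
    finally show "u *\<^sub>R p + v *\<^sub>R p' \<in> S"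
      using uv by (simp add: S_def pp algebra_simps)
  qed
  moreover have "convex T"
  proof (rule convexI)
    fix p p' :: "'a \<times> real" and u v :: real
    assume "p \<in> T" "p' \<in> T" and uv: "0 \<le> u" "0 \<le> v" "u + v = 1"
    then obtain c c' where c: "0 \<le> c" "0 \<le> c'" "p = (c *\<^sub>R f, c * q f)" "p' = (c' *\<^sub>R f, c' * q f)"
      by (auto simp: T_def)
    have "u *\<^sub>R p + v *\<^sub>R p' = ((u * c + v * c') *\<^sub>R f, (u * c + v * c') * q f)"
      by (simp add: c algebra_simps)
    moreover have "0 \<le> u * c + v * c'" using uv c by simp
    ultimately show "u *\<^sub>R p + v *\<^sub>R p' \<in> T" by (auto simp: T_def)
  qed
  moreover have S0: "(0, -1) \<in> S" using q0 by (simp add: S_def)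
  moreover have T0: "(0, 0) \<in> T" by (force simp: T_def)
  moreover have "S \<inter> T = {}" by (auto simp: S_def T_def scale)
  ultimately obtain ab \<beta> where ab: "ab \<noteq> 0" "\<And>p. p \<in> S \<Longrightarrow> ab \<bullet> p \<le> \<beta>" "\<And>p. p \<in> T \<Longrightarrow> \<beta> \<le> ab \<bullet> p"
    using separating_hyperplane_sets[of S T] by blast
  obtain a b where [simp]: "ab = (a, b)" by (cases ab)
  have \<beta>: "- b \<le> \<beta>" "\<beta> \<le> 0" using ab(2)[OF S0] ab(3)[OF T0] by simp_all
  have T: "\<beta> \<le> c * (a \<bullet> f + b * q f)" if "0 \<le> c" for c
    using ab(3)[of "(c *\<^sub>R f, c * q f)"] that by (auto simp: T_def algebra_simps)
  have S: "c * (a \<bullet> g + b * q g) \<le> b" if "0 \<le> c" for c g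
    using ab(2)[of "(c *\<^sub>R g, c * q g - 1)"] that \<beta> by (simp add: S_def scale algebra_simps)
  \<comment> \<open>The inequalities hold for all multiples \<open>c \<ge> 0\<close> with a fixed
    bound, so large \<open>c\<close> forces them to hold with bound \<open>0\<close>. This undoes
    the lowering by one.\<close>
  have le: "a \<bullet> g + b * q g \<le> 0" for g
  proof (rule ccontr)
    assume "\<not> ?thesis"
    then have "0 < a \<bullet> g + b * q g" by simp
    then obtain n :: nat where "b < real n * (a \<bullet> g + b * q g)" using reals_Archimedean3 by blast
    then show False using S[of "real n" g] by simp
  qed
  have ge: "0 \<le> a \<bullet> f + b * q f"
  proof (rule ccontr)
    assume "\<not> ?thesis"
    then have "0 < - (a \<bullet> f + b * q f)" by simp
    then obtain n :: nat where "- \<beta> < real n * - (a \<bullet> f + b * q f)" using reals_Archimedean3 by blast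
    then show False using T[of "real n"] by (simp add: algebra_simps)
  qed
  \<comment> \<open>A vertical hyperplane is excluded: it would give
    \<open>a \<bullet> g \<le> 0\<close> for all \<open>g\<close>, in particular for
    \<open>g = a\<close>.\<close>
  have "b \<noteq> 0"
  proof
    assume "b = 0"
    then have "a \<bullet> a \<le> 0" using le[of a] by simp
    then have "a \<bullet> a = 0" using inner_ge_zero[of a] by linarith
    then show False using ab(1) \<open>b = 0\<close> by (simp add: zero_prod_def)
  qed
  then have b: "0 < b" using \<beta> by simp
  define l where "l = - (1 / b) *\<^sub>R a"
  have "q g \<le> l \<bullet> g" for g using le[of g] b by (simp add: l_def field_simps)
  moreover have "l \<bullet> f = q f" using le[of f] ge b by (simp add: l_def field_simps)
  ultimately show ?thesis by blast
qed

text \<open>Rows can be chosen independently, so each is a supporting functional at \<open>f\<close>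
  of one component of \<open>Q\<close>. That the result is a rate matrix follows from domination,
  tested on the constants \<open>1\<close> and \<open>-1\<close> and on the indicators.\<close>

lemma dominating_rate_matrix_attains:
  assumes Q: "lower_rate_operator (Q :: 'x::finite operator)"
  shows "\<exists>M\<in>dominating_rate_matrices Q. M *v f = Q f"
proof -
  have "\<exists>l. l \<bullet> f = Q f $ x \<and> (\<forall>g. Q g $ x \<le> l \<bullet> g)" for x
    using Q by (intro superlinear_supporting_functional)
      (auto simp: lower_rate_operator_def less_eq_vec_def)
  then obtain l where l: "\<And>x. l x \<bullet> f = Q f $ x" "\<And>x g. Q g $ x \<le> l x \<bullet> g" by metis
  define M :: "real ^ 'x ^ 'x" where "M = (\<chi> x. l x)"
  have Mv: "(M *v g) $ x = l x \<bullet> g" for g x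
    by (simp add: M_def matrix_vector_mult_def inner_vec_def)
  have "M \<in> rate_matrices"
    unfolding rate_matrices_def
  proof (intro CollectI conjI allI impI)
    fix x
    have one: "l x \<bullet> vec 1 = (\<Sum>y\<in>UNIV. M $ x $ y)" by (simp add: M_def inner_vec_def)
    have "Q (vec c) = 0" for c using Q by (simp add: lower_rate_operator_def)
    from this[of 1] this[of "-1"] have "0 \<le> l x \<bullet> vec 1" "0 \<le> l x \<bullet> vec (-1)"
      using l(2)[of "vec 1" x] l(2)[of "vec (-1)" x] by simp_all
    moreover have "l x \<bullet> vec (-1) = - (l x \<bullet> vec 1)" by (simp add: inner_vec_def sum_negf)
    ultimately show "(\<Sum>y\<in>UNIV. M $ x $ y) = 0" using one by simp
    fix y assume "x \<noteq> y"
    then have "0 \<le> Q (axis y 1) $ x" using Q by (simp add: lower_rate_operator_def)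
    also have "\<dots> \<le> l x \<bullet> axis y 1" by (rule l)
    finally show "0 \<le> M $ x $ y" by (simp add: M_def inner_axis)
  qed
  then have "M \<in> dominating_rate_matrices Q"
    by (simp add: dominating_rate_matrices_def less_eq_vec_def Mv l)
  moreover have "M *v f = Q f" by (simp add: vec_eq_iff Mv l)
  ultimately show ?thesis by blast
qed

lemma matrix_vector_mult_minus_distrib: "(M :: real ^ 'n ^ 'm) *v (- f) = - (M *v f)"
  using matrix_vector_mult_scaleR[of M "-1" f] by simp

lemma lower_rate_operator_matrix:
  assumes "M \<in> rate_matrices"
  shows "lower_rate_operator ((*v) M)"
  unfolding lower_rate_operator_def
proof (intro conjI allI impI)
  show "M *v vec c = 0" for c
    using assms by (simp add: rate_matrices_def vec_eq_iff matrix_vector_mult_def flip: sum_distrib_right)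
  show "0 \<le> (M *v axis y 1) $ x" if "x \<noteq> y" for x y
    using assms that by (simp add: rate_matrices_def matrix_vector_mult_basis column_def)
qed (simp_all add: matrix_vector_right_distrib matrix_vector_mult_scaleR)

text \<open>Domination at \<open>h\<close> and at \<open>- h\<close> bounds \<open>M *v h\<close>
  from both sides by the bound for \<open>Q\<close>. The constant does not depend on
  \<open>M\<close>.\<close>

lemma (in lipschitz_rate_operator) dominating_lipschitz:
  assumes M: "M \<in> dominating_rate_matrices Q"
  shows "lipschitz_rate_operator ((*v) M) C"
proof
  show "lower_rate_operator ((*v) M)"
    using M by (auto simp: dominating_rate_matrices_def intro: lower_rate_operator_matrix)
  have lower: "- (C * infnorm h) \<le> (M *v h) $ x" for h x
  proof -
    have "\<bar>Q h $ x\<bar> \<le> C * infnorm h" using rate_bound[of h] by (simp add: infnorm_le_cart)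
    moreover have "Q h $ x \<le> (M *v h) $ x"
      using M by (auto simp: dominating_rate_matrices_def less_eq_vec_def)
    ultimately show ?thesis by simp
  qed
  have "infnorm (M *v h) \<le> C * infnorm h" for h
    unfolding infnorm_le_cart
  proof
    fix x
    show "\<bar>(M *v h) $ x\<bar> \<le> C * infnorm h"
      using lower[of h x] lower[of "- h" x]
      by (simp add: infnorm_neg matrix_vector_mult_minus_distrib abs_le_iff)
  qed
  from this[of "f - g" for f g]
  show "infnorm (M *v f - M *v g) \<le> C * infnorm (f - g)" for f g
    by (simp add: matrix_vector_mult_diff_distrib)
qed (rule C_pos)

section \<open>Transition families with prescribed rates\<close>

text \<open>The transition matrices of a possibly time-inhomogeneous Markov chain.\<close>

definition transition_family :: "(real \<Rightarrow> real \<Rightarrow> real ^ 'x ^ 'x::finite) \<Rightarrow> bool" where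
  "transition_family T \<longleftrightarrow>
     (\<forall>t s. 0 \<le> t \<longrightarrow> t \<le> s \<longrightarrow>
        (\<forall>x y. 0 \<le> T t s $ x $ y) \<and> (\<forall>x. (\<Sum>y\<in>UNIV. T t s $ x $ y) = 1)) \<and>
     (\<forall>t\<ge>0. T t t = mat 1) \<and>
     (\<forall>t r s. 0 \<le> t \<longrightarrow> t \<le> r \<longrightarrow> r \<le> s \<longrightarrow> T t s = T t r ** T r s)"

text \<open>The left and the right derivative may differ, so the rates are allowed to jump, as they
  may at the points of a partition.\<close>

definition has_rates_in ::
  "(real \<Rightarrow> real \<Rightarrow> real ^ 'x ^ 'x::finite) \<Rightarrow> (real ^ 'x ^ 'x) set \<Rightarrow> bool" where
  "has_rates_in T \<Q> \<longleftrightarrow>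
     (\<forall>t\<ge>0. (\<exists>M\<in>\<Q>. ((\<lambda>h. (1 / h) *\<^sub>R (T t (t + h) - mat 1)) \<longlongrightarrow> M) (at_right 0)) \<and>
        (t > 0 \<longrightarrow> (\<exists>M\<in>\<Q>. ((\<lambda>h. (1 / h) *\<^sub>R (T (t - h) t - mat 1)) \<longlongrightarrow> M) (at_right 0))))"

definition glue ::
  "real \<Rightarrow> (real \<Rightarrow> real \<Rightarrow> real ^ 'x ^ 'x::finite) \<Rightarrow> (real \<Rightarrow> real \<Rightarrow> real ^ 'x ^ 'x)
     \<Rightarrow> real \<Rightarrow> real \<Rightarrow> real ^ 'x ^ 'x" where
  "glue \<tau> S T t s =
     (if s \<le> \<tau> then S t s else if \<tau> \<le> t then T t s else S t \<tau> ** T \<tau> s)"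

lemma stochastic_matrix_mult:
  fixes A B :: "real ^ 'x ^ 'x::finite"
  assumes "\<And>x y. 0 \<le> A $ x $ y" "\<And>x. (\<Sum>y\<in>UNIV. A $ x $ y) = 1"
    and "\<And>x y. 0 \<le> B $ x $ y" "\<And>x. (\<Sum>y\<in>UNIV. B $ x $ y) = 1"
  shows "0 \<le> (A ** B) $ x $ y" "(\<Sum>y\<in>UNIV. (A ** B) $ x $ y) = 1"
proof -
  show "0 \<le> (A ** B) $ x $ y"
    using assms by (simp add: matrix_matrix_mult_def sum_nonneg)
  have "(\<Sum>y\<in>UNIV. (A ** B) $ x $ y) = (\<Sum>k\<in>UNIV. \<Sum>y\<in>UNIV. A $ x $ k * B $ k $ y)"
    unfolding matrix_matrix_mult_def by (simp, rule sum.swap)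
  also have "\<dots> = 1" using assms by (simp flip: sum_distrib_left)
  finally show "(\<Sum>y\<in>UNIV. (A ** B) $ x $ y) = 1" .
qed

lemma transition_family_glue:
  assumes S: "transition_family S" and T: "transition_family T" and \<tau>: "0 \<le> \<tau>"
  shows "transition_family (glue \<tau> S T)"
  unfolding transition_family_def
proof (intro conjI allI impI)
  fix t s :: real assume ts: "0 \<le> t" "t \<le> s"
  have stoch: "(\<forall>x y. 0 \<le> U t s $ x $ y) \<and> (\<forall>x. (\<Sum>y\<in>UNIV. U t s $ x $ y) = 1)"
    if "U = S \<or> U = T" "0 \<le> t" "t \<le> s" for U t s
    using S T that unfolding transition_family_def by metis
  consider "s \<le> \<tau>" | "\<tau> < s" "\<tau> \<le> t" | "\<tau> < s" "t < \<tau>" by linarith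
  then have "(\<forall>x y. 0 \<le> glue \<tau> S T t s $ x $ y) \<and> (\<forall>x. (\<Sum>y\<in>UNIV. glue \<tau> S T t s $ x $ y) = 1)"
  proof cases
    case 3
    then show ?thesis
      using stoch[of S t \<tau>] stoch[of T \<tau> s] ts \<tau>
        stochastic_matrix_mult[of "S t \<tau>" "T \<tau> s"] by (simp add: glue_def)
  qed (use stoch ts in \<open>simp_all add: glue_def\<close>)
  then show "0 \<le> glue \<tau> S T t s $ x $ y" "(\<Sum>y\<in>UNIV. glue \<tau> S T t s $ x $ y) = 1" for x y
    by auto
next
  fix t :: real assume "0 \<le> t"
  then show "glue \<tau> S T t t = mat 1"
    using S T by (simp add: glue_def transition_family_def)
next
  fix t r s :: real assume le: "0 \<le> t" "t \<le> r" "r \<le> s"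
  have S3: "S t s = S t r ** S r s" if "0 \<le> t" "t \<le> r" "r \<le> s" for t r s
    using S that unfolding transition_family_def by blast
  have T3: "T t s = T t r ** T r s" if "0 \<le> t" "t \<le> r" "r \<le> s" for t r s
    using T that unfolding transition_family_def by blast
  have id: "S \<tau> \<tau> = mat 1" using S \<tau> by (simp add: transition_family_def)
  consider "s \<le> \<tau>" | "\<tau> < s" "\<tau> \<le> t" "r \<le> \<tau>" | "\<tau> < r" "\<tau> \<le> t" | "t < \<tau>" "\<tau> < s" "r \<le> \<tau>"
    | "t < \<tau>" "\<tau> < r" using le by linarith
  then show "glue \<tau> S T t s = glue \<tau> S T t r ** glue \<tau> S T r s"
  proof cases
    case 1
    then show ?thesis using le by (simp add: glue_def S3[of t r s])
  next
    case 2
    then have "t = \<tau>" "r = \<tau>" using le by auto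
    then show ?thesis using 2 by (simp add: glue_def id)
  next
    case 3
    then show ?thesis using le \<tau> by (simp add: glue_def T3[of t r s])
  next
    case 4
    then show ?thesis using le S3[of t r \<tau>] id by (auto simp: glue_def matrix_mul_assoc)
  next
    case 5
    then show ?thesis using le \<tau> T3[of \<tau> r s] by (simp add: glue_def matrix_mul_assoc)
  qed
qed

text \<open>For small \<open>h\<close> a one-sided increment involves only one of the two families;
  at \<open>\<tau>\<close> itself the left derivative is that of \<open>S\<close> and the right one
  that of \<open>T\<close>.\<close>

lemma has_rates_in_glue:
  assumes S: "has_rates_in S \<Q>" and T: "has_rates_in T \<Q>" and \<tau>: "0 \<le> \<tau>"
  shows "has_rates_in (glue \<tau> S T) \<Q>"
  unfolding has_rates_in_def
proof (intro allI impI conjI)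
  fix t :: real assume t: "0 \<le> t"
  show "\<exists>M\<in>\<Q>. ((\<lambda>h. (1 / h) *\<^sub>R (glue \<tau> S T t (t + h) - mat 1)) \<longlongrightarrow> M) (at_right 0)"
  proof (cases "t < \<tau>")
    case True
    obtain M where "M \<in> \<Q>" and M: "((\<lambda>h. (1 / h) *\<^sub>R (S t (t + h) - mat 1)) \<longlongrightarrow> M) (at_right 0)"
      using S t by (auto simp: has_rates_in_def)
    have "eventually (\<lambda>h. (1 / h) *\<^sub>R (S t (t + h) - mat 1)
        = (1 / h) *\<^sub>R (glue \<tau> S T t (t + h) - mat 1)) (at_right 0)"
      using True by (auto simp: eventually_at_right_field glue_def intro!: exI[of _ "\<tau> - t"])
    from Lim_transform_eventually[OF M this] \<open>M \<in> \<Q>\<close> show ?thesis by blast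
  next
    case False
    obtain M where "M \<in> \<Q>" and M: "((\<lambda>h. (1 / h) *\<^sub>R (T t (t + h) - mat 1)) \<longlongrightarrow> M) (at_right 0)"
      using T t by (auto simp: has_rates_in_def)
    have "eventually (\<lambda>h. (1 / h) *\<^sub>R (T t (t + h) - mat 1)
        = (1 / h) *\<^sub>R (glue \<tau> S T t (t + h) - mat 1)) (at_right 0)"
      using False by (auto simp: eventually_at_right_field glue_def intro!: exI[of _ 1])
    from Lim_transform_eventually[OF M this] \<open>M \<in> \<Q>\<close> show ?thesis by blast
  qed
  assume t: "0 < t"
  show "\<exists>M\<in>\<Q>. ((\<lambda>h. (1 / h) *\<^sub>R (glue \<tau> S T (t - h) t - mat 1)) \<longlongrightarrow> M) (at_right 0)"
  proof (cases "t \<le> \<tau>")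
    case True
    obtain M where "M \<in> \<Q>" and M: "((\<lambda>h. (1 / h) *\<^sub>R (S (t - h) t - mat 1)) \<longlongrightarrow> M) (at_right 0)"
      using S t unfolding has_rates_in_def by (meson less_imp_le)
    then show ?thesis using True by (auto simp: glue_def)
  next
    case False
    obtain M where "M \<in> \<Q>" and M: "((\<lambda>h. (1 / h) *\<^sub>R (T (t - h) t - mat 1)) \<longlongrightarrow> M) (at_right 0)"
      using T t unfolding has_rates_in_def by (meson less_imp_le)
    have "eventually (\<lambda>h. (1 / h) *\<^sub>R (T (t - h) t - mat 1)
        = (1 / h) *\<^sub>R (glue \<tau> S T (t - h) t - mat 1)) (at_right 0)"
      using False by (auto simp: eventually_at_right_field glue_def intro!: exI[of _ "t - \<tau>"])
    from Lim_transform_eventually[OF M this] \<open>M \<in> \<Q>\<close> show ?thesis by blast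
  qed
qed

section \<open>The exponential of a single rate matrix\<close>

locale lipschitz_rate_matrix =
  lipschitz_rate_operator "(*v) M" C for M :: "real ^ 'x::finite ^ 'x" and C
begin

lemma euler_product_minus:
  "v \<in> partitions t s \<Longrightarrow> euler_product ((*v) M) v (- f) = - euler_product ((*v) M) v f"
  by (induction rule: partitions_induct) (auto simp: matrix_vector_mult_minus_distrib)

text \<open>The key is oddness, which passes to the limit from Euler products. Superadditivity at
  \<open>f, g\<close> and at \<open>- f, - g\<close> then gives additivity, and homogeneity extends
  to negative factors.\<close>

lemma corresponding_linear:
  assumes ts: "t \<le> s"
  shows "linear (L t s)"
proof -
  note lto = corresponding_lto[OF ts]
  have minus: "L t s (- f) = - L t s f" for f
  proof -
    have "L t s (- f) - (- L t s f) = 0"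
    proof (rule infnorm_eq_0I)
      fix \<epsilon> :: real assume "0 < \<epsilon>"
      define \<delta> where "\<delta> = min \<epsilon> (1 / C)"
      have "\<delta> \<le> 1 / C" by (simp add: \<delta>_def)
      then have \<delta>: "0 < \<delta>" "\<delta> * C \<le> 1" "\<delta> \<le> \<epsilon>"
        using \<open>0 < \<epsilon>\<close> C_pos by (simp_all add: pos_le_divide_eq) (simp_all add: \<delta>_def)
      obtain v where v: "v \<in> partitions t s" "gaps_le \<delta> v" using ex_partition[OF ts \<delta>(1)] by blast
      let ?\<Phi> = "euler_product ((*v) M) v"
      have "infnorm (L t s (- f) - (- L t s f)) \<le> infnorm (L t s (- f) - ?\<Phi> (- f)) + infnorm (L t s f - ?\<Phi> f)"
        using infnorm_diff_triangle[of "L t s (- f)" "- L t s f" "?\<Phi> (- f)"] euler_product_minus[OF v(1)]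
        by (simp add: add.commute)
      also have "\<dots> \<le> \<delta> * (2 * C\<^sup>2 * (s - t) * infnorm f)"
        using corresponding_approx[OF ts v \<delta>(2), of f] corresponding_approx[OF ts v \<delta>(2), of "- f"]
        by (simp add: infnorm_neg mult_ac)
      also have "\<dots> \<le> \<epsilon> * (2 * C\<^sup>2 * (s - t) * infnorm f)"
        using \<delta> ts by (intro mult_right_mono) (auto simp: infnorm_pos_le)
      finally show "infnorm (L t s (- f) - (- L t s f)) \<le> \<epsilon> * (2 * C\<^sup>2 * (s - t) * infnorm f)" .
    qed
    then show ?thesis by (simp add: eq_neg_iff_add_eq_0)
  qed
  show ?thesis
  proof
    show "L t s (f + g) = L t s f + L t s g" for f g
    proof -
      have "L t s (f + g) $ x = L t s f $ x + L t s g $ x" for x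
        using lto_add[OF lto, of f x g] lto_add[OF lto, of "- f" x "- g"] minus[of "f + g"]
        by (simp add: minus)
      then show ?thesis by (simp add: vec_eq_iff)
    qed
    show "L t s (c *\<^sub>R f) = c *\<^sub>R L t s f" for c f
    proof (cases "0 \<le> c")
      case False
      then have "L t s (c *\<^sub>R f) = - L t s ((- c) *\<^sub>R f)" using minus[of "c *\<^sub>R f"] by simp
      then show ?thesis using False lto_scale[OF lto, of "- c" f] by simp
    qed (simp add: lto_scale[OF lto])
  qed
qed

text \<open>For \<open>t \<le> s\<close> this is the matrix exponential of
  \<open>(s - t) *\<^sub>R M\<close>, obtained as an Euler limit so that its expansion and semigroup
  property are already at hand.\<close>

definition exp_family :: "real \<Rightarrow> real \<Rightarrow> real ^ 'x ^ 'x" where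
  "exp_family t s = matrix (L t s)"

lemma exp_family_works: "t \<le> s \<Longrightarrow> exp_family t s *v f = L t s f"
  unfolding exp_family_def using corresponding_linear by simp

lemma exp_family_component: "exp_family t s $ x $ y = L t s (axis y 1) $ x"
  by (simp add: exp_family_def matrix_def)

lemma transition_family_exp: "transition_family exp_family"
  unfolding transition_family_def
proof (intro conjI allI impI)
  fix t s :: real assume ts: "0 \<le> t" "t \<le> s"
  note lto = corresponding_lto[OF ts(2)]
  show "0 \<le> exp_family t s $ x $ y" for x y
    unfolding exp_family_component by (rule lto_ge[OF lto]) (simp add: axis_def)
  fix x
  have eq: "(\<Sum>y\<in>UNIV. exp_family t s $ x $ y) = L t s (vec 1) $ x"
    using ts by (simp flip: exp_family_works add: matrix_vector_mult_def)
  have "1 \<le> L t s (vec 1) $ x" by (rule lto_ge[OF lto]) simp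
  moreover have "-1 \<le> L t s (- vec 1) $ x" by (rule lto_ge[OF lto]) simp
  moreover have "L t s (- vec 1) = - L t s (vec 1)"
    using corresponding_linear[OF ts(2)] by (rule linear_neg)
  ultimately show "(\<Sum>y\<in>UNIV. exp_family t s $ x $ y) = 1" using eq by simp
next
  fix t :: real
  have "exp_family t t *v f = mat 1 *v f" for f
    by (simp add: exp_family_works corresponding_refl)
  then show "exp_family t t = mat 1" by (simp add: matrix_eq)
next
  fix t r s :: real assume "t \<le> r" "r \<le> s"
  then have "exp_family t s *v f = (exp_family t r ** exp_family r s) *v f" for f
    using corresponding_semigroup[of t r s f]
    by (simp add: exp_family_works flip: matrix_vector_mul_assoc)
  then show "exp_family t s = exp_family t r ** exp_family r s" by (simp add: matrix_eq)
qed

text \<open>The end points are functions of \<open>h\<close> to cover both one-sided increments: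
  \<open>a h = t\<close> with \<open>b h = t + h\<close>, and \<open>a h = t - h\<close> with
  \<open>b h = t\<close>.\<close>

lemma exp_family_derivative:
  assumes "\<And>h. 0 < h \<Longrightarrow> b h = a h + h"
  shows "((\<lambda>h. (1 / h) *\<^sub>R (exp_family (a h) (b h) - mat 1)) \<longlongrightarrow> M) (at_right 0)"
proof (intro vec_tendstoI)
  fix x y
  let ?D = "\<lambda>h. ((1 / h) *\<^sub>R (exp_family (a h) (b h) - mat 1)) $ x $ y"
  have bound: "\<bar>?D h - M $ x $ y\<bar> \<le> C\<^sup>2 * h" if h: "0 < h" "h < 1 / C" for h
  proof -
    have hC: "h * C \<le> 1" using h C_pos by (simp add: field_simps)
    have "infnorm (axis y 1 :: real ^ 'x) \<le> 1" by (auto simp: infnorm_le_cart axis_def)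
    then have "C\<^sup>2 * h\<^sup>2 * infnorm (axis y 1 :: real ^ 'x) \<le> C\<^sup>2 * h\<^sup>2 * 1"
      by (intro mult_left_mono) auto
    then have "infnorm (L (a h) (b h) (axis y 1) - axis y 1 - h *\<^sub>R (M *v axis y 1)) \<le> C\<^sup>2 * h\<^sup>2"
      using corresponding_step[of "a h" "b h" "axis y 1"] assms[OF h(1)] h hC by simp
    then have "\<bar>(L (a h) (b h) (axis y 1) - axis y 1 - h *\<^sub>R (M *v axis y 1)) $ x\<bar> \<le> C\<^sup>2 * h\<^sup>2"
      by (simp only: infnorm_le_cart)
    moreover have "(M *v axis y 1) $ x = M $ x $ y"
      by (simp add: matrix_vector_mult_basis column_def)
    moreover have "axis y 1 $ x = (mat 1 :: real ^ 'x ^ 'x) $ x $ y"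
      by (simp add: axis_def mat_def)
    ultimately have "\<bar>(exp_family (a h) (b h) - mat 1) $ x $ y - h * M $ x $ y\<bar> \<le> C\<^sup>2 * h\<^sup>2"
      by (simp add: exp_family_component)
    moreover have "?D h - M $ x $ y
        = (1 / h) * ((exp_family (a h) (b h) - mat 1) $ x $ y - h * M $ x $ y)"
      using h by (simp add: field_simps)
    ultimately show ?thesis using h by (simp add: abs_mult field_simps power2_eq_square)
  qed
  have lim: "((\<lambda>h. C\<^sup>2 * h) \<longlongrightarrow> C\<^sup>2 * 0) (at_right 0)" by (intro tendsto_intros)
  have "eventually (\<lambda>h. norm (?D h - M $ x $ y) \<le> C\<^sup>2 * h) (at_right 0)"
    unfolding eventually_at_right_field real_norm_def using bound C_pos
    by (intro exI[of _ "1 / C"]) simp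
  from Lim_null_comparison[OF this] lim have "((\<lambda>h. ?D h - M $ x $ y) \<longlongrightarrow> 0) (at_right 0)"
    by simp
  then show "(?D \<longlongrightarrow> M $ x $ y) (at_right 0)" by (rule LIM_zero_cancel)
qed

lemma has_rates_in_exp:
  assumes "M \<in> \<Q>"
  shows "has_rates_in exp_family \<Q>"
proof -
  have "((\<lambda>h. (1 / h) *\<^sub>R (exp_family t (t + h) - mat 1)) \<longlongrightarrow> M) (at_right 0)"
    "((\<lambda>h. (1 / h) *\<^sub>R (exp_family (t - h) t - mat 1)) \<longlongrightarrow> M) (at_right 0)" for t
    using exp_family_derivative[of "\<lambda>h. t + h" "\<lambda>h. t"]
      exp_family_derivative[of "\<lambda>h. t" "\<lambda>h. t - h"] by force+
  then show ?thesis unfolding has_rates_in_def using assms by blast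
qed

end

section \<open>Families with piecewise constant rates near the limit operators\<close>

context lipschitz_rate_operator
begin

text \<open>The matrix for the first interval is selected at \<open>g\<close>, the exact Euler
  product over the later ones, rather than at its approximation \<open>T r s *v f\<close>;
  nonexpansiveness of the exponential turns the difference of the two into an additive
  error.\<close>

lemma ex_family_near_euler_product:
  assumes "v \<in> partitions t s" "gaps_le \<delta> v" "\<delta> * C \<le> 1" "0 \<le> t"
  shows "\<exists>T. transition_family T \<and> has_rates_in T (dominating_rate_matrices Q) \<and>
    infnorm (T t s *v f - euler_product Q v f) \<le> C\<^sup>2 * \<delta> * (s - t) * infnorm f"
  using assms
proof (induction rule: partitions_induct)
  case single
  \<comment> \<open>No interval is left; one dominating rate matrix, taken at the arbitrary function
    \<open>0\<close>, drives the family at all times.\<close>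
  obtain M where M: "M \<in> dominating_rate_matrices Q"
    using dominating_rate_matrix_attains[OF rate, of 0] by blast
  then interpret M: lipschitz_rate_matrix M C
    unfolding lipschitz_rate_matrix_def by (rule dominating_lipschitz)
  show ?case
    using M.transition_family_exp M.has_rates_in_exp[OF M]
    by (intro exI[of _ M.exp_family]) (simp add: M.exp_family_works M.corresponding_refl infnorm_0)
next
  case (Cons t r v)
  have le: "t < r" "r \<le> s" "0 \<le> r" using Cons partitions_le by auto
  define g where "g = euler_product Q (r # v) f"
  obtain T where T: "transition_family T" "has_rates_in T (dominating_rate_matrices Q)"
    "infnorm (T r s *v f - g) \<le> C\<^sup>2 * \<delta> * (s - r) * infnorm f"
    unfolding g_def using Cons.IH Cons.prems Cons.hyps by auto
  obtain M where M: "M \<in> dominating_rate_matrices Q" and Mg: "M *v g = Q g"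
    using dominating_rate_matrix_attains[OF rate] by blast
  then interpret M: lipschitz_rate_matrix M C
    unfolding lipschitz_rate_matrix_def by (intro dominating_lipschitz)
  define U where "U = glue r M.exp_family T"
  have U: "transition_family U" "has_rates_in U (dominating_rate_matrices Q)"
    unfolding U_def
    using transition_family_glue[OF M.transition_family_exp T(1) le(3)]
      has_rates_in_glue[OF M.has_rates_in_exp[OF M] T(2) le(3)] by blast+
  have "T r r = mat 1" using T(1) le(3) by (simp only: transition_family_def)
  then have "U t s *v f = M.exp_family t r *v (T r s *v f)"
    using le by (auto simp: U_def glue_def matrix_vector_mul_assoc)
  then have Uf: "U t s *v f = M.L t r (T r s *v f)" using le by (simp add: M.exp_family_works)
  have rt: "r - t \<le> \<delta>" using Cons.prems by simp
  then have rtC: "(r - t) * C \<le> 1"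
    using mult_right_mono[of "r - t" \<delta> C] C_pos Cons.prems(2) by linarith
  have gN: "infnorm g \<le> infnorm f"
    unfolding g_def by (rule lto_infnorm_le, rule euler_lto) (use Cons in auto)
  have "infnorm (U t s *v f - (g + (r - t) *\<^sub>R Q g))
      \<le> infnorm (M.L t r (T r s *v f) - M.L t r g) + infnorm (M.L t r g - (g + (r - t) *\<^sub>R Q g))"
    unfolding Uf by (rule infnorm_diff_triangle)
  also have "\<dots> \<le> infnorm (T r s *v f - g) + C\<^sup>2 * (r - t)\<^sup>2 * infnorm g"
    using lto_nonexpansive[OF M.corresponding_lto] M.corresponding_step[of t r g] le rtC
    by (intro add_mono) (auto simp: Mg diff_diff_eq)
  also have "\<dots> \<le> C\<^sup>2 * \<delta> * (s - r) * infnorm f + C\<^sup>2 * \<delta> * (r - t) * infnorm f"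
  proof -
    have "(r - t)\<^sup>2 * infnorm g \<le> \<delta> * (r - t) * infnorm f"
      unfolding power2_eq_square using rt le gN
      by (intro mult_mono) (auto intro: infnorm_pos_le)
    from mult_left_mono[OF this, of "C\<^sup>2"] T(3) show ?thesis by (simp add: algebra_simps)
  qed
  also have "\<dots> = C\<^sup>2 * \<delta> * (s - t) * infnorm f" by (simp add: algebra_simps)
  finally show ?case using U by (auto simp: g_def intro!: exI[of _ U])
qed

lemma ex_family_near_corresponding:
  assumes "0 \<le> t" "t \<le> s" "0 < \<epsilon>"
  shows "\<exists>T. transition_family T \<and> has_rates_in T (dominating_rate_matrices Q) \<and>
    infnorm (T t s *v f - L t s f) \<le> \<epsilon>"
proof -
  define K where "K = 2 * C\<^sup>2 * (s - t) * infnorm f"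
  have K: "0 \<le> K" using assms by (simp add: K_def infnorm_pos_le)
  define \<delta> where "\<delta> = min (1 / C) (\<epsilon> / (K + 1))"
  have "\<delta> \<le> 1 / C" "\<delta> \<le> \<epsilon> / (K + 1)" by (simp_all add: \<delta>_def)
  then have \<delta>: "\<delta> * C \<le> 1" "\<delta> * (K + 1) \<le> \<epsilon>"
    using C_pos K by (simp_all add: pos_le_divide_eq)
  have "0 < \<delta>" using C_pos K assms by (simp add: \<delta>_def)
  obtain v where v: "v \<in> partitions t s" "gaps_le \<delta> v"
    using ex_partition[OF assms(2) \<open>0 < \<delta>\<close>] by blast
  obtain T where T: "transition_family T" "has_rates_in T (dominating_rate_matrices Q)"
    "infnorm (T t s *v f - euler_product Q v f) \<le> C\<^sup>2 * \<delta> * (s - t) * infnorm f"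
    using ex_family_near_euler_product[OF v \<delta>(1) assms(1)] by blast
  have "infnorm (T t s *v f - L t s f) \<le> \<delta> * K"
    using infnorm_diff_triangle[of "T t s *v f" "L t s f" "euler_product Q v f"] T(3)
      corresponding_approx[OF assms(2) v \<delta>(1), of f] by (simp add: K_def infnorm_sub mult_ac)
  also have "\<dots> \<le> \<epsilon>" using \<delta> \<open>0 < \<delta>\<close> by (simp add: algebra_simps)
  finally show ?thesis using T by blast
qed

end

section \<open>The domain of a stochastic process\<close>

text \<open>Cylinder events: membership depends only on the states at times in \<open>w\<close>.
  Every event of the domain is one for some finite \<open>w\<close>, so finitely many of them share
  one finite set of times.\<close>

definition determined :: "'x path set \<Rightarrow> real set \<Rightarrow> 'x path set \<Rightarrow> bool" where
  "determined \<Omega> w A \<longleftrightarrow>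
     (\<forall>\<omega>\<in>\<Omega>. \<forall>\<omega>'\<in>\<Omega>. restrict \<omega> w = restrict \<omega>' w \<longrightarrow> \<omega> \<in> A \<longrightarrow> \<omega>' \<in> A)"

lemma restrict_eq_iff: "restrict f A = restrict g A \<longleftrightarrow> (\<forall>a\<in>A. f a = g a)"
  by (metis restrict_apply' restrict_ext)

lemma determined_mono: "determined \<Omega> w A \<Longrightarrow> w \<subseteq> w' \<Longrightarrow> determined \<Omega> w' A"
  unfolding determined_def restrict_eq_iff by (meson subset_iff)

lemma determined_state_event: "t \<in> w \<Longrightarrow> determined \<Omega> w (state_event \<Omega> t x)"
  by (auto simp: determined_def state_event_def restrict_eq_iff)

lemma determined_history_event: "u \<subseteq> w \<Longrightarrow> determined \<Omega> w (history_event \<Omega> u xu)"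
  unfolding determined_def history_event_def
  by (metis (mono_tags, lifting) mem_Collect_eq restrict_eq_iff subset_iff)

text \<open>The sets determined by some finite set of times form an algebra that contains the
  generators; two such sets are both determined by the union of their times.\<close>

lemma determined_event_algebra:
  assumes "A \<in> event_algebra \<Omega> u"
  shows "\<exists>w\<in>time_seqs. determined \<Omega> w A"
proof -
  let ?M = "{A. A \<subseteq> \<Omega> \<and> (\<exists>w\<in>time_seqs. determined \<Omega> w A)}"
  have "algebra \<Omega> ?M"
    unfolding algebra_iff_Un
  proof (intro conjI ballI)
    show "{} \<in> ?M" by (auto simp: determined_def time_seqs_def)
    fix a assume "a \<in> ?M"
    then obtain w where w: "a \<subseteq> \<Omega>" "w \<in> time_seqs" "determined \<Omega> w a" by blast
    then have "determined \<Omega> w (\<Omega> - a)"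
      unfolding determined_def by (metis Diff_iff)
    with w show "\<Omega> - a \<in> ?M" by blast
    fix b assume "b \<in> ?M"
    then obtain w' where w': "b \<subseteq> \<Omega>" "w' \<in> time_seqs" "determined \<Omega> w' b" by blast
    have "determined \<Omega> (w \<union> w') a" "determined \<Omega> (w \<union> w') b"
      using w w' by (auto intro: determined_mono)
    then have "determined \<Omega> (w \<union> w') (a \<union> b)" unfolding determined_def by blast
    moreover have "w \<union> w' \<in> time_seqs" using w w' by (auto simp: time_seqs_def)
    ultimately show "a \<union> b \<in> ?M" using w w' by blast
  qed auto
  moreover have "{state_event \<Omega> t x | t x. 0 \<le> t \<and> (t \<in> u \<or> (\<forall>r\<in>u. r < t))} \<subseteq> ?M"
  proof clarify
    fix t :: real and x assume "0 \<le> t"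
    then have "{t} \<in> time_seqs" by (simp add: time_seqs_def)
    moreover have "determined \<Omega> {t} (state_event \<Omega> t x)" by (simp add: determined_state_event)
    ultimately show "state_event \<Omega> t x \<subseteq> \<Omega> \<and> (\<exists>w\<in>time_seqs. determined \<Omega> w (state_event \<Omega> t x))"
      by (auto simp: state_event_def)
  qed
  ultimately have "event_algebra \<Omega> u \<subseteq> ?M" unfolding event_algebra_def by blast
  then show ?thesis using assms by blast
qed

text \<open>The defining property of \<open>path_space\<close> speaks of non-empty \<open>u\<close>.
  For the empty history, whose event is all of \<open>\<Omega>\<close>, an arbitrary one-point
  history provides a path.\<close>

lemma path_space_history:
  assumes "path_space \<Omega>" "u \<in> time_seqs" "xu \<in> u \<rightarrow>\<^sub>E UNIV"
  shows "history_event \<Omega> u xu \<noteq> {}"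
proof (cases "u = {}")
  case True
  have "(\<lambda>r\<in>{0}. undefined) \<in> {0 :: real} \<rightarrow>\<^sub>E UNIV" by simp
  moreover have "{0 :: real} \<in> time_seqs" by (simp add: time_seqs_def)
  ultimately obtain \<omega> where "\<omega> \<in> \<Omega>"
    using assms(1) unfolding path_space_def by (metis insert_not_empty)
  then show ?thesis using True assms(3) by (auto simp: history_event_def restrict_def)
next
  case False
  then obtain \<omega> where "\<omega> \<in> \<Omega>" "restrict \<omega> u = xu"
    using assms unfolding path_space_def by meson
  then show ?thesis by (auto simp: history_event_def)
qed

lemma process_domain_determined:
  assumes "path_space \<Omega>" "(A, C) \<in> process_domain \<Omega>"
  shows "C \<noteq> {}" "C \<subseteq> \<Omega>" "\<exists>w\<in>time_seqs. determined \<Omega> w A \<and> determined \<Omega> w C"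
proof -
  obtain u xu where u: "u \<in> time_seqs" "xu \<in> u \<rightarrow>\<^sub>E UNIV" "A \<in> event_algebra \<Omega> u" "C = history_event \<Omega> u xu"
    using assms(2) by (auto simp: process_domain_def)
  show "C \<noteq> {}" "C \<subseteq> \<Omega>"
    using path_space_history[OF assms(1) u(1,2)] u(4) by (auto simp: history_event_def)
  obtain w where w: "w \<in> time_seqs" "determined \<Omega> w A" using determined_event_algebra[OF u(3)] by blast
  then have "determined \<Omega> (u \<union> w) A" "determined \<Omega> (u \<union> w) C" "u \<union> w \<in> time_seqs"
    using u by (auto simp: time_seqs_def intro: determined_mono determined_history_event)
  then show "\<exists>w\<in>time_seqs. determined \<Omega> w A \<and> determined \<Omega> w C" by blast
qed

lemma state_event_in_algebra:
  assumes "0 \<le> t" "t \<in> u \<or> (\<forall>r\<in>u. r < t)"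
  shows "state_event \<Omega> t x \<in> event_algebra \<Omega> u"
  using assms unfolding event_algebra_def by blast

lemma time_seqs_before_insert:
  "u \<in> time_seqs_before t \<Longrightarrow> 0 \<le> t \<Longrightarrow> insert t u \<in> time_seqs"
  "u \<in> time_seqs_before t \<Longrightarrow> 0 \<le> t \<Longrightarrow> t < s \<Longrightarrow> insert t u \<in> time_seqs_before s"
  by (force simp: time_seqs_before_def time_seqs_def)+

lemma PiE_upd_UNIV: "xu \<in> u \<rightarrow>\<^sub>E UNIV \<Longrightarrow> xu(t := x) \<in> insert t u \<rightarrow>\<^sub>E UNIV"
  by (auto simp: PiE_def extensional_def)

text \<open>Makes present and past together a single history, the form of conditioning event that
  \<open>process_domain\<close> asks for; \<open>t\<close> is a new time because \<open>u\<close>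
  lies before it.\<close>

lemma state_history_event:
  assumes "u \<in> time_seqs_before t" "xu \<in> u \<rightarrow>\<^sub>E UNIV"
  shows "state_event \<Omega> t x \<inter> history_event \<Omega> u xu = history_event \<Omega> (insert t u) (xu(t := x))"
proof -
  have "t \<notin> u" using assms by (auto simp: time_seqs_before_def)
  have 1: "restrict xu u = xu" "restrict (xu(t := x)) (insert t u) = xu(t := x)"
    by (rule PiE_restrict, fact assms(2)) (rule PiE_restrict, rule PiE_upd_UNIV, fact assms(2))
  have "restrict \<omega> (insert t u) = restrict (xu(t := x)) (insert t u) \<longleftrightarrow> \<omega> t = x \<and> restrict \<omega> u = restrict xu u" for \<omega>
    using \<open>t \<notin> u\<close> unfolding restrict_eq_iff by auto
  then have "restrict \<omega> (insert t u) = xu(t := x) \<longleftrightarrow> \<omega> t = x \<and> restrict \<omega> u = xu" for \<omega>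
    unfolding 1 .
  then show ?thesis by (auto simp: state_event_def history_event_def)
qed

lemma transition_in_domain:
  assumes "u \<in> time_seqs_before t" "xu \<in> u \<rightarrow>\<^sub>E UNIV" "0 \<le> t" "t \<le> s"
  shows "(state_event \<Omega> s y, state_event \<Omega> t x \<inter> history_event \<Omega> u xu) \<in> process_domain \<Omega>"
proof -
  have "s \<in> insert t u \<or> (\<forall>r\<in>insert t u. r < s)"
    using assms by (auto simp: time_seqs_before_def)
  then have "state_event \<Omega> s y \<in> event_algebra \<Omega> (insert t u)"
    using assms by (intro state_event_in_algebra) auto
  then show ?thesis
    unfolding state_history_event[OF assms(1,2)] process_domain_def
    using time_seqs_before_insert(1)[OF assms(1,3)] PiE_upd_UNIV[OF assms(2)] by blast
qed

section \<open>Gains and the finitely many values that they take\<close>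

abbreviation gain ::
  "'x conditional \<Rightarrow> nat \<Rightarrow> (nat \<Rightarrow> 'x path set) \<Rightarrow> (nat \<Rightarrow> 'x path set) \<Rightarrow> (nat \<Rightarrow> real) \<Rightarrow> 'x path \<Rightarrow> real"
  where "gain P n A C l \<omega> \<equiv> \<Sum>i=1..n. l i * indicator (C i) \<omega> * (P (A i, C i) - indicator (A i) \<omega>)"

text \<open>A path enters the gain only through its memberships in the finitely many events. So the
  gain takes finitely many values, and for a fixed pattern it is continuous in \<open>P\<close>;
  this gives attainment of the maximum and closedness of the coherence condition.\<close>

definition pattern ::
  "nat \<Rightarrow> (nat \<Rightarrow> 'x path set) \<Rightarrow> (nat \<Rightarrow> 'x path set) \<Rightarrow> 'x path \<Rightarrow> nat \<Rightarrow> bool \<times> bool" where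
  "pattern n A C \<omega> = (\<lambda>i\<in>{1..n}. (\<omega> \<in> C i, \<omega> \<in> A i))"

definition pattern_gain ::
  "'x conditional \<Rightarrow> nat \<Rightarrow> (nat \<Rightarrow> 'x path set) \<Rightarrow> (nat \<Rightarrow> 'x path set) \<Rightarrow> (nat \<Rightarrow> real)
     \<Rightarrow> (nat \<Rightarrow> bool \<times> bool) \<Rightarrow> real" where
  "pattern_gain P n A C l p =
     (\<Sum>i=1..n. l i * of_bool (fst (p i)) * (P (A i, C i) - of_bool (snd (p i))))"

lemma gain_pattern: "gain P n A C l \<omega> = pattern_gain P n A C l (pattern n A C \<omega>)"
  unfolding pattern_gain_def by (intro sum.cong) (auto simp: pattern_def indicator_def)

lemma finite_pattern: "finite (pattern n A C ` X)"
  by (rule finite_subset[of _ "{1..n} \<rightarrow>\<^sub>E UNIV"]) (auto simp: pattern_def intro: finite_PiE)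

lemma coherent_iff:
  assumes "path_space \<Omega>"
  shows "coherent \<Omega> P \<longleftrightarrow>
    (\<forall>n\<ge>1. \<forall>A C l. (\<forall>i\<in>{1..n}. (A i, C i) \<in> process_domain \<Omega>) \<longrightarrow>
       (\<exists>\<omega>\<in>\<Union>i\<in>{1..n}. C i. 0 \<le> gain P n A C l \<omega>))"
proof -
  have "0 \<le> Max (gain P n A C l ` (\<Union>i\<in>{1..n}. C i)) \<longleftrightarrow> (\<exists>\<omega>\<in>\<Union>i\<in>{1..n}. C i. 0 \<le> gain P n A C l \<omega>)"
    if "n \<ge> 1" "\<forall>i\<in>{1..n}. (A i, C i) \<in> process_domain \<Omega>" for n A C l
  proof -
    have "1 \<in> {1..n}" using that(1) by simp
    then have "(A 1, C 1) \<in> process_domain \<Omega>" using that(2) by blast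
    then have "C 1 \<noteq> {}" by (rule process_domain_determined(1)[OF assms])
    then have "(\<Union>i\<in>{1..n}. C i) \<noteq> {}" using \<open>1 \<in> {1..n}\<close> by blast
    moreover have "gain P n A C l ` (\<Union>i\<in>{1..n}. C i)
        = pattern_gain P n A C l ` pattern n A C ` (\<Union>i\<in>{1..n}. C i)"
      unfolding gain_pattern image_image ..
    then have "finite (gain P n A C l ` (\<Union>i\<in>{1..n}. C i))" by (simp add: finite_pattern)
    ultimately show ?thesis by (subst Max_ge_iff) auto
  qed
  then show ?thesis unfolding coherent_def by (intro iff_allI imp_cong refl)
qed

section \<open>Finite-dimensional expectations of a Markov chain\<close>

text \<open>With no earlier time point the state is drawn uniformly, so that the earliest state,
  too, takes every value with positive probability.\<close>

definition transition_step ::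
  "(real \<Rightarrow> real \<Rightarrow> 'x \<Rightarrow> 'x::finite \<Rightarrow> real) \<Rightarrow> real list \<Rightarrow> real \<Rightarrow> (real \<Rightarrow> 'x) \<Rightarrow> 'x \<Rightarrow> real" where
  "transition_step K ts t z y = (case ts of [] \<Rightarrow> 1 / CARD('x) | r # _ \<Rightarrow> K r t (z r) y)"

text \<open>The time points are listed from the latest to the earliest one.\<close>

fun chain_expectation ::
  "(real \<Rightarrow> real \<Rightarrow> 'x \<Rightarrow> 'x::finite \<Rightarrow> real) \<Rightarrow> real list \<Rightarrow> ((real \<Rightarrow> 'x) \<Rightarrow> real) \<Rightarrow> real" where
  "chain_expectation K [] F = F (\<lambda>_. undefined)"
| "chain_expectation K (t # ts) F =
     chain_expectation K ts (\<lambda>z. \<Sum>y\<in>UNIV. transition_step K ts t z y * F (z(t := y)))"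

text \<open>\<open>chain_expectation\<close> evaluates its integrand only at functions that are
  \<open>undefined\<close> off the listed times, that is, at state assignments.\<close>

lemma chain_expectation_cong:
  assumes "\<And>z. z \<in> extensional (set ts) \<Longrightarrow> F z = G z"
  shows "chain_expectation K ts F = chain_expectation K ts G"
  using assms
proof (induction ts arbitrary: F G)
  case (Cons t ts)
  have "z(t := y) \<in> extensional (set (t # ts))" if "z \<in> extensional (set ts)" for z :: "real \<Rightarrow> 'a" and y
    using that by (auto simp: extensional_def)
  then show ?case
    unfolding chain_expectation.simps using Cons.prems
    by (intro Cons.IH sum.cong arg_cong2[of _ _ _ _ "(*)"] refl) blast
qed (simp add: extensional_def)

lemma chain_expectation_add:
  "chain_expectation K ts (\<lambda>z. F z + G z) = chain_expectation K ts F + chain_expectation K ts G"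
  by (induction ts arbitrary: F G) (simp_all add: distrib_left sum.distrib)

lemma chain_expectation_mult:
  "chain_expectation K ts (\<lambda>z. c * F z) = c * chain_expectation K ts F"
  by (induction ts arbitrary: F) (simp_all add: mult.left_commute flip: sum_distrib_left)

lemma chain_expectation_diff:
  "chain_expectation K ts (\<lambda>z. F z - G z) = chain_expectation K ts F - chain_expectation K ts G"
  using chain_expectation_add[of K ts F "\<lambda>z. (-1) * G z"] chain_expectation_mult[of K ts "-1" G]
  by simp

lemma chain_expectation_zero: "chain_expectation K ts (\<lambda>z. 0) = 0"
  using chain_expectation_mult[of K ts 0 "\<lambda>z. 0"] by simp

lemma chain_expectation_sum:
  "finite I \<Longrightarrow> chain_expectation K ts (\<lambda>z. \<Sum>i\<in>I. F i z) = (\<Sum>i\<in>I. chain_expectation K ts (F i))"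
  by (induction I rule: finite_induct) (simp_all add: chain_expectation_zero chain_expectation_add)

locale positive_kernel =
  fixes K :: "real \<Rightarrow> real \<Rightarrow> 'x \<Rightarrow> 'x::finite \<Rightarrow> real"
  assumes K_pos: "0 < K r t a b"
    and K_sum: "(\<Sum>b\<in>UNIV. K r t a b) = 1"
begin

lemma transition_step_pos: "0 < transition_step K ts t z y"
  by (auto simp: transition_step_def K_pos split: list.split)

lemma transition_step_sum: "(\<Sum>y\<in>UNIV. transition_step K ts t z y) = 1"
  by (cases ts) (simp_all add: transition_step_def K_sum)

lemma chain_expectation_nonneg:
  assumes "\<And>z. z \<in> extensional (set ts) \<Longrightarrow> 0 \<le> F z"
  shows "0 \<le> chain_expectation K ts F"
  using assms
proof (induction ts arbitrary: F)
  case (Cons t ts)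
  have "z(t := y) \<in> extensional (set (t # ts))" if "z \<in> extensional (set ts)" for z :: "real \<Rightarrow> 'x" and y
    using that by (auto simp: extensional_def)
  then show ?case
    unfolding chain_expectation.simps using Cons.prems
    by (intro Cons.IH sum_nonneg mult_nonneg_nonneg less_imp_le[OF transition_step_pos]) blast
qed (simp add: extensional_def)

lemma chain_expectation_mono:
  assumes "\<And>z. z \<in> extensional (set ts) \<Longrightarrow> F z \<le> G z"
  shows "chain_expectation K ts F \<le> chain_expectation K ts G"
  using chain_expectation_nonneg[of ts "\<lambda>z. G z - F z"] assms by (simp add: chain_expectation_diff)

lemma chain_expectation_pos:
  assumes "distinct ts" "\<And>z. z \<in> extensional (set ts) \<Longrightarrow> 0 \<le> F z"
    and "z0 \<in> extensional (set ts)" "0 < F z0"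
  shows "0 < chain_expectation K ts F"
  using assms
proof (induction ts arbitrary: F z0)
  case Nil
  then have "z0 = (\<lambda>_. undefined)" by (auto simp: extensional_def)
  then show ?case using Nil by simp
next
  case (Cons t ts)
  have ext: "z(t := y) \<in> extensional (set (t # ts))" if "z \<in> extensional (set ts)" for z :: "real \<Rightarrow> 'x" and y
    using that by (auto simp: extensional_def)
  let ?G = "\<lambda>z. \<Sum>y\<in>UNIV. transition_step K ts t z y * F (z(t := y))"
  have nn: "0 \<le> transition_step K ts t z y * F (z(t := y))" if "z \<in> extensional (set ts)" for z y
    by (intro mult_nonneg_nonneg Cons.prems(2) ext that less_imp_le[OF transition_step_pos])
  \<comment> \<open>Erasing the latest state of \<open>z0\<close> yields an assignment on the
    earlier times at which the inner sum is positive.\<close>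
  define z1 where "z1 = z0(t := undefined)"
  have z1: "z1 \<in> extensional (set ts)" "z1(t := z0 t) = z0"
    using Cons.prems(3) by (auto simp: z1_def extensional_def)
  have "0 < transition_step K ts t z1 (z0 t) * F (z1(t := z0 t))"
    using Cons.prems(4) transition_step_pos by (simp add: z1)
  also have "\<dots> \<le> ?G z1"
    by (rule member_le_sum) (use nn z1 in auto)
  finally have "0 < chain_expectation K ts ?G"
    by (intro Cons.IH[of ?G z1] sum_nonneg nn z1(1)) (use Cons.prems(1) in simp)
  then show ?case by simp
qed

lemma chain_expectation_unused:
  assumes "\<And>z y. F (z(t := y)) = F z"
  shows "chain_expectation K (t # ts) F = chain_expectation K ts F"
  using assms by (simp add: transition_step_sum flip: sum_distrib_right)

end

text \<open>
  Mixing in the uniform distribution makes the kernels strictly positive; outside \<open>0 \<le> r \<le> t\<close> the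
  value is irrelevant.
\<close>

definition perturbed_kernel ::
  "(real \<Rightarrow> real \<Rightarrow> real ^ 'x ^ 'x::finite) \<Rightarrow> real \<Rightarrow> real \<Rightarrow> real \<Rightarrow> 'x \<Rightarrow> 'x \<Rightarrow> real" where
  "perturbed_kernel T \<epsilon> r t a b =
     (if 0 \<le> r \<and> r \<le> t then (1 - \<epsilon>) * T r t $ a $ b + \<epsilon> / CARD('x) else 1 / CARD('x))"

locale perturbed_family =
  fixes T :: "real \<Rightarrow> real \<Rightarrow> real ^ 'x ^ 'x::finite" and \<epsilon> :: real
  assumes T: "transition_family T" and \<epsilon>: "0 < \<epsilon>" "\<epsilon> < 1"
begin

lemma T_nonneg: "0 \<le> t \<Longrightarrow> t \<le> s \<Longrightarrow> 0 \<le> T t s $ x $ y"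
  and T_sum: "0 \<le> t \<Longrightarrow> t \<le> s \<Longrightarrow> (\<Sum>y\<in>UNIV. T t s $ x $ y) = 1"
  and T_refl: "0 \<le> t \<Longrightarrow> T t t = mat 1"
  and T_mult: "0 \<le> t \<Longrightarrow> t \<le> r \<Longrightarrow> r \<le> s \<Longrightarrow> T t s = T t r ** T r s"
  using T unfolding transition_family_def by metis+

lemma T_le_1: "0 \<le> t \<Longrightarrow> t \<le> s \<Longrightarrow> T t s $ x $ y \<le> 1"
  using member_le_sum[of y UNIV "\<lambda>y. T t s $ x $ y"] T_nonneg T_sum[of t s x] by simp

sublocale positive_kernel "perturbed_kernel T \<epsilon>"
proof
  fix r t a b
  show "0 < perturbed_kernel T \<epsilon> r t a b"
    using \<epsilon> T_nonneg[of r t a b] by (auto simp: perturbed_kernel_def intro!: add_nonneg_pos)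
  show "(\<Sum>b\<in>UNIV. perturbed_kernel T \<epsilon> r t a b) = 1"
    using T_sum[of r t a]
    by (cases "0 \<le> r \<and> r \<le> t")
      (auto simp: perturbed_kernel_def sum.distrib simp flip: sum_distrib_left)
qed

lemma perturbed_kernel_near:
  assumes "0 \<le> r" "r \<le> t"
  shows "\<bar>perturbed_kernel T \<epsilon> r t a b - T r t $ a $ b\<bar> \<le> \<epsilon>"
proof -
  have "perturbed_kernel T \<epsilon> r t a b - T r t $ a $ b = \<epsilon> * (1 / CARD('x) - T r t $ a $ b)"
    using assms by (simp add: perturbed_kernel_def algebra_simps)
  moreover have "\<bar>1 / CARD('x) - T r t $ a $ b\<bar> \<le> 1"
  proof -
    have "0 < 1 / real CARD('x)" "1 / real CARD('x) \<le> 1" by auto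
    then show ?thesis using T_nonneg[OF assms, of a b] T_le_1[OF assms, of a b] by linarith
  qed
  ultimately show ?thesis using \<epsilon> by (simp add: abs_mult)
qed

abbreviation "E \<equiv> chain_expectation (perturbed_kernel T \<epsilon>)"

text \<open>The Markov property up to an error, for a weight \<open>G\<close> that depends on the
  past up to \<open>t\<close>, such as the indicator of a history. The perturbed kernels satisfy the
  Chapman-Kolmogorov equation only approximately, so errors accumulate over the time points between
  \<open>t\<close> and \<open>s\<close>. Passing one of them adds \<open>\<epsilon>\<close> for the
  kernel and sums an earlier error over \<open>CARD('x)\<close> states: a factor \<open>c\<close>
  becomes \<open>1 + CARD('x) * c \<le> (CARD('x) + 1) * c\<close>.\<close>

lemma chain_markov:
  assumes "sorted_wrt (>) ts" "\<forall>r\<in>set ts. 0 \<le> r" "t \<in> set ts" "s \<in> set ts" "t \<le> s"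
    and G: "\<And>z. 0 \<le> G z" "\<And>z r y. t < r \<Longrightarrow> G (z(r := y)) = G z"
  shows "\<bar>E ts (\<lambda>z. G z * of_bool (z s = y)) - E ts (\<lambda>z. G z * T t s $ (z t) $ y)\<bar>
          \<le> \<epsilon> * (CARD('x) + 1) ^ length ts * E ts G"
  using assms(1-5)
proof (induction ts arbitrary: s y)
  case Nil
  then show ?case by simp
next
  case (Cons h ts)
  have EG: "0 \<le> E us G" for us using G(1) by (intro chain_expectation_nonneg)
  show ?case
  proof (cases "h = s")
    case False
    then have "t < h" "s < h" using Cons.prems by auto
    \<comment> \<open>Time points after \<open>s\<close> are integrated out, as neither side depends
      on them.\<close>
    then have unused: "E (h # ts) (\<lambda>z. G z * of_bool (z s = y)) = E ts (\<lambda>z. G z * of_bool (z s = y))"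
      "E (h # ts) (\<lambda>z. G z * T t s $ (z t) $ y) = E ts (\<lambda>z. G z * T t s $ (z t) $ y)"
      "E (h # ts) G = E ts G"
      using G(2) by (intro chain_expectation_unused, simp)+
    have "\<bar>E (h # ts) (\<lambda>z. G z * of_bool (z s = y)) - E (h # ts) (\<lambda>z. G z * T t s $ (z t) $ y)\<bar>
        \<le> \<epsilon> * (CARD('x) + 1) ^ length ts * E (h # ts) G"
      unfolding unused by (rule Cons.IH) (use Cons.prems False \<open>t < h\<close> in auto)
    also have "\<dots> \<le> \<epsilon> * (CARD('x) + 1) ^ length (h # ts) * E (h # ts) G"
      using \<epsilon> by (intro mult_right_mono mult_left_mono power_increasing EG) auto
    finally show ?thesis .
  next
    case h: True
    show ?thesis
    proof (cases "t = s")
      case True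
      then have "(\<lambda>z. G z * T t s $ (z t) $ y) = (\<lambda>z. G z * of_bool (z s = y))"
        using T_refl[of t] Cons.prems by (auto simp: mat_def)
      then show ?thesis using \<epsilon> EG[of "h # ts"] by simp
    next
      case False
      then have ts: "t \<in> set ts" "t < s" using Cons.prems h by auto
      \<comment> \<open>\<open>p\<close> is the time point just before \<open>s\<close>; splitting
        \<open>T t s\<close> at \<open>p\<close> brings the induction hypothesis for
        \<open>p\<close> into play.\<close>
      then obtain p us where us: "ts = p # us" by (cases ts) auto
      have p: "p < s" "t \<le> p" "0 \<le> p" "0 \<le> t" "p \<in> set ts"
        using Cons.prems h ts by (auto simp: us)
      let ?c = "real (CARD('x) + 1) ^ length ts"
      let ?F = "\<lambda>a z. G z * of_bool (z p = a)"
      let ?H = "\<lambda>a z. G z * T t p $ (z t) $ a"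
      have 1: "E (h # ts) (\<lambda>z. G z * of_bool (z s = y)) = E ts (\<lambda>z. G z * perturbed_kernel T \<epsilon> p s (z p) y)"
        using G(2)[OF ts(2)]
        by (simp add: h us transition_step_def of_bool_def if_distrib mult.commute cong: if_cong)
      have 2: "E (h # ts) (\<lambda>z. G z * T t s $ (z t) $ y) = E ts (\<lambda>z. G z * T t s $ (z t) $ y)"
        "E (h # ts) G = E ts G"
        unfolding h using G(2)[OF ts(2)] ts(2) by (intro chain_expectation_unused, simp)+
      have 3: "\<bar>E ts (\<lambda>z. G z * perturbed_kernel T \<epsilon> p s (z p) y) - E ts (\<lambda>z. G z * T p s $ (z p) $ y)\<bar>
          \<le> \<epsilon> * E ts G"
      proof -
        have "\<bar>G z * perturbed_kernel T \<epsilon> p s (z p) y - G z * T p s $ (z p) $ y\<bar> \<le> \<epsilon> * G z" for z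
          using mult_left_mono[OF perturbed_kernel_near[of p s "z p" y] G(1)[of z]] p G(1)[of z]
          by (simp add: abs_mult mult.commute flip: right_diff_distrib)
        then have "E ts (\<lambda>z. G z * perturbed_kernel T \<epsilon> p s (z p) y - G z * T p s $ (z p) $ y) \<le> E ts (\<lambda>z. \<epsilon> * G z)"
          "E ts (\<lambda>z. G z * T p s $ (z p) $ y - G z * perturbed_kernel T \<epsilon> p s (z p) y) \<le> E ts (\<lambda>z. \<epsilon> * G z)"
          by (auto simp: abs_le_iff intro!: chain_expectation_mono)
        then show ?thesis
          by (simp add: chain_expectation_diff chain_expectation_mult abs_le_iff)
      qed
      have 4: "E ts (\<lambda>z. G z * T p s $ (z p) $ y) = (\<Sum>a\<in>UNIV. T p s $ a $ y * E ts (?F a))"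
      proof -
        have "G z * T p s $ (z p) $ y = (\<Sum>a\<in>UNIV. T p s $ a $ y * ?F a z)" for z
          by (simp add: of_bool_def if_distrib mult.commute cong: if_cong)
        then show ?thesis by (simp add: chain_expectation_sum chain_expectation_mult)
      qed
      have 5: "E ts (\<lambda>z. G z * T t s $ (z t) $ y) = (\<Sum>a\<in>UNIV. T p s $ a $ y * E ts (?H a))"
      proof -
        have "G z * T t s $ (z t) $ y = (\<Sum>a\<in>UNIV. T p s $ a $ y * ?H a z)" for z
          using T_mult[of t p s] p
          by (simp add: matrix_matrix_mult_def sum_distrib_left mult_ac)
        then show ?thesis by (simp add: chain_expectation_sum chain_expectation_mult)
      qed
      have "\<bar>(\<Sum>a\<in>UNIV. T p s $ a $ y * E ts (?F a)) - (\<Sum>a\<in>UNIV. T p s $ a $ y * E ts (?H a))\<bar>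
          \<le> (\<Sum>a\<in>UNIV. \<bar>T p s $ a $ y * (E ts (?F a) - E ts (?H a))\<bar>)"
        unfolding right_diff_distrib sum_subtractf[symmetric] by (rule sum_abs)
      also have "\<dots> \<le> (\<Sum>a\<in>(UNIV :: 'x set). \<epsilon> * ?c * E ts G)"
      proof (rule sum_mono)
        fix a
        have "\<bar>E ts (?F a) - E ts (?H a)\<bar> \<le> \<epsilon> * ?c * E ts G"
          using Cons.IH[of p a] Cons.prems p ts by simp
        then have "T p s $ a $ y * \<bar>E ts (?F a) - E ts (?H a)\<bar> \<le> 1 * (\<epsilon> * ?c * E ts G)"
          using p T_nonneg T_le_1 by (intro mult_mono) auto
        then show "\<bar>T p s $ a $ y * (E ts (?F a) - E ts (?H a))\<bar> \<le> \<epsilon> * ?c * E ts G"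
          using p T_nonneg[of p s a y] by (simp add: abs_mult)
      qed
      also have "\<dots> = CARD('x) * (\<epsilon> * ?c * E ts G)" by simp
      finally have 6: "\<bar>E ts (\<lambda>z. G z * T p s $ (z p) $ y) - E ts (\<lambda>z. G z * T t s $ (z t) $ y)\<bar>
          \<le> CARD('x) * (\<epsilon> * ?c * E ts G)" unfolding 4 5 .
      have "1 * (\<epsilon> * E ts G) \<le> ?c * (\<epsilon> * E ts G)"
        using \<epsilon> EG by (intro mult_right_mono one_le_power) auto
      then have "\<epsilon> * E ts G + CARD('x) * (\<epsilon> * ?c * E ts G) \<le> \<epsilon> * (CARD('x) + 1) ^ length (h # ts) * E ts G"
        by (simp add: algebra_simps)
      then show ?thesis unfolding 1 2 using 3 6 by linarith
    qed
  qed
qed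

end

section \<open>Existence of processes with given transition matrices\<close>

text \<open>Some path that realises the assignment \<open>z\<close> on \<open>w\<close>; for events
  determined by \<open>w\<close> the choice does not matter.\<close>

definition lift_path :: "'x path set \<Rightarrow> real set \<Rightarrow> 'x path \<Rightarrow> 'x path" where
  "lift_path \<Omega> w z = (SOME \<omega>. \<omega> \<in> \<Omega> \<and> restrict \<omega> w = z)"

lemma lift_path:
  assumes "path_space \<Omega>" "w \<in> time_seqs" "z \<in> extensional w"
  shows "lift_path \<Omega> w z \<in> \<Omega>" "restrict (lift_path \<Omega> w z) w = z"
proof -
  have "z \<in> w \<rightarrow>\<^sub>E UNIV" using assms(3) by (simp add: PiE_def)
  then have "\<exists>\<omega>. \<omega> \<in> \<Omega> \<and> restrict \<omega> w = z"
    using path_space_history[OF assms(1,2)] by (auto simp: history_event_def)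
  then have "lift_path \<Omega> w z \<in> \<Omega> \<and> restrict (lift_path \<Omega> w z) w = z"
    unfolding lift_path_def by (rule someI_ex)
  then show "lift_path \<Omega> w z \<in> \<Omega>" "restrict (lift_path \<Omega> w z) w = z" by auto
qed

definition descending_times :: "real set \<Rightarrow> real list" where
  "descending_times w = rev (sorted_list_of_set w)"

lemma descending_times:
  assumes "w \<in> time_seqs"
  shows "set (descending_times w) = w" "sorted_wrt (>) (descending_times w)"
    "distinct (descending_times w)" "length (descending_times w) = card w"
  using assms strict_sorted_list_of_set[of w]
  by (auto simp: descending_times_def time_seqs_def sorted_wrt_rev)

text \<open>An elementary conditional probability for events determined by \<open>w\<close>. It is
  defined on all pairs of sets, so that these functions for different \<open>w\<close> lie in one
  product space.\<close>

definition chain_conditional ::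
  "(real \<Rightarrow> real \<Rightarrow> real ^ 'x ^ 'x::finite) \<Rightarrow> real \<Rightarrow> 'x path set \<Rightarrow> real set \<Rightarrow> 'x conditional" where
  "chain_conditional T \<epsilon> \<Omega> w = (\<lambda>(A, C).
     chain_expectation (perturbed_kernel T \<epsilon>) (descending_times w) (\<lambda>z. indicator (A \<inter> C) (lift_path \<Omega> w z)) /
     chain_expectation (perturbed_kernel T \<epsilon>) (descending_times w) (\<lambda>z. indicator C (lift_path \<Omega> w z)))"

context perturbed_family
begin

text \<open>Holds for arbitrary pairs of sets: a vanishing denominator makes the quotient
  \<open>0\<close>.\<close>

lemma chain_conditional_range: "0 \<le> chain_conditional T \<epsilon> \<Omega> w p" "chain_conditional T \<epsilon> \<Omega> w p \<le> 1"
proof -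
  obtain A C where p: "p = (A, C)" by (cases p)
  let ?N = "E (descending_times w) (\<lambda>z. indicator (A \<inter> C) (lift_path \<Omega> w z))"
  let ?D = "E (descending_times w) (\<lambda>z. indicator C (lift_path \<Omega> w z))"
  have "0 \<le> ?N" by (intro chain_expectation_nonneg) simp
  moreover have "?N \<le> ?D" by (intro chain_expectation_mono) (auto simp: indicator_def)
  ultimately show "0 \<le> chain_conditional T \<epsilon> \<Omega> w p" "chain_conditional T \<epsilon> \<Omega> w p \<le> 1"
    unfolding chain_conditional_def p by (auto simp: divide_le_eq_1)
qed

lemma chain_event_pos:
  assumes "path_space \<Omega>" "w \<in> time_seqs" "determined \<Omega> w C" "C \<noteq> {}" "C \<subseteq> \<Omega>"
  shows "0 < E (descending_times w) (\<lambda>z. indicator C (lift_path \<Omega> w z))"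
proof -
  obtain \<omega> where \<omega>: "\<omega> \<in> C" "\<omega> \<in> \<Omega>" using assms by blast
  have ext: "restrict \<omega> w \<in> extensional w" by simp
  have "lift_path \<Omega> w (restrict \<omega> w) \<in> C"
    using assms(3) \<omega> lift_path[OF assms(1,2) ext] unfolding determined_def by metis
  then show ?thesis
    by (intro chain_expectation_pos[of _ _ "restrict \<omega> w"])
      (use descending_times[OF assms(2)] ext in simp_all)
qed

text \<open>Every bet has expectation zero under the chain, hence so does the total gain. Were the
  gain negative on the whole union of conditioning events, being zero off it, its expectation would
  be negative, since every state assignment has positive probability.\<close>

lemma chain_conditional_coherent:
  assumes \<Omega>: "path_space \<Omega>" and w: "w \<in> time_seqs" and "n \<ge> 1"
    and det: "\<And>i. i \<in> {1..n} \<Longrightarrow> determined \<Omega> w (C i) \<and> C i \<noteq> {} \<and> C i \<subseteq> \<Omega>"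
  shows "\<exists>\<omega>\<in>\<Union>i\<in>{1..n}. C i. 0 \<le> gain (chain_conditional T \<epsilon> \<Omega> w) n A C l \<omega>"
proof (rule ccontr)
  let ?P = "chain_conditional T \<epsilon> \<Omega> w" and ?ts = "descending_times w" and ?f = "lift_path \<Omega> w"
  assume "\<not> ?thesis"
  then have neg: "gain ?P n A C l \<omega> < 0" if "\<omega> \<in> (\<Union>i\<in>{1..n}. C i)" for \<omega>
    using that by (meson not_le)
  have nonpos: "gain ?P n A C l \<omega> \<le> 0" for \<omega>
  proof (cases "\<omega> \<in> (\<Union>i\<in>{1..n}. C i)")
    case False
    then have "l i * indicator (C i) \<omega> * (?P (A i, C i) - indicator (A i) \<omega>) = 0" if "i \<in> {1..n}" for i
      using that by simp
    then have "gain ?P n A C l \<omega> = 0" by (rule sum.neutral[OF ballI])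
    then show ?thesis by simp
  qed (use neg less_imp_le in blast)
  have summand: "E ?ts (\<lambda>z. l i * indicator (C i) (?f z) * (?P (A i, C i) - indicator (A i) (?f z))) = 0"
    if "i \<in> {1..n}" for i
  proof -
    have pos: "0 < E ?ts (\<lambda>z. indicator (C i) (?f z))"
      using chain_event_pos[OF \<Omega> w] det[OF that] by blast
    have "(\<lambda>z. l i * indicator (C i) (?f z) * (?P (A i, C i) - indicator (A i) (?f z)))
        = (\<lambda>z. l i * (?P (A i, C i) * indicator (C i) (?f z) - indicator (A i \<inter> C i) (?f z)))"
      by (auto simp: indicator_def fun_eq_iff)
    then have "E ?ts (\<lambda>z. l i * indicator (C i) (?f z) * (?P (A i, C i) - indicator (A i) (?f z)))
        = l i * (?P (A i, C i) * E ?ts (\<lambda>z. indicator (C i) (?f z)) - E ?ts (\<lambda>z. indicator (A i \<inter> C i) (?f z)))"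
      by (simp only: chain_expectation_mult chain_expectation_diff)
    also have "\<dots> = 0" using pos by (simp add: chain_conditional_def)
    finally show ?thesis .
  qed
  have zero: "E ?ts (\<lambda>z. gain ?P n A C l (?f z)) = 0"
    by (subst chain_expectation_sum) (use summand in \<open>simp_all\<close>)
  have 1: "1 \<in> {1..n}" using \<open>n \<ge> 1\<close> by simp
  then obtain \<omega> where \<omega>: "\<omega> \<in> C 1" "\<omega> \<in> \<Omega>" using det by blast
  have ext: "restrict \<omega> w \<in> extensional w" by simp
  have "?f (restrict \<omega> w) \<in> C 1"
    using det[OF 1] \<omega> lift_path[OF \<Omega> w ext] unfolding determined_def by metis
  then have "gain ?P n A C l (?f (restrict \<omega> w)) < 0" using neg 1 by blast
  then have "0 < E ?ts (\<lambda>z. (-1) * gain ?P n A C l (?f z))"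
    by (intro chain_expectation_pos[of _ _ "restrict \<omega> w"])
      (use descending_times[OF w] nonpos ext in simp_all)
  then show False unfolding chain_expectation_mult zero by simp
qed

text \<open>With \<open>G\<close> the indicator of the conditioning event, the error bound of
  \<open>chain_markov\<close> is proportional to the probability of that event. Division therefore
  leaves a bound in terms of \<open>\<epsilon>\<close> and the number of time points.\<close>

lemma chain_conditional_transition:
  assumes \<Omega>: "path_space \<Omega>" and w: "w \<in> time_seqs" "insert t (insert s u) \<subseteq> w"
    and u: "u \<in> time_seqs_before t" "xu \<in> u \<rightarrow>\<^sub>E UNIV" "0 \<le> t" "t \<le> s"
  shows "\<bar>chain_conditional T \<epsilon> \<Omega> w (state_event \<Omega> s y, state_event \<Omega> t x \<inter> history_event \<Omega> u xu)
    - T t s $ x $ y\<bar> \<le> \<epsilon> * (CARD('x) + 1) ^ card w"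
proof -
  let ?ts = "descending_times w" and ?f = "lift_path \<Omega> w"
  let ?C = "state_event \<Omega> t x \<inter> history_event \<Omega> u xu"
  define G :: "(real \<Rightarrow> 'x) \<Rightarrow> real" where "G z = of_bool (z t = x \<and> restrict z u = xu)" for z
  note ts = descending_times[OF w(1)]
  have f: "?f z \<in> \<Omega>" "\<forall>r\<in>w. ?f z r = z r" if "z \<in> extensional w" for z
  proof -
    have "restrict (?f z) w r = z r" for r using lift_path[OF \<Omega> w(1) that] by simp
    then show "\<forall>r\<in>w. ?f z r = z r" by (metis restrict_apply')
  qed (rule lift_path[OF \<Omega> w(1) that])
  have C: "indicator ?C (?f z) = G z"
    and AC: "indicator (state_event \<Omega> s y \<inter> ?C) (?f z) = G z * of_bool (z s = y)"
    if z: "z \<in> extensional w" for z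
  proof -
    have "restrict (?f z) u = restrict z u" using f(2)[OF z] w(2) by (auto simp: restrict_eq_iff)
    moreover have "?f z t = z t" "?f z s = z s" using f(2)[OF z] w(2) by auto
    ultimately show "indicator ?C (?f z) = G z"
      "indicator (state_event \<Omega> s y \<inter> ?C) (?f z) = G z * of_bool (z s = y)"
      using f(1)[OF z] by (auto simp: G_def indicator_def state_event_def history_event_def)
  qed
  have EC: "E ?ts (\<lambda>z. indicator ?C (?f z)) = E ?ts G"
    and EAC: "E ?ts (\<lambda>z. indicator (state_event \<Omega> s y \<inter> ?C) (?f z)) = E ?ts (\<lambda>z. G z * of_bool (z s = y))"
    using C AC ts(1) by (intro chain_expectation_cong, simp)+
  have "determined \<Omega> w ?C" "?C \<noteq> {}" "?C \<subseteq> \<Omega>"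
    unfolding state_history_event[OF u(1,2)]
    using determined_history_event[of "insert t u" w] w(2)
      path_space_history[OF \<Omega> time_seqs_before_insert(1)[OF u(1,3)] PiE_upd_UNIV[OF u(2)]]
    by (auto simp: history_event_def)
  then have pos: "0 < E ?ts G" using chain_event_pos[OF \<Omega> w(1)] by (simp flip: EC)
  have "G (z(r := a)) = G z" if "t < r" for z r a
  proof -
    have "r \<noteq> t" "r \<notin> u" using that u(1) by (auto simp: time_seqs_before_def)
    then have "restrict (z(r := a)) u = restrict z u" by (auto simp: restrict_eq_iff)
    then show ?thesis using \<open>r \<noteq> t\<close> by (simp add: G_def)
  qed
  then have "\<bar>E ?ts (\<lambda>z. G z * of_bool (z s = y)) - E ?ts (\<lambda>z. G z * T t s $ (z t) $ y)\<bar>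
      \<le> \<epsilon> * (CARD('x) + 1) ^ length ?ts * E ?ts G"
    using ts w u by (intro chain_markov) (auto simp: G_def time_seqs_def)
  moreover have "(\<lambda>z. G z * T t s $ (z t) $ y) = (\<lambda>z. T t s $ x $ y * G z)"
    by (auto simp: G_def)
  ultimately have "\<bar>E ?ts (\<lambda>z. G z * of_bool (z s = y)) - T t s $ x $ y * E ?ts G\<bar>
      \<le> \<epsilon> * (CARD('x) + 1) ^ card w * E ?ts G"
    by (simp only: chain_expectation_mult ts(4))
  moreover have "chain_conditional T \<epsilon> \<Omega> w (state_event \<Omega> s y, ?C) - T t s $ x $ y
      = (E ?ts (\<lambda>z. G z * of_bool (z s = y)) - T t s $ x $ y * E ?ts G) / E ?ts G"
    using pos by (simp add: chain_conditional_def EC EAC diff_divide_distrib)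
  ultimately show ?thesis using pos by (simp add: abs_divide pos_divide_le_eq)
qed

end

lemma cluster_point_in_closed:
  assumes "inf (nhds x) F \<noteq> bot" "closed S" "eventually (\<lambda>y. y \<in> S) F"
  shows "x \<in> S"
proof (rule ccontr)
  assume "x \<notin> S"
  then have "eventually (\<lambda>y. y \<in> - S) (nhds x)"
    using assms(2) by (intro eventually_nhds_in_open) auto
  then have "eventually (\<lambda>y. False) (inf (nhds x) F)"
    using assms(3) unfolding eventually_inf by blast
  then show False using assms(1) by (simp add: trivial_limit_def)
qed

text \<open>
  The finite-dimensional conditional probabilities live in a compact cube, and a cluster point of
  them, as the set of time points grows and the perturbation tends to zero, is a process.
\<close>

theorem ex_process:
  fixes \<Omega> :: "'x::finite path set"
  assumes \<Omega>: "path_space \<Omega>" and T: "transition_family T"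
  shows "\<exists>P\<in>stochastic_processes \<Omega>. \<forall>t s. \<forall>u\<in>time_seqs_before t. \<forall>xu\<in>u \<rightarrow>\<^sub>E UNIV.
    0 \<le> t \<longrightarrow> t \<le> s \<longrightarrow> transition_matrix \<Omega> P u xu t s = T t s"
proof -
  \<comment> \<open>Scaling by the growth factor of \<open>chain_conditional_transition\<close>
    makes the error at most \<open>e\<close>, whatever the size of \<open>w\<close>.\<close>
  define c where "c w e = e / real (CARD('x) + 1) ^ card w" for w :: "real set" and e :: real
  define F where "F = filtermap (\<lambda>(w, e). chain_conditional T (c w e) \<Omega> w)
    (finite_subsets_at_top {0..} \<times>\<^sub>F at_right (0 :: real))"
  have eventuallyI: "eventually R F"
    if "w0 \<in> time_seqs" "0 < e0" and R: "\<And>w e. w \<in> time_seqs \<Longrightarrow> w0 \<subseteq> w \<Longrightarrow> perturbed_family T (c w e) \<Longrightarrow>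
      0 < e \<Longrightarrow> e < e0 \<Longrightarrow> R (chain_conditional T (c w e) \<Omega> w)" for R w0 e0
  proof -
    have "eventually (\<lambda>w. w \<in> time_seqs \<and> w0 \<subseteq> w) (finite_subsets_at_top {0..})"
      using that(1) by (auto simp: eventually_finite_subsets_at_top time_seqs_def)
    moreover have "eventually (\<lambda>e. 0 < e \<and> e < min e0 1) (at_right (0 :: real))"
      using that(2) unfolding eventually_at_right_field by (intro exI[of _ "min e0 1"]) auto
    moreover have "R (chain_conditional T (c w e) \<Omega> w)"
      if "w \<in> time_seqs \<and> w0 \<subseteq> w" "0 < e \<and> e < min e0 1" for w e
    proof (rule R)
      have "1 \<le> real (CARD('x) + 1) ^ card w" by (intro one_le_power) simp
      then have "c w e \<le> e / 1" unfolding c_def using that by (intro divide_left_mono) auto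
      moreover have "0 < c w e" unfolding c_def using that by simp
      ultimately show "perturbed_family T (c w e)"
        using that T by unfold_locales auto
    qed (use that in auto)
    ultimately show ?thesis
      unfolding F_def eventually_filtermap eventually_prod_filter prod.case by blast
  qed
  define cube :: "'x conditional set" where "cube = (UNIV \<rightarrow>\<^sub>E {0..1})"
  \<comment> \<open>Tychonoff's theorem: functions carry the topology of pointwise convergence, so
    evaluation at a pair of events is continuous.\<close>
  have "compact cube"
  proof -
    have "compactin (product_topology (\<lambda>_. euclidean) UNIV) cube"
      unfolding cube_def compactin_PiE by simp
    then show ?thesis by (simp add: euclidean_product_topology)
  qed
  moreover have "F \<noteq> bot"
    by (simp add: F_def filtermap_bot_iff prod_filter_eq_bot)
  moreover have "eventually (\<lambda>P. P \<in> cube) F"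
  proof (rule eventuallyI[of "{}" 1])
    fix w e assume "perturbed_family T (c w e)"
    then interpret perturbed_family T "c w e" .
    show "chain_conditional T (c w e) \<Omega> w \<in> cube"
      using chain_conditional_range by (auto simp: cube_def)
  qed (auto simp: time_seqs_def)
  ultimately obtain P where P: "inf (nhds P) F \<noteq> bot" unfolding compact_filter by blast
  have cont: "continuous_on UNIV (\<lambda>P :: 'x conditional. P p)" for p by simp
  have coherent: "\<exists>\<omega>\<in>\<Union>i\<in>{1..n}. C i. 0 \<le> gain P n A C l \<omega>"
    if n: "n \<ge> 1" and dom: "\<And>i. i \<in> {1..n} \<Longrightarrow> (A i, C i) \<in> process_domain \<Omega>" for n A C l
  proof -
    let ?U = "\<Union>i\<in>{1..n}. C i"
    \<comment> \<open>The existence of a path with non-negative gain becomes a finite union, over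
      patterns, of closed conditions on \<open>P\<close>, and hence closed.\<close>
    define S where "S = (\<Union>p\<in>pattern n A C ` ?U. {P. 0 \<le> pattern_gain P n A C l p})"
    have S: "P \<in> S \<longleftrightarrow> (\<exists>\<omega>\<in>?U. 0 \<le> gain P n A C l \<omega>)" for P
      unfolding S_def gain_pattern by blast
    have "closed S"
      unfolding S_def pattern_gain_def
      by (intro closed_UN finite_pattern ballI closed_Collect_le continuous_intros cont)
    obtain w where w: "\<And>i. i \<in> {1..n} \<Longrightarrow> w i \<in> time_seqs \<and> determined \<Omega> (w i) (C i)"
      using process_domain_determined(3)[OF \<Omega> dom] by metis
    have "(\<Union>i\<in>{1..n}. w i) \<in> time_seqs"
      using w unfolding time_seqs_def by (intro CollectI conjI finite_UN_I UN_least) blast+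
    then have "eventually (\<lambda>P. P \<in> S) F"
    proof (rule eventuallyI[of _ 1])
      fix v e assume v: "v \<in> time_seqs" "(\<Union>i\<in>{1..n}. w i) \<subseteq> v" "perturbed_family T (c v e)"
      then interpret perturbed_family T "c v e" by simp
      have "determined \<Omega> v (C i) \<and> C i \<noteq> {} \<and> C i \<subseteq> \<Omega>" if "i \<in> {1..n}" for i
      proof -
        have "w i \<subseteq> v" using v(2) that by blast
        then show ?thesis
          using w[OF that] process_domain_determined(1,2)[OF \<Omega> dom[OF that]] determined_mono by blast
      qed
      then show "chain_conditional T (c v e) \<Omega> v \<in> S"
        unfolding S by (intro chain_conditional_coherent[OF \<Omega> v(1) n]) blast
    qed simp
    then have "P \<in> S" using cluster_point_in_closed[OF P \<open>closed S\<close>] by blast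
    then show ?thesis unfolding S .
  qed
  have transition: "P (state_event \<Omega> s y, state_event \<Omega> t x \<inter> history_event \<Omega> u xu) = T t s $ x $ y"
    if u: "u \<in> time_seqs_before t" "xu \<in> u \<rightarrow>\<^sub>E UNIV" "0 \<le> t" "t \<le> s" for t s u xu x y
  proof -
    let ?p = "(state_event \<Omega> s y, state_event \<Omega> t x \<inter> history_event \<Omega> u xu)"
    have "\<bar>P ?p - T t s $ x $ y\<bar> \<le> 0 + \<eta>" if "0 < \<eta>" for \<eta>
    proof -
      have "closed {P :: 'x conditional. \<bar>P ?p - T t s $ x $ y\<bar> \<le> \<eta>}"
        by (intro closed_Collect_le continuous_intros cont)
      moreover have "insert t (insert s u) \<in> time_seqs"
        using u by (auto simp: time_seqs_before_def time_seqs_def)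
      then have "eventually (\<lambda>P. P \<in> {P. \<bar>P ?p - T t s $ x $ y\<bar> \<le> \<eta>}) F"
      proof (rule eventuallyI[OF _ \<open>0 < \<eta>\<close>])
        fix w e assume w: "w \<in> time_seqs" "insert t (insert s u) \<subseteq> w" "perturbed_family T (c w e)" "e < \<eta>"
        then interpret perturbed_family T "c w e" by simp
        show "chain_conditional T (c w e) \<Omega> w \<in> {P. \<bar>P ?p - T t s $ x $ y\<bar> \<le> \<eta>}"
          using chain_conditional_transition[OF \<Omega> w(1,2) u, of y x] \<open>e < \<eta>\<close> by (simp add: c_def)
      qed
      ultimately have "P \<in> {P. \<bar>P ?p - T t s $ x $ y\<bar> \<le> \<eta>}"
        by (rule cluster_point_in_closed[OF P])
      then show ?thesis by simp
    qed
    then have "\<bar>P ?p - T t s $ x $ y\<bar> \<le> 0" by (rule field_le_epsilon)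
    then show ?thesis by simp
  qed
  define P' where "P' = restrict P (process_domain \<Omega>)"
  have "coherent \<Omega> P'"
    unfolding coherent_iff[OF \<Omega>]
  proof (intro allI impI)
    fix n :: nat and A C :: "nat \<Rightarrow> 'x path set" and l :: "nat \<Rightarrow> real"
    assume n: "1 \<le> n" and dom: "\<forall>i\<in>{1..n}. (A i, C i) \<in> process_domain \<Omega>"
    have "gain P' n A C l \<omega> = gain P n A C l \<omega>" for \<omega>
      using dom by (intro sum.cong) (auto simp: P'_def)
    then show "\<exists>\<omega>\<in>\<Union>i\<in>{1..n}. C i. 0 \<le> gain P' n A C l \<omega>" using coherent n dom by simp
  qed
  then have "P' \<in> stochastic_processes \<Omega>" by (simp add: stochastic_processes_def P'_def)
  moreover have "transition_matrix \<Omega> P' u xu t s = T t s"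
    if "u \<in> time_seqs_before t" "xu \<in> u \<rightarrow>\<^sub>E UNIV" "0 \<le> t" "t \<le> s" for t s u xu
    using that transition transition_in_domain[OF that]
    by (simp add: transition_matrix_def vec_eq_iff P'_def)
  ultimately show ?thesis by blast
qed

section \<open>Consequences of coherence\<close>

text \<open>The form in which coherence is applied: each law of probability below comes from a list
  of bets whose gain is at most a constant built from values of \<open>P\<close>; equations arise
  from stakes of both signs.\<close>

lemma coherent_list:
  assumes \<Omega>: "path_space \<Omega>" and P: "coherent \<Omega> P"
    and dom: "\<And>l A C. (l, A, C) \<in> set xs \<Longrightarrow> (A, C) \<in> process_domain \<Omega>" and "xs \<noteq> []"
    and le: "\<And>\<omega> l A C. (l, A, C) \<in> set xs \<Longrightarrow> \<omega> \<in> C \<Longrightarrow>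
      (\<Sum>(l, A, C)\<leftarrow>xs. l * indicator C \<omega> * (P (A, C) - indicator A \<omega>)) \<le> (k :: real)"
  shows "0 \<le> k"
proof -
  define n where "n = length xs"
  \<comment> \<open>Lists are indexed from \<open>0\<close>, the bets of \<open>coherent\<close>
    from \<open>1\<close>.\<close>
  define l A C where "l i = fst (xs ! (i - 1))" and "A i = fst (snd (xs ! (i - 1)))"
    and "C i = snd (snd (xs ! (i - 1)))" for i
  have mem: "(l i, A i, C i) \<in> set xs" if "i \<in> {1..n}" for i
    using that nth_mem[of "i - 1" xs] by (auto simp: l_def A_def C_def n_def)
  have gain: "gain P n A C l \<omega> = (\<Sum>(l, A, C)\<leftarrow>xs. l * indicator C \<omega> * (P (A, C) - indicator A \<omega>))" for \<omega>
    unfolding n_def l_def A_def C_def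
    by (simp add: sum_list_sum_nth sum.atLeast1_atMost_eq atLeast0LessThan case_prod_beta)
  have "n \<ge> 1" using \<open>xs \<noteq> []\<close> by (simp add: n_def Suc_leI)
  moreover have "\<forall>i\<in>{1..n}. (A i, C i) \<in> process_domain \<Omega>" using mem dom by blast
  ultimately obtain i \<omega> where i: "i \<in> {1..n}" "\<omega> \<in> C i" and nn: "0 \<le> gain P n A C l \<omega>"
    using P unfolding coherent_iff[OF \<Omega>] by blast
  show ?thesis by (rule order_trans[OF nn[unfolded gain] le[OF mem[OF i(1)] i(2)]])
qed

context
  fixes \<Omega> :: "'x::finite path set" and P :: "'x conditional"
  assumes \<Omega>: "path_space \<Omega>" and P: "P \<in> stochastic_processes \<Omega>"
begin

lemma coherent: "coherent \<Omega> P"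
  using P by (simp add: stochastic_processes_def)

lemma process_nonneg:
  assumes "(A, C) \<in> process_domain \<Omega>"
  shows "0 \<le> P (A, C)"
  by (rule coherent_list[OF \<Omega> coherent, of "[(1, A, C)]"]) (use assms in \<open>auto simp: indicator_def\<close>)

lemma process_le_1:
  assumes "(A, C) \<in> process_domain \<Omega>"
  shows "P (A, C) \<le> 1"
proof -
  have "0 \<le> 1 - P (A, C)"
    by (rule coherent_list[OF \<Omega> coherent, of "[(-1, A, C)]"]) (use assms in \<open>auto simp: indicator_def\<close>)
  then show ?thesis by simp
qed

lemma process_disjoint:
  assumes "(A, C) \<in> process_domain \<Omega>" "A \<inter> C = {}"
  shows "P (A, C) = 0"
proof -
  have "0 \<le> - P (A, C)"
    by (rule coherent_list[OF \<Omega> coherent, of "[(-1, A, C)]"]) (use assms in \<open>auto simp: indicator_def\<close>)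
  then show ?thesis using process_nonneg[OF assms(1)] by simp
qed

text \<open>The stake \<open>c\<close> on every \<open>S y\<close> has constant gain on
  \<open>C\<close>; \<open>c = 1\<close> and \<open>c = -1\<close> give the two
  inequalities.\<close>

lemma process_partition:
  assumes dom: "\<And>y :: 'x. (S y, C) \<in> process_domain \<Omega>"
    and part: "\<And>\<omega>. \<omega> \<in> C \<Longrightarrow> (\<Sum>y\<in>UNIV. indicator (S y) \<omega>) = (1 :: real)"
  shows "(\<Sum>y\<in>UNIV. P (S y, C)) = 1"
proof -
  obtain ys :: "'x list" where ys: "set ys = UNIV" "distinct ys"
    using finite_distinct_list[of "UNIV :: 'x set"] by auto
  have "0 \<le> c * ((\<Sum>y\<in>UNIV. P (S y, C)) - 1)" for c
  proof (rule coherent_list[OF \<Omega> coherent, of "map (\<lambda>y. (c, S y, C)) ys"])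
    show "(l, A, C') \<in> set (map (\<lambda>y. (c, S y, C)) ys) \<Longrightarrow> (A, C') \<in> process_domain \<Omega>" for l A C'
      using dom by auto
    show "map (\<lambda>y. (c, S y, C)) ys \<noteq> []" using ys by auto
    fix \<omega> l A C' assume "(l, A, C') \<in> set (map (\<lambda>y. (c, S y, C)) ys)" "\<omega> \<in> C'"
    then have \<omega>: "\<omega> \<in> C" by auto
    have "(\<Sum>(l, A, C)\<leftarrow>map (\<lambda>y. (c, S y, C)) ys. l * indicator C \<omega> * (P (A, C) - indicator A \<omega>))
        = (\<Sum>y\<in>UNIV. c * (P (S y, C) - indicator (S y) \<omega>))"
      using \<omega> sum_list_distinct_conv_sum_set[OF ys(2), of "\<lambda>y. c * (P (S y, C) - indicator (S y) \<omega>)"]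
      by (simp add: comp_def ys)
    also have "\<dots> = c * ((\<Sum>y\<in>UNIV. P (S y, C)) - 1)"
      using part[OF \<omega>] by (simp add: sum_subtractf flip: sum_distrib_left)
    finally show "(\<Sum>(l, A, C)\<leftarrow>map (\<lambda>y. (c, S y, C)) ys. l * indicator C \<omega> * (P (A, C) - indicator A \<omega>))
        \<le> c * ((\<Sum>y\<in>UNIV. P (S y, C)) - 1)" by simp
  qed
  from this[of 1] this[of "-1"] show ?thesis by simp
qed

lemma process_total_probability:
  assumes dom: "(Z, C) \<in> process_domain \<Omega>" "\<And>y :: 'x. (S y, C) \<in> process_domain \<Omega>"
      "\<And>y. (Z, S y \<inter> C) \<in> process_domain \<Omega>"
    and part: "\<And>\<omega>. \<omega> \<in> C \<Longrightarrow> (\<Sum>y\<in>UNIV. indicator (S y) \<omega>) = (1 :: real)"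
  shows "P (Z, C) = (\<Sum>y\<in>UNIV. P (S y, C) * P (Z, S y \<inter> C))"
proof -
  obtain ys :: "'x list" where ys: "set ys = UNIV" "distinct ys"
    using finite_distinct_list[of "UNIV :: 'x set"] by auto
  let ?k = "P (Z, C) - (\<Sum>y\<in>UNIV. P (S y, C) * P (Z, S y \<inter> C))"
  have "0 \<le> c * ?k" for c
  proof -
    \<comment> \<open>The bets on \<open>Z\<close> given \<open>C\<close> and on \<open>Z\<close>
      given \<open>S y \<inter> C\<close> have opposite stakes, and the stake
      \<open>- c * P (Z, S y \<inter> C)\<close> on \<open>S y\<close> is chosen so that all
      indicators cancel: on \<open>C\<close> the gain is the constant \<open>c * ?k\<close>.\<close>
    define xs where "xs = (c, Z, C) # map (\<lambda>y. (- c, Z, S y \<inter> C)) ys @ map (\<lambda>y. (- c * P (Z, S y \<inter> C), S y, C)) ys"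
    show ?thesis
    proof (rule coherent_list[OF \<Omega> coherent, of xs])
      show "(l, A, C') \<in> set xs \<Longrightarrow> (A, C') \<in> process_domain \<Omega>" for l A C'
        using dom by (auto simp: xs_def)
      show "xs \<noteq> []" by (simp add: xs_def)
      fix \<omega> l A C' assume "(l, A, C') \<in> set xs" "\<omega> \<in> C'"
      then have \<omega>: "\<omega> \<in> C" by (auto simp: xs_def)
      let ?z = "indicator Z \<omega> :: real" and ?s = "\<lambda>y. indicator (S y) \<omega> :: real" and ?q = "\<lambda>y. P (Z, S y \<inter> C)"
      have sl: "(\<Sum>y\<leftarrow>ys. g y) = (\<Sum>y\<in>UNIV. g y)" for g :: "'x \<Rightarrow> real"
        using sum_list_distinct_conv_sum_set[OF ys(2), of g] by (simp add: ys)
      have "(\<Sum>(l, A, C)\<leftarrow>xs. l * indicator C \<omega> * (P (A, C) - indicator A \<omega>))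
          = c * (P (Z, C) - ?z) + (\<Sum>y\<leftarrow>ys. - c * ?s y * (?q y - ?z)) + (\<Sum>y\<leftarrow>ys. - c * ?q y * (P (S y, C) - ?s y))"
        using \<omega> by (simp add: xs_def comp_def indicator_inter_arith)
      also have "\<dots> = c * (P (Z, C) - ?z) + (\<Sum>y\<in>UNIV. c * ?z * ?s y - c * (P (S y, C) * ?q y))"
        unfolding sl add.assoc sum.distrib[symmetric]
        by (intro arg_cong2[of _ _ _ _ "(+)"] sum.cong) (simp_all add: algebra_simps)
      also have "\<dots> = c * (P (Z, C) - ?z) + c * ?z * (\<Sum>y\<in>UNIV. ?s y) - c * (\<Sum>y\<in>UNIV. P (S y, C) * ?q y)"
        by (simp add: sum_subtractf sum_distrib_left)
      also have "\<dots> = c * ?k" by (simp add: part[OF \<omega>] algebra_simps)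
      finally show "(\<Sum>(l, A, C)\<leftarrow>xs. l * indicator C \<omega> * (P (A, C) - indicator A \<omega>)) \<le> c * ?k" by simp
    qed
  qed
  from this[of 1] this[of "-1"] show ?thesis by simp
qed

section \<open>Transition matrices of a coherent process\<close>

lemma state_event_partition:
  assumes "C \<subseteq> \<Omega>" "\<omega> \<in> C"
  shows "(\<Sum>y\<in>UNIV. indicator (state_event \<Omega> s y) \<omega>) = (1 :: real)"
proof -
  have "indicator (state_event \<Omega> s y) \<omega> = (if y = \<omega> s then 1 else 0 :: real)" for y
    using assms by (auto simp: state_event_def indicator_def)
  then show ?thesis by simp
qed

lemma conditioning_subset: "state_event \<Omega> t x \<inter> history_event \<Omega> u xu \<subseteq> \<Omega>"
  by (auto simp: history_event_def)

context
  fixes t s :: real and u :: "real set" and xu :: "real \<Rightarrow> 'x"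
  assumes u: "u \<in> time_seqs_before t" "xu \<in> u \<rightarrow>\<^sub>E UNIV" "0 \<le> t" "t \<le> s"
begin

lemma transition_matrix_nonneg: "0 \<le> transition_matrix \<Omega> P u xu t s $ x $ y"
  using process_nonneg[OF transition_in_domain[OF u]] by (simp add: transition_matrix_def)

lemma transition_matrix_le_1: "transition_matrix \<Omega> P u xu t s $ x $ y \<le> 1"
  using process_le_1[OF transition_in_domain[OF u]] by (simp add: transition_matrix_def)

lemma transition_matrix_sum: "(\<Sum>y\<in>UNIV. transition_matrix \<Omega> P u xu t s $ x $ y) = 1"
  unfolding transition_matrix_def
  using process_partition[OF transition_in_domain[OF u] state_event_partition[OF conditioning_subset]]
  by simp

lemma scaled_increment_rate_matrix:
  assumes "0 < h"
  shows "(1 / h) *\<^sub>R (transition_matrix \<Omega> P u xu t s - mat 1) \<in> rate_matrices"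
proof -
  have "(\<Sum>y\<in>UNIV. (mat 1 :: real ^ 'x ^ 'x) $ x $ y) = 1" for x by (simp add: mat_def)
  then show ?thesis
    using transition_matrix_sum transition_matrix_nonneg assms
    by (auto simp: rate_matrices_def sum_subtractf mat_def simp flip: sum_distrib_left sum_divide_distrib)
qed

end

lemma transition_matrix_refl:
  assumes u: "u \<in> time_seqs_before t" "xu \<in> u \<rightarrow>\<^sub>E UNIV" "0 \<le> t"
  shows "transition_matrix \<Omega> P u xu t t = mat 1"
proof -
  let ?T = "transition_matrix \<Omega> P u xu t t"
  have off: "?T $ x $ y = 0" if "x \<noteq> y" for x y
    using that process_disjoint[OF transition_in_domain[OF u order_refl, where x = x and y = y]]
    by (auto simp: transition_matrix_def state_event_def)
  have "?T $ x $ x = 1" for x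
  proof -
    have "(\<Sum>y\<in>UNIV. ?T $ x $ y) = (\<Sum>y\<in>UNIV. if y = x then ?T $ x $ x else 0)"
      using off by (intro sum.cong) auto
    then show ?thesis using transition_matrix_sum[OF u order_refl, of x] by simp
  qed
  with off show ?thesis by (simp add: vec_eq_iff mat_def)
qed

text \<open>Total probability over the state at time \<open>a\<close>. The process need not be
  Markov, so the second factor keeps the history, extended by the state \<open>x\<close> at
  \<open>t\<close>; \<open>t < a\<close> puts this history before \<open>a\<close>.\<close>

lemma transition_matrix_chapman_kolmogorov:
  assumes u: "u \<in> time_seqs_before t" "xu \<in> u \<rightarrow>\<^sub>E UNIV" "0 \<le> t" "t < a" "a \<le> b"
  shows "transition_matrix \<Omega> P u xu t b $ x $ z =
    (\<Sum>y\<in>UNIV. transition_matrix \<Omega> P u xu t a $ x $ y *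
      transition_matrix \<Omega> P (insert t u) (xu(t := x)) a b $ y $ z)"
proof -
  let ?C = "state_event \<Omega> t x \<inter> history_event \<Omega> u xu"
  note C = state_history_event[OF u(1,2), of \<Omega> x]
  have u': "insert t u \<in> time_seqs_before a" "xu(t := x) \<in> insert t u \<rightarrow>\<^sub>E UNIV" "0 \<le> a" "a \<le> b"
    using time_seqs_before_insert(2)[OF u(1,3,4)] PiE_upd_UNIV[OF u(2)] u by auto
  have "P (state_event \<Omega> b z, ?C) = (\<Sum>y\<in>UNIV. P (state_event \<Omega> a y, ?C) *
      P (state_event \<Omega> b z, state_event \<Omega> a y \<inter> ?C))"
  proof (rule process_total_probability)
    show "(state_event \<Omega> b z, state_event \<Omega> a y \<inter> ?C) \<in> process_domain \<Omega>" for y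
      unfolding C by (rule transition_in_domain[OF u'])
  qed (use u transition_in_domain[OF u(1-3)] state_event_partition[OF conditioning_subset] in auto)
  then show ?thesis by (simp add: transition_matrix_def C)
qed

end

section \<open>Rates of well-behaved consistent processes\<close>

lemma rate_matrices_limit:
  assumes "\<And>n. X n \<in> rate_matrices" "X \<longlonglongrightarrow> M"
  shows "M \<in> rate_matrices"
proof -
  have ent: "(\<lambda>n. X n $ x $ y) \<longlonglongrightarrow> M $ x $ y" for x y
    using assms(2) by (intro tendsto_vec_nth)
  have "(\<lambda>n. \<Sum>y\<in>UNIV. X n $ x $ y) \<longlonglongrightarrow> (\<Sum>y\<in>UNIV. M $ x $ y)" for x
    by (intro tendsto_sum ent)
  then have "(\<Sum>y\<in>UNIV. M $ x $ y) = 0" for x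
    using assms(1) by (simp add: rate_matrices_def LIMSEQ_const_iff)
  moreover have "0 \<le> M $ x $ y" if "x \<noteq> y" for x y
    using assms(1) that by (intro LIMSEQ_le_const[OF ent]) (auto simp: rate_matrices_def)
  ultimately show ?thesis by (simp add: rate_matrices_def)
qed

lemma norm_matrix_le_sum: "norm (A :: real ^ 'n ^ 'm) \<le> (\<Sum>x\<in>UNIV. \<Sum>y\<in>UNIV. \<bar>A $ x $ y\<bar>)"
proof -
  have "norm A \<le> (\<Sum>x\<in>UNIV. norm (A $ x))" unfolding norm_vec_def by (rule L2_set_le_sum) simp
  also have "\<dots> \<le> (\<Sum>x\<in>UNIV. \<Sum>y\<in>UNIV. \<bar>A $ x $ y\<bar>)" by (intro sum_mono norm_le_l1_cart)
  finally show ?thesis .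
qed

lemma abs_matrix_vector_le:
  fixes A :: "real ^ 'n ^ 'm"
  shows "\<bar>(A *v g) $ y\<bar> \<le> CARD('n) * norm A * infnorm g"
proof -
  have "\<bar>(A *v g) $ y\<bar> \<le> (\<Sum>z\<in>UNIV. \<bar>A $ y $ z * g $ z\<bar>)"
    unfolding matrix_vector_mult_def by simp
  also have "\<dots> \<le> (\<Sum>z\<in>(UNIV :: 'n set). norm A * infnorm g)"
  proof (rule sum_mono)
    fix z
    have "\<bar>A $ y $ z\<bar> \<le> norm A"
      using component_le_norm_cart[of "A $ y" z] Finite_Cartesian_Product.norm_nth_le[of A y] by linarith
    then show "\<bar>A $ y $ z * g $ z\<bar> \<le> norm A * infnorm g"
      unfolding abs_mult by (intro mult_mono component_le_infnorm_cart) auto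
  qed
  finally show ?thesis by simp
qed

lemma op_norm_matrix_le: "op_norm ((*v) (A :: real ^ 'x ^ 'x::finite)) \<le> CARD('x) * norm A"
proof (rule op_norm_le)
  fix f :: "real ^ 'x" assume "infnorm f = 1"
  then show "infnorm (A *v f) \<le> CARD('x) * norm A"
    unfolding infnorm_le_cart using abs_matrix_vector_le[of A f] by simp
qed

lemma abs_matrix_entry_le_op_norm:
  "\<bar>(A :: real ^ 'x ^ 'x::finite) $ x $ y\<bar> \<le> op_norm ((*v) A)"
proof -
  have "infnorm (A *v axis y 1) \<le> op_norm ((*v) A) * infnorm (axis y 1 :: real ^ 'x)"
  proof (rule infnorm_le_op_norm)
    fix f :: "real ^ 'x" assume "infnorm f = 1"
    then show "infnorm (A *v f) \<le> CARD('x) * norm A"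
      unfolding infnorm_le_cart using abs_matrix_vector_le[of A f] by simp
  qed (simp add: matrix_vector_mult_scaleR)
  moreover have "infnorm (axis y 1 :: real ^ 'x) = 1"
  proof (rule antisym)
    show "infnorm (axis y 1 :: real ^ 'x) \<le> 1" by (auto simp: infnorm_le_cart axis_def)
    show "1 \<le> infnorm (axis y 1 :: real ^ 'x)"
      using component_le_infnorm_cart[of "axis y 1 :: real ^ 'x" y] by simp
  qed
  ultimately have "infnorm (A *v axis y 1) \<le> op_norm ((*v) A)" by simp
  then show ?thesis by (simp add: infnorm_le_cart matrix_vector_mult_basis column_def)
qed

text \<open>Difference quotients need not converge, but they are bounded. If they stayed away from
  \<open>\<Q>\<close> along a sequence tending to zero, a subsequence would converge to a rate
  matrix, which lies in \<open>\<Q>\<close> by \<open>cluster\<close>.\<close>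

lemma eventually_near_cluster_set:
  fixes F :: "real \<Rightarrow> real ^ 'x ^ 'x::finite"
  assumes bounded: "eventually (\<lambda>h. norm (F h) \<le> B) (at_right 0)"
    and rate: "eventually (\<lambda>h. F h \<in> rate_matrices) (at_right 0)"
    and cluster: "\<And>\<Delta> M. (\<And>i. 0 < \<Delta> i) \<Longrightarrow> \<Delta> \<longlonglongrightarrow> 0 \<Longrightarrow> (\<lambda>i. F (\<Delta> i)) \<longlonglongrightarrow> M \<Longrightarrow>
      M \<in> rate_matrices \<Longrightarrow> M \<in> \<Q>"
    and "0 < \<epsilon>"
  shows "eventually (\<lambda>h. \<exists>M\<in>\<Q>. norm (F h - M) < \<epsilon>) (at_right 0)"
proof (rule ccontr)
  assume not: "\<not> ?thesis"
  obtain b where b: "0 < b" "\<And>h. 0 < h \<Longrightarrow> h < b \<Longrightarrow> norm (F h) \<le> B \<and> F h \<in> rate_matrices"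
    using eventually_conj[OF bounded rate] unfolding eventually_at_right_field by auto
  have "\<exists>h. 0 < h \<and> h < min b (inverse (real (Suc n))) \<and> \<not> (\<exists>M\<in>\<Q>. norm (F h - M) < \<epsilon>)" for n
  proof (rule ccontr)
    assume "\<not> ?thesis"
    then have "eventually (\<lambda>h. \<exists>M\<in>\<Q>. norm (F h - M) < \<epsilon>) (at_right 0)"
      unfolding eventually_at_right_field using b(1)
      by (intro exI[of _ "min b (inverse (real (Suc n)))"]) auto
    with not show False by simp
  qed
  then obtain \<Delta> where \<Delta>: "\<And>n. 0 < \<Delta> n" "\<And>n. \<Delta> n < b" "\<And>n. \<Delta> n < inverse (real (Suc n))"
    "\<And>n. \<not> (\<exists>M\<in>\<Q>. norm (F (\<Delta> n) - M) < \<epsilon>)" by (metis min_less_iff_conj)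
  have lim: "\<Delta> \<longlonglongrightarrow> 0"
    using \<Delta>(1,3) by (intro tendsto_sandwich[OF _ _ tendsto_const LIMSEQ_inverse_real_of_nat])
      (auto intro!: always_eventually less_imp_le)
  have "bounded (range (\<lambda>n. F (\<Delta> n)))"
    using b(2) \<Delta> by (intro boundedI[of _ B]) auto
  then obtain M r where r: "strict_mono r" "((\<lambda>n. F (\<Delta> n)) \<circ> r) \<longlonglongrightarrow> M"
    using bounded_imp_convergent_subsequence by blast
  have "M \<in> rate_matrices"
    using b(2) \<Delta> by (intro rate_matrices_limit[OF _ r(2)]) simp
  moreover have "(\<Delta> \<circ> r) \<longlonglongrightarrow> 0" using LIMSEQ_subseq_LIMSEQ[OF lim r(1)] .
  ultimately have "M \<in> \<Q>"
    using cluster[of "\<Delta> \<circ> r" M] \<Delta>(1) r(2) by (simp add: comp_def)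
  moreover obtain n where "norm (F (\<Delta> (r n)) - M) < \<epsilon>"
    using LIMSEQ_D[OF r(2) \<open>0 < \<epsilon>\<close>] by auto
  ultimately show False using \<Delta>(4) by blast
qed

text \<open>Together with \<open>Limsup_op_norm_finite\<close> this turns well-behavedness into
  eventual boundedness of the difference quotients in the Euclidean norm, where compactness applies;
  the constants come from the equivalence of norms.\<close>

lemma Limsup_op_norm_bounded:
  fixes A :: "real \<Rightarrow> real ^ 'x ^ 'x::finite"
  assumes "Limsup (at_right 0) (\<lambda>h. ereal (1 / h * op_norm ((*v) (A h)))) < \<infinity>"
  shows "\<exists>B. eventually (\<lambda>h. norm ((1 / h) *\<^sub>R A h) \<le> B) (at_right 0)"
proof -
  obtain B :: real where "Limsup (at_right 0) (\<lambda>h. ereal (1 / h * op_norm ((*v) (A h)))) < ereal B"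
    using ereal_dense2[OF assms] by blast
  then have "eventually (\<lambda>h. ereal (1 / h * op_norm ((*v) (A h))) < ereal B) (at_right 0)"
    by (rule Limsup_lessD)
  then have "eventually (\<lambda>h. norm ((1 / h) *\<^sub>R A h) \<le> real CARD('x) * (real CARD('x) * B)) (at_right 0)"
    using eventually_at_right_less[of 0]
  proof eventually_elim
    case (elim h)
    have "\<bar>((1 / h) *\<^sub>R A h) $ x $ y\<bar> \<le> B" for x y
    proof -
      have "\<bar>((1 / h) *\<^sub>R A h) $ x $ y\<bar> = 1 / h * \<bar>A h $ x $ y\<bar>" using elim by (simp add: abs_mult)
      also have "\<dots> \<le> 1 / h * op_norm ((*v) (A h))"
        using elim by (intro mult_left_mono abs_matrix_entry_le_op_norm) auto
      finally show ?thesis using elim by simp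
    qed
    then have "norm ((1 / h) *\<^sub>R A h) \<le> (\<Sum>x\<in>(UNIV :: 'x set). \<Sum>y\<in>(UNIV :: 'x set). B)"
      by (intro order_trans[OF norm_matrix_le_sum] sum_mono)
    then show ?case by simp
  qed
  then show ?thesis by blast
qed

lemma Limsup_op_norm_finite:
  fixes A :: "real \<Rightarrow> real ^ 'x ^ 'x::finite"
  assumes "eventually (\<lambda>h. norm ((1 / h) *\<^sub>R A h) \<le> B) (at_right 0)"
  shows "Limsup (at_right 0) (\<lambda>h. ereal (1 / h * op_norm ((*v) (A h)))) < \<infinity>"
proof -
  have "eventually (\<lambda>h. ereal (1 / h * op_norm ((*v) (A h))) \<le> ereal (CARD('x) * B)) (at_right 0)"
    using assms eventually_at_right_less[of 0]
  proof eventually_elim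
    case (elim h)
    have "1 / h * op_norm ((*v) (A h)) \<le> 1 / h * (CARD('x) * norm (A h))"
      using elim by (intro mult_left_mono op_norm_matrix_le) auto
    also have "\<dots> = CARD('x) * norm ((1 / h) *\<^sub>R A h)" using elim by simp
    also have "\<dots> \<le> CARD('x) * B" using elim by (intro mult_left_mono) auto
    finally show ?case by simp
  qed
  then have "Limsup (at_right 0) (\<lambda>h. ereal (1 / h * op_norm ((*v) (A h)))) \<le> ereal (CARD('x) * B)"
    by (rule Limsup_bounded)
  also have "\<dots> < \<infinity>" by simp
  finally show ?thesis .
qed

lemma eventually_before:
  assumes "u \<in> time_seqs_before t" "0 < t"
  shows "eventually (\<lambda>h. 0 < h \<and> 0 \<le> t - h \<and> u \<in> time_seqs_before (t - h)) (at_right 0)"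
proof -
  have ev: "eventually (\<lambda>h. r < t - h) (at_right 0)" if "r < t" for r
    using that by (auto simp: eventually_at_right_field intro!: exI[of _ "t - r"])
  \<comment> \<open>Including \<open>0\<close> makes the same argument yield
    \<open>0 < t - h\<close>.\<close>
  have "finite (insert 0 u)" "\<And>r. r \<in> insert 0 u \<Longrightarrow> r < t"
    using assms by (auto simp: time_seqs_before_def time_seqs_def)
  then have "eventually (\<lambda>h. \<forall>r\<in>insert 0 u. r < t - h) (at_right 0)"
    by (intro eventually_ball_finite ballI ev)
  then show ?thesis
    using eventually_at_right_less[of 0]
    by eventually_elim (use assms in \<open>auto simp: time_seqs_before_def\<close>)
qed

section \<open>The lower bound for well-behaved consistent processes\<close>

context lipschitz_rate_operator
begin

text \<open>\<open>A\<close> differs from \<open>mat 1 + h *\<^sub>R M\<close> by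
  \<open>h *\<^sub>R D\<close> with \<open>norm D \<le> \<epsilon>\<close>. This deviation and the
  quadratic error of \<open>corresponding_step\<close> are the two terms of the bound;
  \<open>CARD('x)\<close> stems from passing to the maximum norm.\<close>

lemma increment_dominates:
  assumes M: "M \<in> dominating_rate_matrices Q" and h: "0 < h" "h * C \<le> 1"
    and near: "norm ((1 / h) *\<^sub>R (A - mat 1) - M) \<le> \<epsilon>"
  shows "L a (a + h) g $ y - h * (real CARD('x) * \<epsilon> + C\<^sup>2 * h) * infnorm g \<le> (A *v g) $ y"
proof -
  define D where "D = (1 / h) *\<^sub>R (A - mat 1) - M"
  have "A = mat 1 + h *\<^sub>R (M + D)" using h by (simp add: D_def algebra_simps)
  then have "(A *v g) $ y = g $ y + h * ((M *v g) $ y + (D *v g) $ y)"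
    by (simp add: matrix_vector_mult_add_rdistrib scaleR_matrix_vector_assoc[symmetric])
  moreover have "h * (Q g $ y - CARD('x) * \<epsilon> * infnorm g) \<le> h * ((M *v g) $ y + (D *v g) $ y)"
  proof (intro mult_left_mono)
    have "Q g $ y \<le> (M *v g) $ y" using M by (simp add: dominating_rate_matrices_def less_eq_vec_def)
    moreover have "CARD('x) * norm D * infnorm g \<le> CARD('x) * \<epsilon> * infnorm g"
      using near by (intro mult_right_mono mult_left_mono infnorm_pos_le) (auto simp: D_def)
    then have "- (CARD('x) * \<epsilon> * infnorm g) \<le> (D *v g) $ y"
      using abs_matrix_vector_le[of D g y] by linarith
    ultimately show "Q g $ y - CARD('x) * \<epsilon> * infnorm g \<le> (M *v g) $ y + (D *v g) $ y" by simp
  qed (use h in simp)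
  moreover have "\<bar>(L a (a + h) g - g - h *\<^sub>R Q g) $ y\<bar> \<le> C\<^sup>2 * h\<^sup>2 * infnorm g"
    using corresponding_step[of a "a + h" g] h unfolding infnorm_le_cart by simp
  ultimately show ?thesis by (simp add: algebra_simps power2_eq_square)
qed

lemma eventually_increment_dominates:
  fixes A :: "real \<Rightarrow> real ^ 'x ^ 'x"
  assumes ab: "\<And>h. 0 < h \<Longrightarrow> b h = a h + h"
    and bounded: "Limsup (at_right 0) (\<lambda>h. ereal (1 / h * op_norm ((*v) (A h - mat 1)))) < \<infinity>"
    and rate: "eventually (\<lambda>h. (1 / h) *\<^sub>R (A h - mat 1) \<in> rate_matrices) (at_right 0)"
    and cluster: "\<And>\<Delta> M. (\<And>i. 0 < \<Delta> i) \<Longrightarrow> \<Delta> \<longlonglongrightarrow> 0 \<Longrightarrow>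
      (\<lambda>i. (1 / \<Delta> i) *\<^sub>R (A (\<Delta> i) - mat 1)) \<longlonglongrightarrow> M \<Longrightarrow> M \<in> rate_matrices \<Longrightarrow>
      M \<in> dominating_rate_matrices Q"
    and "0 < \<epsilon>"
  shows "eventually (\<lambda>h. \<forall>y g. L (a h) (b h) g $ y - \<epsilon> * h * infnorm g \<le> (A h *v g) $ y) (at_right 0)"
proof -
  \<comment> \<open>Half of \<open>\<epsilon>\<close> is reserved for the deviation from a
    dominating matrix, the other half for the quadratic error.\<close>
  define \<delta> where "\<delta> = \<epsilon> / (2 * CARD('x))"
  have \<delta>: "0 < \<delta>" "CARD('x) * \<delta> = \<epsilon> / 2" using \<open>0 < \<epsilon>\<close> by (simp_all add: \<delta>_def)
  obtain B where B: "eventually (\<lambda>h. norm ((1 / h) *\<^sub>R (A h - mat 1)) \<le> B) (at_right 0)"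
    using Limsup_op_norm_bounded[OF bounded] by blast
  have "eventually (\<lambda>h. \<exists>M\<in>dominating_rate_matrices Q. norm ((1 / h) *\<^sub>R (A h - mat 1) - M) < \<delta>) (at_right 0)"
    by (rule eventually_near_cluster_set[OF B rate _ \<delta>(1)]) (rule cluster)
  moreover have "eventually (\<lambda>h. 0 < h \<and> h < 1 / C \<and> h < \<epsilon> / (2 * C\<^sup>2)) (at_right 0)"
    unfolding eventually_at_right_field using C_pos \<open>0 < \<epsilon>\<close>
    by (intro exI[of _ "min (1 / C) (\<epsilon> / (2 * C\<^sup>2))"]) auto
  ultimately show ?thesis
  proof eventually_elim
    case (elim h)
    then obtain M where M: "M \<in> dominating_rate_matrices Q" "norm ((1 / h) *\<^sub>R (A h - mat 1) - M) \<le> \<delta>"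
      by (meson less_imp_le)
    have h: "0 < h" "h * C \<le> 1" using elim C_pos by (auto simp: field_simps)
    have "C\<^sup>2 * h \<le> \<epsilon> / 2" using elim C_pos by (simp add: field_simps)
    then have "h * (CARD('x) * \<delta> + C\<^sup>2 * h) * infnorm g \<le> h * \<epsilon> * infnorm g" for g :: "real ^ 'x"
      using h \<delta> by (intro mult_right_mono mult_left_mono infnorm_pos_le) auto
    then show ?case
      using increment_dominates[OF M(1) h M(2), of "a h"] ab[OF h(1)]
      by (smt (verit) mult.commute)
  qed
qed

theorem expectation_ge_corresponding:
  assumes \<Omega>: "path_space \<Omega>"
    and P: "P \<in> well_behaved_consistent_processes \<Omega> (dominating_rate_matrices Q)"
    and u: "u \<in> time_seqs_before t" "xu \<in> u \<rightarrow>\<^sub>E UNIV" "0 \<le> t" and ts: "t \<le> s"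
  shows "L t s f $ x \<le> (transition_matrix \<Omega> P u xu t s *v f) $ x"
proof -
  have sp: "P \<in> stochastic_processes \<Omega>" and wb: "well_behaved \<Omega> P"
    and con: "consistent \<Omega> (dominating_rate_matrices Q) P"
    using P by (auto simp: well_behaved_consistent_processes_def)
  have right: "eventually (\<lambda>h. \<forall>y g. L r (r + h) g $ y - \<epsilon> * h * infnorm g
      \<le> (transition_matrix \<Omega> P v xv r (r + h) *v g) $ y) (at_right 0)"
    if v: "v \<in> time_seqs_before r" "xv \<in> v \<rightarrow>\<^sub>E UNIV" "0 \<le> r" and "0 < \<epsilon>" for v xv r \<epsilon>
  proof (rule eventually_increment_dominates)
    show "Limsup (at_right 0) (\<lambda>h. ereal (1 / h * op_norm ((*v) (transition_matrix \<Omega> P v xv r (r + h) - mat 1)))) < \<infinity>"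
      using wb v unfolding well_behaved_def by blast
    show "eventually (\<lambda>h. (1 / h) *\<^sub>R (transition_matrix \<Omega> P v xv r (r + h) - mat 1) \<in> rate_matrices) (at_right 0)"
      using eventually_at_right_less[of 0]
      by eventually_elim (use scaled_increment_rate_matrix[OF \<Omega> sp v] in simp)
    show "M \<in> dominating_rate_matrices Q" if "\<And>i. 0 < \<Delta> i" "\<Delta> \<longlonglongrightarrow> 0"
      "(\<lambda>i. (1 / \<Delta> i) *\<^sub>R (transition_matrix \<Omega> P v xv r (r + \<Delta> i) - mat 1)) \<longlonglongrightarrow> M" "M \<in> rate_matrices" for \<Delta> M
    proof -
      have "M \<in> outer_derivative \<Omega> P v xv r" unfolding outer_derivative_def using that by blast
      then show ?thesis using con v unfolding consistent_def by blast
    qed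
  qed (use \<open>0 < \<epsilon>\<close> in auto)
  have left: "eventually (\<lambda>h. \<forall>y g. L (r - h) r g $ y - \<epsilon> * h * infnorm g
      \<le> (transition_matrix \<Omega> P v xv (r - h) r *v g) $ y) (at_right 0)"
    if v: "v \<in> time_seqs_before r" "xv \<in> v \<rightarrow>\<^sub>E UNIV" "0 < r" and "0 < \<epsilon>" for v xv r \<epsilon>
  proof (rule eventually_increment_dominates)
    show "Limsup (at_right 0) (\<lambda>h. ereal (1 / h * op_norm ((*v) (transition_matrix \<Omega> P v xv (r - h) r - mat 1)))) < \<infinity>"
      using wb v less_imp_le[OF v(3)] unfolding well_behaved_def by blast
    show "eventually (\<lambda>h. (1 / h) *\<^sub>R (transition_matrix \<Omega> P v xv (r - h) r - mat 1) \<in> rate_matrices) (at_right 0)"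
      using eventually_before[OF v(1,3)]
      by eventually_elim (use scaled_increment_rate_matrix[OF \<Omega> sp _ v(2)] in auto)
    show "M \<in> dominating_rate_matrices Q" if "\<And>i. 0 < \<Delta> i" "\<Delta> \<longlonglongrightarrow> 0"
      "(\<lambda>i. (1 / \<Delta> i) *\<^sub>R (transition_matrix \<Omega> P v xv (r - \<Delta> i) r - mat 1)) \<longlonglongrightarrow> M" "M \<in> rate_matrices" for \<Delta> M
    proof -
      have "M \<in> outer_derivative \<Omega> P v xv r" unfolding outer_derivative_def using that v(3) by blast
      then show ?thesis using con v less_imp_le[OF v(3)] unfolding consistent_def by blast
    qed
  qed (use \<open>0 < \<epsilon>\<close> in auto)
  let ?T = "transition_matrix \<Omega> P u xu"
  define T' where "T' = transition_matrix \<Omega> P (insert t u) (xu(t := x))"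
  define \<phi> where "\<phi> r = (?T t r *v L r s f) $ x" for r
  have g_le: "infnorm (L r s f) \<le> infnorm f" if "r \<le> s" for r
    using lto_infnorm_le[OF corresponding_lto[OF that]] .
  \<comment> \<open>The increment of \<open>\<phi>\<close> is an average, with weights
    \<open>?T t a $ x $ y\<close>, of one-step differences started in \<open>y\<close>; the
    semigroup property brings \<open>L a s f\<close> into the form \<open>L a b g\<close>.\<close>
  have step: "- (e * infnorm f) \<le> \<phi> b - \<phi> a"
    if "t < a" "a \<le> b" "b \<le> s" "0 \<le> e"
      and dom: "\<And>y g. L a b g $ y - e * infnorm g \<le> (T' a b *v g) $ y" for a b e
  proof -
    define g where "g = L b s f"
    have sg: "L a s f = L a b g" unfolding g_def by (rule corresponding_semigroup[OF that(2,3)])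
    have "\<phi> b = (\<Sum>z\<in>UNIV. \<Sum>y\<in>UNIV. ?T t a $ x $ y * (T' a b $ y $ z * g $ z))"
      unfolding \<phi>_def matrix_vector_mult_def g_def[symmetric] T'_def
      using transition_matrix_chapman_kolmogorov[OF \<Omega> sp u that(1,2)]
      by (simp add: sum_distrib_right mult.assoc)
    also have "\<dots> = (\<Sum>y\<in>UNIV. ?T t a $ x $ y * (T' a b *v g) $ y)"
      by (subst sum.swap) (simp add: matrix_vector_mult_def sum_distrib_left)
    finally have "\<phi> b - \<phi> a = (\<Sum>y\<in>UNIV. ?T t a $ x $ y * ((T' a b *v g) $ y - L a b g $ y))"
      by (simp add: \<phi>_def sg matrix_vector_mult_def[of "?T t a"] right_diff_distrib sum_subtractf)
    also have "\<dots> \<ge> (\<Sum>y\<in>UNIV. ?T t a $ x $ y * - (e * infnorm f))"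
    proof (intro sum_mono mult_left_mono)
      fix y
      have "e * infnorm g \<le> e * infnorm f" using g_le that by (intro mult_left_mono) (auto simp: g_def)
      then show "- (e * infnorm f) \<le> (T' a b *v g) $ y - L a b g $ y" using dom[of g y] by linarith
    qed (use transition_matrix_nonneg[OF \<Omega> sp u] that in simp)
    also have "(\<Sum>y\<in>UNIV. ?T t a $ x $ y * - (e * infnorm f)) = - (e * infnorm f)"
      unfolding sum_distrib_right[symmetric] transition_matrix_sum[OF \<Omega> sp u less_imp_le[OF that(1)]]
      by simp
    finally show ?thesis .
  qed
  have mono: "- (\<epsilon> * (s - t) * infnorm f) \<le> \<phi> s - \<phi> t" if "0 < \<epsilon>" for \<epsilon>
  proof -
    \<comment> \<open>Intervals that leave \<open>[t, s]\<close> satisfy \<open>R\<close> vacuously,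
      so the local condition of \<open>Bolzano\<close> concerns only those inside.\<close>
    define R where "R a b \<longleftrightarrow> (t \<le> a \<and> a \<le> b \<and> b \<le> s \<longrightarrow> - (\<epsilon> * (b - a) * infnorm f) \<le> \<phi> b - \<phi> a)" for a b
    have "R t s"
      using ts
    proof (induction rule: Bolzano)
      case (trans a b c)
      show ?case
        unfolding R_def
      proof
        assume "t \<le> a \<and> a \<le> c \<and> c \<le> s"
        then have "- (\<epsilon> * (b - a) * infnorm f) \<le> \<phi> b - \<phi> a" "- (\<epsilon> * (c - b) * infnorm f) \<le> \<phi> c - \<phi> b"
          using trans by (auto simp: R_def)
        then show "- (\<epsilon> * (c - a) * infnorm f) \<le> \<phi> c - \<phi> a" by (simp add: algebra_simps)
      qed
    next
      case (local r)
      show ?case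
      proof (cases "r = t")
        \<comment> \<open>At \<open>t\<close> itself the state is fixed by the conditioning, so
          there is no averaging and the history is still \<open>u\<close>.\<close>
        case True
        obtain d where d: "0 < d" "\<And>h y g. 0 < h \<Longrightarrow> h < d \<Longrightarrow>
            L t (t + h) g $ y - \<epsilon> * h * infnorm g \<le> (?T t (t + h) *v g) $ y"
          using right[OF u \<open>0 < \<epsilon>\<close>] unfolding eventually_at_right_field by auto
        have "R a b" if ab: "a \<le> r" "r \<le> b" "b - a < d" for a b
          unfolding R_def
        proof
          assume le: "t \<le> a \<and> a \<le> b \<and> b \<le> s"
          then have a: "a = t" using ab True by simp
          show "- (\<epsilon> * (b - a) * infnorm f) \<le> \<phi> b - \<phi> a"
          proof (cases "b = t")
            case False
            then have "L t b (L b s f) $ x - \<epsilon> * (b - t) * infnorm (L b s f) \<le> \<phi> b"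
              unfolding \<phi>_def using d(2)[of "b - t" "L b s f" x] ab le a by simp
            moreover have "L t b (L b s f) $ x = L t s f $ x"
              by (subst corresponding_semigroup[of t b s f]) (use le a in auto)
            moreover have "\<phi> t = L t s f $ x"
              using transition_matrix_refl[OF \<Omega> sp u] by (simp add: \<phi>_def)
            moreover have "\<epsilon> * (b - t) * infnorm (L b s f) \<le> \<epsilon> * (b - t) * infnorm f"
              using g_le le a \<open>0 < \<epsilon>\<close> by (intro mult_left_mono) auto
            ultimately show ?thesis unfolding a by linarith
          qed (simp add: a)
        qed
        then show ?thesis using d(1) by blast
      next
        case False
        then have "t < r" using local by simp
        have u': "insert t u \<in> time_seqs_before a" "xu(t := x) \<in> insert t u \<rightarrow>\<^sub>E UNIV" "0 \<le> a" if "t < a" for a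
          using time_seqs_before_insert(2)[OF u(1,3) that] PiE_upd_UNIV[OF u(2)] u(3) that by auto
        obtain d1 where d1: "0 < d1" "\<And>h y g. 0 < h \<Longrightarrow> h < d1 \<Longrightarrow>
            L r (r + h) g $ y - \<epsilon> * h * infnorm g \<le> (T' r (r + h) *v g) $ y"
          using right[OF u'[OF \<open>t < r\<close>] \<open>0 < \<epsilon>\<close>] unfolding eventually_at_right_field T'_def by auto
        have "0 < r" using \<open>t < r\<close> u(3) by simp
        obtain d2 where d2: "0 < d2" "\<And>h y g. 0 < h \<Longrightarrow> h < d2 \<Longrightarrow>
            L (r - h) r g $ y - \<epsilon> * h * infnorm g \<le> (T' (r - h) r *v g) $ y"
          using left[OF u'(1,2)[OF \<open>t < r\<close>] \<open>0 < r\<close> \<open>0 < \<epsilon>\<close>]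
          unfolding eventually_at_right_field T'_def by auto
        \<comment> \<open>Being closer to \<open>r\<close> than \<open>r - t\<close>, the point
          \<open>a\<close> lies after \<open>t\<close>, where Chapman-Kolmogorov applies. The
          interval is split at \<open>r\<close>, since only increments that begin or end at
          \<open>r\<close> are under control.\<close>
        have "R a b" if ab: "a \<le> r" "r \<le> b" "b - a < min (r - t) (min d1 d2)" for a b
          unfolding R_def
        proof
          assume le: "t \<le> a \<and> a \<le> b \<and> b \<le> s"
          have 1: "- (\<epsilon> * (r - a) * infnorm f) \<le> \<phi> r - \<phi> a"
          proof (cases "a = r")
            case False
            then show ?thesis
              using d2(2)[of "r - a"] ab le \<open>0 < \<epsilon>\<close> by (intro step) auto
          qed simp
          have 2: "- (\<epsilon> * (b - r) * infnorm f) \<le> \<phi> b - \<phi> r"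
          proof (cases "b = r")
            case False
            then show ?thesis
              using d1(2)[of "b - r"] ab le \<open>0 < \<epsilon>\<close> \<open>t < r\<close> by (intro step) auto
          qed simp
          from 1 2 show "- (\<epsilon> * (b - a) * infnorm f) \<le> \<phi> b - \<phi> a" by (simp add: algebra_simps)
        qed
        then show ?thesis
          using d1(1) d2(1) \<open>t < r\<close> by (intro exI[of _ "min (r - t) (min d1 d2)"]) auto
      qed
    qed
    then show ?thesis using ts by (simp add: R_def)
  qed
  have "\<phi> t - \<phi> s \<le> 0"
  proof (rule field_le_epsilon)
    fix e :: real assume "0 < e"
    define K where "K = (s - t) * infnorm f"
    have K: "0 \<le> K" using ts by (simp add: K_def infnorm_pos_le)
    have "- (e / (K + 1) * K) \<le> \<phi> s - \<phi> t"
      using mono[of "e / (K + 1)"] K \<open>0 < e\<close> by (simp add: K_def mult.assoc)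
    moreover have "e / (K + 1) * K \<le> e" using K \<open>0 < e\<close> by (simp add: field_simps)
    ultimately show "\<phi> t - \<phi> s \<le> 0 + e" by simp
  qed
  then show ?thesis
    using transition_matrix_refl[OF \<Omega> sp u] by (simp add: \<phi>_def corresponding_refl)
qed

end

section \<open>Attainment and maximality\<close>

text \<open>Since the one-sided limits exist, the outer derivative contains nothing but these limits
  and the quotients stay bounded, so consistency and well-behavedness carry over from
  \<open>T\<close>.\<close>

lemma ex_process_with_rates:
  fixes \<Omega> :: "'x::finite path set"
  assumes \<Omega>: "path_space \<Omega>" and T: "transition_family T" and rates: "has_rates_in T \<Q>"
  shows "\<exists>P\<in>well_behaved_consistent_processes \<Omega> \<Q>. \<forall>t s. \<forall>u\<in>time_seqs_before t. \<forall>xu\<in>u \<rightarrow>\<^sub>E UNIV.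
    0 \<le> t \<longrightarrow> t \<le> s \<longrightarrow> transition_matrix \<Omega> P u xu t s = T t s"
proof -
  obtain P where P: "P \<in> stochastic_processes \<Omega>" and PT: "\<And>t s u xu. u \<in> time_seqs_before t \<Longrightarrow>
      xu \<in> u \<rightarrow>\<^sub>E UNIV \<Longrightarrow> 0 \<le> t \<Longrightarrow> t \<le> s \<Longrightarrow> transition_matrix \<Omega> P u xu t s = T t s"
    using ex_process[OF \<Omega> T] by blast
  have limits: "(\<exists>M\<in>\<Q>. ((\<lambda>h. (1 / h) *\<^sub>R (transition_matrix \<Omega> P u xu t (t + h) - mat 1)) \<longlongrightarrow> M) (at_right 0)) \<and>
     (t > 0 \<longrightarrow> (\<exists>M\<in>\<Q>. ((\<lambda>h. (1 / h) *\<^sub>R (transition_matrix \<Omega> P u xu (t - h) t - mat 1)) \<longlongrightarrow> M) (at_right 0)))"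
    if u: "u \<in> time_seqs_before t" "xu \<in> u \<rightarrow>\<^sub>E UNIV" "0 \<le> t" for t u xu
  proof (intro conjI impI)
    obtain M where M: "M \<in> \<Q>" "((\<lambda>h. (1 / h) *\<^sub>R (T t (t + h) - mat 1)) \<longlongrightarrow> M) (at_right 0)"
      using rates u(3) unfolding has_rates_in_def by blast
    have "eventually (\<lambda>h. (1 / h) *\<^sub>R (T t (t + h) - mat 1)
        = (1 / h) *\<^sub>R (transition_matrix \<Omega> P u xu t (t + h) - mat 1)) (at_right 0)"
      using eventually_at_right_less[of 0] by eventually_elim (use PT[OF u] in simp)
    from Lim_transform_eventually[OF M(2) this] M(1)
    show "\<exists>M\<in>\<Q>. ((\<lambda>h. (1 / h) *\<^sub>R (transition_matrix \<Omega> P u xu t (t + h) - mat 1)) \<longlongrightarrow> M) (at_right 0)"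
      by blast
  next
    assume t: "0 < t"
    obtain M where M: "M \<in> \<Q>" "((\<lambda>h. (1 / h) *\<^sub>R (T (t - h) t - mat 1)) \<longlongrightarrow> M) (at_right 0)"
      using rates u(3) t unfolding has_rates_in_def by blast
    have "eventually (\<lambda>h. (1 / h) *\<^sub>R (T (t - h) t - mat 1)
        = (1 / h) *\<^sub>R (transition_matrix \<Omega> P u xu (t - h) t - mat 1)) (at_right 0)"
      using eventually_before[OF u(1) t] by eventually_elim (use PT[OF _ u(2)] in auto)
    from Lim_transform_eventually[OF M(2) this] M(1)
    show "\<exists>M\<in>\<Q>. ((\<lambda>h. (1 / h) *\<^sub>R (transition_matrix \<Omega> P u xu (t - h) t - mat 1)) \<longlongrightarrow> M) (at_right 0)"
      by blast
  qed
  have finite: "Limsup (at_right 0) (\<lambda>h. ereal (1 / h * op_norm ((*v) (A h)))) < \<infinity>"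
    if "((\<lambda>h. (1 / h) *\<^sub>R A h) \<longlongrightarrow> M) (at_right 0)" for A :: "real \<Rightarrow> real ^ 'x ^ 'x" and M
  proof -
    have "eventually (\<lambda>h. norm ((1 / h) *\<^sub>R A h) < norm M + 1) (at_right 0)"
      using tendsto_norm[OF that] by (rule order_tendstoD) simp
    from eventually_mono[OF this less_imp_le] show ?thesis by (rule Limsup_op_norm_finite)
  qed
  have "well_behaved \<Omega> P"
    unfolding well_behaved_def
  proof (intro allI impI ballI conjI)
    fix t u and xu :: "real \<Rightarrow> 'x" assume u: "0 \<le> t" "u \<in> time_seqs_before t" "xu \<in> u \<rightarrow>\<^sub>E UNIV"
    from conjunct1[OF limits[OF u(2,3,1)]] obtain M
      where "((\<lambda>h. (1 / h) *\<^sub>R (transition_matrix \<Omega> P u xu t (t + h) - mat 1)) \<longlongrightarrow> M) (at_right 0)" ..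
    then show "Limsup (at_right 0) (\<lambda>h. ereal
        (1 / h * op_norm ((*v) (transition_matrix \<Omega> P u xu t (t + h) - mat 1)))) < \<infinity>"
      by (rule finite)
    assume "0 < t"
    from mp[OF conjunct2[OF limits[OF u(2,3,1)]] this] obtain M
      where "((\<lambda>h. (1 / h) *\<^sub>R (transition_matrix \<Omega> P u xu (t - h) t - mat 1)) \<longlongrightarrow> M) (at_right 0)" ..
    then show "Limsup (at_right 0) (\<lambda>h. ereal
        (1 / h * op_norm ((*v) (transition_matrix \<Omega> P u xu (t - h) t - mat 1)))) < \<infinity>"
      by (rule finite)
  qed
  moreover have "consistent \<Omega> \<Q> P"
    unfolding consistent_def
  proof (intro allI impI ballI subsetI)
    fix t u and xu :: "real \<Rightarrow> 'x" and N
    assume u: "0 \<le> t" "u \<in> time_seqs_before t" "xu \<in> u \<rightarrow>\<^sub>E UNIV" and "N \<in> outer_derivative \<Omega> P u xu t"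
    then obtain \<Delta> where \<Delta>: "\<And>i. 0 < \<Delta> i" "\<Delta> \<longlonglongrightarrow> 0" and
      N: "(\<lambda>i. (1 / \<Delta> i) *\<^sub>R (transition_matrix \<Omega> P u xu t (t + \<Delta> i) - mat 1)) \<longlonglongrightarrow> N \<or>
       t > 0 \<and> (\<lambda>i. (1 / \<Delta> i) *\<^sub>R (transition_matrix \<Omega> P u xu (t - \<Delta> i) t - mat 1)) \<longlonglongrightarrow> N"
      unfolding outer_derivative_def by blast
    have \<Delta>_at: "filterlim \<Delta> (at_right 0) sequentially"
      using \<Delta> by (simp add: tendsto_imp_filterlim_at_right)
    have in_Q: "N \<in> \<Q>" if seq: "(\<lambda>i. F (\<Delta> i)) \<longlonglongrightarrow> N" and lim: "\<exists>M\<in>\<Q>. (F \<longlongrightarrow> M) (at_right 0)" for F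
    proof -
      obtain M where M: "M \<in> \<Q>" "(F \<longlongrightarrow> M) (at_right 0)" using lim by blast
      have "N = M" using LIMSEQ_unique[OF seq filterlim_compose[OF M(2) \<Delta>_at]] .
      with M show ?thesis by simp
    qed
    from N show "N \<in> \<Q>"
    proof
      assume "(\<lambda>i. (1 / \<Delta> i) *\<^sub>R (transition_matrix \<Omega> P u xu t (t + \<Delta> i) - mat 1)) \<longlonglongrightarrow> N"
      then show ?thesis using conjunct1[OF limits[OF u(2,3,1)]] by (rule in_Q)
    next
      assume "t > 0 \<and> (\<lambda>i. (1 / \<Delta> i) *\<^sub>R (transition_matrix \<Omega> P u xu (t - \<Delta> i) t - mat 1)) \<longlonglongrightarrow> N"
      then show ?thesis using mp[OF conjunct2[OF limits[OF u(2,3,1)]]] by (intro in_Q) auto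
    qed
  qed
  ultimately have "P \<in> well_behaved_consistent_processes \<Omega> \<Q>"
    using P by (simp add: well_behaved_consistent_processes_def)
  with PT show ?thesis by blast
qed

lemma cond_expectation_eq:
  "cond_expectation \<Omega> P f s t x u xu = (transition_matrix \<Omega> P u xu t s *v f) $ x"
  by (simp add: cond_expectation_def transition_matrix_def matrix_vector_mult_def mult.commute)

context lipschitz_rate_operator
begin

theorem represents_well_behaved_consistent:
  assumes \<Omega>: "path_space \<Omega>"
  shows "represents \<Omega> Q (well_behaved_consistent_processes \<Omega> (dominating_rate_matrices Q))"
    (is "represents \<Omega> Q ?\<P>")
  unfolding represents_def
proof (intro conjI allI impI ballI)
  show "?\<P> \<noteq> {}"
    \<comment> \<open>Any transition family with dominating rates serves here; this instance is a
      means to obtain one.\<close>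
    using ex_family_near_corresponding[of 0 0 1 0] ex_process_with_rates[OF \<Omega>] by fastforce
  show "?\<P> \<subseteq> stochastic_processes \<Omega>" by (auto simp: well_behaved_consistent_processes_def)
  fix t s f u x and xu :: "real \<Rightarrow> 'x"
  assume u: "u \<in> time_seqs_before t" "xu \<in> u \<rightarrow>\<^sub>E UNIV" and ts: "0 \<le> t \<and> t \<le> s"
  have lower: "L t s f $ x \<le> cond_expectation \<Omega> P f s t x u xu" if "P \<in> ?\<P>" for P
    unfolding cond_expectation_eq using expectation_ge_corresponding[OF \<Omega> that u] ts by simp
  then have bdd: "bdd_below ((\<lambda>P. cond_expectation \<Omega> P f s t x u xu) ` ?\<P>)"
    by (intro bdd_belowI[of _ "L t s f $ x"]) auto
  show "lower_cond_expectation \<Omega> ?\<P> f s t x u xu = L t s f $ x"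
  proof (rule antisym)
    show "L t s f $ x \<le> lower_cond_expectation \<Omega> ?\<P> f s t x u xu"
      unfolding lower_cond_expectation_def using lower \<open>?\<P> \<noteq> {}\<close> by (intro cINF_greatest)
    show "lower_cond_expectation \<Omega> ?\<P> f s t x u xu \<le> L t s f $ x"
    proof (rule field_le_epsilon)
      fix \<epsilon> :: real assume "0 < \<epsilon>"
      obtain T where T: "transition_family T" "has_rates_in T (dominating_rate_matrices Q)"
        "infnorm (T t s *v f - L t s f) \<le> \<epsilon>"
        using ex_family_near_corresponding[OF _ _ \<open>0 < \<epsilon>\<close>, of t s f] ts by blast
      obtain P where P: "P \<in> ?\<P>" "transition_matrix \<Omega> P u xu t s = T t s"
        using ex_process_with_rates[OF \<Omega> T(1,2)] u ts by blast
      have "\<bar>(T t s *v f - L t s f) $ x\<bar> \<le> \<epsilon>" using T(3) unfolding infnorm_le_cart by blast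
      then have "cond_expectation \<Omega> P f s t x u xu \<le> L t s f $ x + \<epsilon>"
        unfolding cond_expectation_eq P(2) by simp
      moreover have "lower_cond_expectation \<Omega> ?\<P> f s t x u xu \<le> cond_expectation \<Omega> P f s t x u xu"
        unfolding lower_cond_expectation_def using bdd P(1) by (rule cINF_lower)
      ultimately show "lower_cond_expectation \<Omega> ?\<P> f s t x u xu \<le> L t s f $ x + \<epsilon>" by simp
    qed
  qed
qed

text \<open>Domination is one-sided, but \<open>A\<close> acts linearly: testing it at
  \<open>axis y 1\<close> and \<open>- axis y 1\<close> bounds each entry from both sides.\<close>

lemma increment_entry_bound:
  assumes dom: "\<And>f x. L a (a + h) f $ x \<le> (A *v f) $ x" and h: "0 < h" "h * C \<le> 1"
  shows "norm ((1 / h) *\<^sub>R (A - mat 1)) \<le> CARD('x) * (CARD('x) * (2 * C))"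
proof -
  have "\<bar>((1 / h) *\<^sub>R (A - mat 1)) $ x $ y\<bar> \<le> 2 * C" for x y
  proof -
    have low: "f $ x - 2 * C * h \<le> (A *v f) $ x" if "infnorm f \<le> 1" for f
    proof -
      have "infnorm (L a (a + h) f - f) \<le> 2 * C * h * infnorm f"
        using corresponding_near_id[of a "a + h" f] h by simp
      also have "\<dots> \<le> 2 * C * h * 1" using that h C_pos by (intro mult_left_mono) auto
      finally have "\<bar>(L a (a + h) f - f) $ x\<bar> \<le> 2 * C * h" by (simp add: infnorm_le_cart)
      then show ?thesis using dom[of f x] by simp
    qed
    have "infnorm (axis y 1 :: real ^ 'x) \<le> 1" by (auto simp: infnorm_le_cart axis_def)
    then have "axis y 1 $ x - 2 * C * h \<le> (A *v axis y 1) $ x"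
      "- axis y 1 $ x - 2 * C * h \<le> - ((A *v axis y 1) $ x)"
      using low[of "axis y 1"] low[of "- axis y 1"]
      by (simp_all add: infnorm_neg matrix_vector_mult_minus_distrib)
    moreover have "(A *v axis y 1) $ x = A $ x $ y" by (simp add: matrix_vector_mult_basis column_def)
    moreover have "axis y 1 $ x = (mat 1 :: real ^ 'x ^ 'x) $ x $ y" by (simp add: axis_def mat_def)
    ultimately have "\<bar>(A - mat 1) $ x $ y\<bar> \<le> 2 * C * h" by (simp add: abs_le_iff)
    then show ?thesis using h by (simp add: abs_mult field_simps)
  qed
  then have "norm ((1 / h) *\<^sub>R (A - mat 1)) \<le> (\<Sum>x\<in>(UNIV :: 'x set). \<Sum>y\<in>(UNIV :: 'x set). 2 * C)"
    by (intro order_trans[OF norm_matrix_le_sum] sum_mono)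
  then show ?thesis by simp
qed

text \<open>Up to a quadratic error \<open>L (a i) (b i) f - f\<close> is
  \<open>\<Delta> i *\<^sub>R Q f\<close>, so domination survives division by
  \<open>\<Delta> i\<close> and the limit. It is assumed eventually, because backward increments may
  leave the domain for large \<open>\<Delta> i\<close>.\<close>

lemma increment_limit_dominates:
  assumes \<Delta>: "\<And>i. 0 < \<Delta> i" "\<Delta> \<longlonglongrightarrow> 0" and ab: "\<And>i. b i = a i + \<Delta> i"
    and dom: "eventually (\<lambda>i. \<forall>f x. L (a i) (b i) f $ x \<le> (A i *v f) $ x) sequentially"
    and lim: "(\<lambda>i. (1 / \<Delta> i) *\<^sub>R (A i - mat 1)) \<longlonglongrightarrow> M" and M: "M \<in> rate_matrices"
  shows "M \<in> dominating_rate_matrices Q"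
proof -
  have "Q f $ x \<le> (M *v f) $ x" for f x
  proof (rule tendsto_le)
    have "(\<lambda>i. Q f $ x - C\<^sup>2 * \<Delta> i * infnorm f) \<longlonglongrightarrow> Q f $ x - C\<^sup>2 * 0 * infnorm f"
      by (intro tendsto_intros \<Delta>)
    then show "(\<lambda>i. Q f $ x - C\<^sup>2 * \<Delta> i * infnorm f) \<longlonglongrightarrow> Q f $ x" by simp
    show "(\<lambda>i. (((1 / \<Delta> i) *\<^sub>R (A i - mat 1)) *v f) $ x) \<longlonglongrightarrow> (M *v f) $ x"
      unfolding matrix_vector_mult_def vec_lambda_beta
      by (intro tendsto_intros lim)
    have "eventually (\<lambda>i. \<Delta> i < 1 / C) sequentially"
      using \<Delta>(2) by (rule order_tendstoD) (use C_pos in simp)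
    then show "eventually (\<lambda>i. Q f $ x - C\<^sup>2 * \<Delta> i * infnorm f \<le> (((1 / \<Delta> i) *\<^sub>R (A i - mat 1)) *v f) $ x) sequentially"
      using dom
    proof eventually_elim
      case (elim i)
      define h where "h = \<Delta> i"
      have h: "0 < h" "h * C \<le> 1" using elim \<Delta> C_pos by (auto simp: h_def field_simps)
      have "\<bar>(L (a i) (b i) f - f - h *\<^sub>R Q f) $ x\<bar> \<le> C\<^sup>2 * h\<^sup>2 * infnorm f"
        using corresponding_step[of "a i" "b i" f] h ab[of i] unfolding infnorm_le_cart h_def by simp
      moreover have "L (a i) (b i) f $ x \<le> (A i *v f) $ x" using elim by blast
      ultimately have "h * Q f $ x - C\<^sup>2 * h\<^sup>2 * infnorm f \<le> (A i *v f) $ x - f $ x" by simp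
      moreover have "(((1 / h) *\<^sub>R (A i - mat 1)) *v f) $ x = ((A i *v f) $ x - f $ x) / h"
        by (simp add: scaleR_matrix_vector_assoc[symmetric] matrix_vector_mult_diff_rdistrib)
      ultimately show ?case
        unfolding h_def[symmetric] using h by (simp only:) (simp add: field_simps power2_eq_square)
    qed
  qed simp
  with M show ?thesis by (simp add: dominating_rate_matrices_def less_eq_vec_def)
qed

theorem represents_maximal:
  assumes \<Omega>: "path_space \<Omega>" and rep: "represents \<Omega> Q \<P>" and P: "P \<in> \<P>"
  shows "P \<in> well_behaved_consistent_processes \<Omega> (dominating_rate_matrices Q)"
proof -
  have sp: "\<P> \<subseteq> stochastic_processes \<Omega>" using rep by (simp add: represents_def)
  have dom: "L t s f $ x \<le> (transition_matrix \<Omega> P u xu t s *v f) $ x"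
    if u: "u \<in> time_seqs_before t" "xu \<in> u \<rightarrow>\<^sub>E UNIV" "0 \<le> t" "t \<le> s" for u xu t s f x
  proof -
    \<comment> \<open>The infimum is a lower bound once the expectations are bounded below; this
      bound holds for all coherent processes, as their transition probabilities lie in
      \<open>[0, 1]\<close>.\<close>
    have "- (\<Sum>y\<in>UNIV. \<bar>f $ y\<bar>) \<le> cond_expectation \<Omega> P' f s t x u xu" if "P' \<in> \<P>" for P'
    proof -
      have "P' \<in> stochastic_processes \<Omega>" using that sp by blast
      note nonneg = transition_matrix_nonneg[OF \<Omega> this u] and le_1 = transition_matrix_le_1[OF \<Omega> this u]
      have "- \<bar>f $ y\<bar> \<le> transition_matrix \<Omega> P' u xu t s $ x $ y * f $ y" for y
      proof -
        have "transition_matrix \<Omega> P' u xu t s $ x $ y * - \<bar>f $ y\<bar> \<le> transition_matrix \<Omega> P' u xu t s $ x $ y * f $ y"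
          by (intro mult_left_mono nonneg) simp
        then show ?thesis using mult_right_mono[OF le_1[of x y], of "\<bar>f $ y\<bar>"] by simp
      qed
      then show ?thesis
        unfolding cond_expectation_eq matrix_vector_mult_def sum_negf[symmetric]
        by (simp add: sum_mono)
    qed
    then have "bdd_below ((\<lambda>P. cond_expectation \<Omega> P f s t x u xu) ` \<P>)"
      by (intro bdd_belowI[of _ "- (\<Sum>y\<in>UNIV. \<bar>f $ y\<bar>)"]) auto
    then have "lower_cond_expectation \<Omega> \<P> f s t x u xu \<le> cond_expectation \<Omega> P f s t x u xu"
      unfolding lower_cond_expectation_def using P by (rule cINF_lower)
    moreover have "lower_cond_expectation \<Omega> \<P> f s t x u xu = L t s f $ x"
      using rep u unfolding represents_def by blast
    ultimately show ?thesis unfolding cond_expectation_eq by simp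
  qed
  have small: "eventually (\<lambda>h. 0 < h \<and> h * C \<le> 1) (at_right 0)"
    unfolding eventually_at_right_field using C_pos
    by (intro exI[of _ "1 / C"]) (auto simp: field_simps)
  have "well_behaved \<Omega> P"
    unfolding well_behaved_def
  proof (intro allI impI ballI conjI)
    fix t u and xu :: "real \<Rightarrow> 'x" assume u: "0 \<le> t" "u \<in> time_seqs_before t" "xu \<in> u \<rightarrow>\<^sub>E UNIV"
    show "Limsup (at_right 0) (\<lambda>h. ereal (1 / h * op_norm ((*v) (transition_matrix \<Omega> P u xu t (t + h) - mat 1)))) < \<infinity>"
      using small
      by (intro Limsup_op_norm_finite, eventually_elim)
        (rule increment_entry_bound[where a = t], use dom[OF u(2,3,1)] in auto)
    assume t: "0 < t"
    show "Limsup (at_right 0) (\<lambda>h. ereal (1 / h * op_norm ((*v) (transition_matrix \<Omega> P u xu (t - h) t - mat 1)))) < \<infinity>"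
    proof (rule Limsup_op_norm_finite)
      show "eventually (\<lambda>h. norm ((1 / h) *\<^sub>R (transition_matrix \<Omega> P u xu (t - h) t - mat 1))
          \<le> CARD('x) * (CARD('x) * (2 * C))) (at_right 0)"
        using small eventually_before[OF u(2) t]
      proof eventually_elim
        case (elim h)
        then have "L (t - h) (t - h + h) f $ x \<le> (transition_matrix \<Omega> P u xu (t - h) t *v f) $ x" for f x
          using dom[of u "t - h" xu t] u(3) by simp
        then show ?case by (rule increment_entry_bound) (use elim in auto)
      qed
    qed
  qed
  moreover have "consistent \<Omega> (dominating_rate_matrices Q) P"
    unfolding consistent_def
  proof (intro allI impI ballI subsetI)
    fix t u and xu :: "real \<Rightarrow> 'x" and M
    assume u: "0 \<le> t" "u \<in> time_seqs_before t" "xu \<in> u \<rightarrow>\<^sub>E UNIV" and "M \<in> outer_derivative \<Omega> P u xu t"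
    then obtain \<Delta> where M: "M \<in> rate_matrices" and \<Delta>: "\<And>i. 0 < \<Delta> i" "\<Delta> \<longlonglongrightarrow> 0" and
      "(\<lambda>i. (1 / \<Delta> i) *\<^sub>R (transition_matrix \<Omega> P u xu t (t + \<Delta> i) - mat 1)) \<longlonglongrightarrow> M \<or>
       t > 0 \<and> (\<lambda>i. (1 / \<Delta> i) *\<^sub>R (transition_matrix \<Omega> P u xu (t - \<Delta> i) t - mat 1)) \<longlonglongrightarrow> M"
      unfolding outer_derivative_def by blast
    then consider
      (right) "(\<lambda>i. (1 / \<Delta> i) *\<^sub>R (transition_matrix \<Omega> P u xu t (t + \<Delta> i) - mat 1)) \<longlonglongrightarrow> M"
    | (left) "t > 0" "(\<lambda>i. (1 / \<Delta> i) *\<^sub>R (transition_matrix \<Omega> P u xu (t - \<Delta> i) t - mat 1)) \<longlonglongrightarrow> M" by blast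
    then show "M \<in> dominating_rate_matrices Q"
    proof cases
      case right
      show ?thesis
      proof (rule increment_limit_dominates[OF \<Delta> _ _ right M])
        show "eventually (\<lambda>i. \<forall>f x. L t (t + \<Delta> i) f $ x
            \<le> (transition_matrix \<Omega> P u xu t (t + \<Delta> i) *v f) $ x) sequentially"
          using dom[OF u(2,3,1)] \<Delta>(1) by (simp add: less_imp_le)
      qed simp
    next
      case left
      have "filterlim \<Delta> (at_right 0) sequentially"
        using \<Delta> by (simp add: tendsto_imp_filterlim_at_right)
      then have ev: "eventually (\<lambda>i. 0 < \<Delta> i \<and> 0 \<le> t - \<Delta> i \<and> u \<in> time_seqs_before (t - \<Delta> i)) sequentially"
        using eventually_before[OF u(2) left(1)] unfolding filterlim_iff by blast
      show ?thesis
      proof (rule increment_limit_dominates[OF \<Delta> _ _ left(2) M])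
        show "eventually (\<lambda>i. \<forall>f x. L (t - \<Delta> i) t f $ x
            \<le> (transition_matrix \<Omega> P u xu (t - \<Delta> i) t *v f) $ x) sequentially"
          using ev by eventually_elim (use dom[OF _ u(3)] in auto)
      qed simp
    qed
  qed
  ultimately show ?thesis
    using P sp by (auto simp: well_behaved_consistent_processes_def)
qed

end

theorem theorem8p4:
  fixes \<Omega> :: "(real \<Rightarrow> 'x::finite) set"
    and Q :: "real ^ 'x \<Rightarrow> real ^ 'x"
  assumes "path_space \<Omega>"
    and "lower_rate_operator Q"
  shows "represents \<Omega> Q (well_behaved_consistent_processes \<Omega> (dominating_rate_matrices Q)) \<and>
    (\<forall>\<P>. represents \<Omega> Q \<P> \<longrightarrow>
       \<P> \<subseteq> well_behaved_consistent_processes \<Omega> (dominating_rate_matrices Q))"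
proof -
  obtain C where "lipschitz_rate_operator Q C"
    using lower_rate_operator_lipschitz[OF assms(2)] by blast
  then interpret lipschitz_rate_operator Q C .
  show ?thesis
    using represents_well_behaved_consistent[OF assms(1)] represents_maximal[OF assms(1)] by blast
qed

end
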